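(* Let $\sigma,\tau:\mathbb R_+\to\mathbb R$ satisfy $\sup_{x>0}\int_x^{x+1}\sigma(t)^2\,dt<\infty$ and $\sup_{x>0}\int_x^{x+1}|\tau(t)|\,dt<\infty$, and fix $\alpha\in[0,\pi)$. Let $E_1<E_2$ be real and suppose that for some $p>2$, $$\liminf_{x\to\infty}\int_{E_1}^{E_2}\|T(E;x)\|^p\,dE<\infty.$$ Then $H^\alpha$ has purely absolutely continuous spectrum on $(E_1,E_2)$.
   Context: $\mathbb R_+=(0,\infty)$. For $u\in AC_{\mathrm{loc}}(\mathbb R_+)$ put $u^{[1]}:=u'-\sigma u$, let $\mathfrak D:=\{u\in AC_{\mathrm{loc}}(\mathbb R_+): u^{[1]}\in AC_{\mathrm{loc}}(\mathbb R_+)\}$ and, for $u\in\mathfrak D$, $\ell u:=-(u^{[1]})'-\sigma u^{[1]}+(\tau-\sigma^2)u$. The endpoint $0$ is regular, so $u(0),u^{[1]}(0)$ exist as limits whenever $u\in L^2(\mathbb R_+)\cap\mathfrak D$, $\ell u\in L^2(\mathbb R_+)$, or $\ell u=zu$; the endpoint $\infty$ is limit point. $H^\alpha$ is the self-adjoint operator in $L^2(\mathbb R_+)$ given by $H^\alpha u=\ell u$ on $\mathrm{dom}(H^\alpha)=\{u\in L^2(\mathbb R_+): u\in\mathfrak D,\ \ell u\in L^2(\mathbb R_+),\ u(0)\cos\alpha+u^{[1]}(0)\sin\alpha=0\}$. The transfer matrix $T(z;x)$ is the locally absolutely continuous (in $x$) solution of $$\partial_xT(z;x)=\begin{pmatrix}-\sigma(x)&\tau(x)-\sigma(x)^2-z\\1&\sigma(x)\end{pmatrix}T(z;x),\qquad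 T(z;0)=I.$$ For $z\in\mathbb C\setminus\mathbb R$ there is, up to multiples, a unique nontrivial solution $\psi_z\in L^2(\mathbb R_+)$ of $\ell\psi_z=z\psi_z$; set $$m_\alpha(z)=\frac{\cos(\alpha)\psi_z^{[1]}(0)-\sin(\alpha)\psi_z(0)}{\sin(\alpha)\psi_z^{[1]}(0)+\cos(\alpha)\psi_z(0)},$$ a Herglotz function. The spectral measure $\mu^\alpha$ is the Borel measure on $\mathbb R$ with $\mu^\alpha((\lambda_1,\lambda_2])=\lim_{\delta\downarrow0}\lim_{\varepsilon\downarrow0}\frac1\pi\int_{\lambda_1+\delta}^{\lambda_2+\delta}\mathrm{Im}\,m_\alpha(\lambda+i\varepsilon)\,d\lambda$ for $\lambda_1<\lambda_2$; $H^\alpha$ is unitarily equivalent to multiplication by the independent variable in $L^2(\mathbb R,\mu^\alpha)$. Purely absolutely continuous spectrum on an interval $I$ means that the restriction of $\mu^\alpha$ to $I$ is absolutely continuous with respect to Lebesgue measure. *)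

theory Defs
  imports "HOL-Analysis.Analysis"
begin

section \<open>Absolute continuity and square integrability\<close>

text \<open>
  Epsilon-delta absolute continuity. A finite family of non-overlapping subintervals of
  \<open>S\<close> is a division \<open>D\<close> of its union; \<open>u (Sup K) - u (Inf K)\<close> is the increment of \<open>u\<close> over \<open>K\<close>.
\<close>

definition abs_cont_on :: "real set \<Rightarrow> (real \<Rightarrow> 'a::real_normed_vector) \<Rightarrow> bool" where
  "abs_cont_on S u \<longleftrightarrow>
     (\<forall>\<epsilon>>0. \<exists>\<delta>>0. \<forall>D. D division_of (\<Union>D) \<and> \<Union>D \<subseteq> S \<and> (\<Sum>K\<in>D. Sup K - Inf K) < \<delta> \<longrightarrow>
        (\<Sum>K\<in>D. norm (u (Sup K) - u (Inf K))) < \<epsilon>)"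

definition AC_loc :: "real set \<Rightarrow> (real \<Rightarrow> 'a::real_normed_vector) \<Rightarrow> bool" where
  "AC_loc S u \<longleftrightarrow> (\<forall>a b. {a..b} \<subseteq> S \<longrightarrow> abs_cont_on {a..b} u)"

definition L2_halfline :: "(real \<Rightarrow> complex) \<Rightarrow> bool" where
  "L2_halfline u \<longleftrightarrow> u \<in> borel_measurable (lebesgue_on {0<..}) \<and>
     integrable (lebesgue_on {0<..}) (\<lambda>x. (cmod (u x))\<^sup>2)"

section \<open>The differential expression and its self-adjoint realizations\<close>

text \<open>
  The half-line is \<open>{0<..}\<close>; the values of all functions at \<open>x \<le> 0\<close> are irrelevant.
  Since \<open>u' - \<sigma> u\<close> is only defined almost everywhere, membership of \<open>u\<close> in \<open>\<DD>\<close> means that it has a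
  locally absolutely continuous representative \<open>v\<close>, which is then unique on \<open>{0<..}\<close>.
\<close>

definition has_quasi_deriv ::
  "(real \<Rightarrow> real) \<Rightarrow> (real \<Rightarrow> complex) \<Rightarrow> (real \<Rightarrow> complex) \<Rightarrow> bool" where
  "has_quasi_deriv \<sigma> u v \<longleftrightarrow> AC_loc {0<..} u \<and> AC_loc {0<..} v \<and>
     (AE x in lebesgue_on {0<..}.
        \<exists>d. (u has_vector_derivative d) (at x) \<and> v x = d - \<sigma> x * u x)"

definition \<DD> :: "(real \<Rightarrow> real) \<Rightarrow> (real \<Rightarrow> complex) set" where
  "\<DD> \<sigma> = {u. \<exists>v. has_quasi_deriv \<sigma> u v}"

definition quasi_deriv :: "(real \<Rightarrow> real) \<Rightarrow> (real \<Rightarrow> complex) \<Rightarrow> real \<Rightarrow> complex" where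
  "quasi_deriv \<sigma> u = (SOME v. has_quasi_deriv \<sigma> u v)"

text \<open>\<open>has_ell \<sigma> \<tau> u f\<close>: \<open>u\<close> lies in \<open>\<DD>\<close> and \<open>\<ell> u = f\<close> almost everywhere.\<close>

definition has_ell ::
  "(real \<Rightarrow> real) \<Rightarrow> (real \<Rightarrow> real) \<Rightarrow> (real \<Rightarrow> complex) \<Rightarrow> (real \<Rightarrow> complex) \<Rightarrow> bool" where
  "has_ell \<sigma> \<tau> u f \<longleftrightarrow> u \<in> \<DD> \<sigma> \<and>
     (AE x in lebesgue_on {0<..}.
        \<exists>d. (quasi_deriv \<sigma> u has_vector_derivative d) (at x) \<and>
            f x = - d - \<sigma> x * quasi_deriv \<sigma> u x + (\<tau> x - (\<sigma> x)\<^sup>2) * u x)"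

definition val0 :: "(real \<Rightarrow> complex) \<Rightarrow> complex" where
  "val0 u = Lim (at_right 0) u"

text \<open>
  The operator with boundary condition \<open>\<alpha>\<close> at \<open>0\<close>, given by its graph; elements of the
  Hilbert space are represented by functions.
\<close>

definition H :: "(real \<Rightarrow> real) \<Rightarrow> (real \<Rightarrow> real) \<Rightarrow> real \<Rightarrow> ((real \<Rightarrow> complex) \<times> (real \<Rightarrow> complex)) set" where
  "H \<sigma> \<tau> \<alpha> = {(u, f). L2_halfline u \<and> has_ell \<sigma> \<tau> u f \<and> L2_halfline f \<and>
     val0 u * cos \<alpha> + val0 (quasi_deriv \<sigma> u) * sin \<alpha> = 0}"

section \<open>Transfer matrices\<close>

definition coeff_matrix :: "(real \<Rightarrow> real) \<Rightarrow> (real \<Rightarrow> real) \<Rightarrow> complex \<Rightarrow> real \<Rightarrow> complex^2^2" where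
  "coeff_matrix \<sigma> \<tau> z x =
     vector [vector [of_real (- \<sigma> x), of_real (\<tau> x - (\<sigma> x)\<^sup>2) - z],
             vector [1, of_real (\<sigma> x)]]"

text \<open>The solution is unique on \<open>{0..}\<close>; only its values there are used.\<close>

definition transfer_matrix ::
  "(real \<Rightarrow> real) \<Rightarrow> (real \<Rightarrow> real) \<Rightarrow> complex \<Rightarrow> real \<Rightarrow> complex^2^2" where
  "transfer_matrix \<sigma> \<tau> z = (SOME T. AC_loc {0..} T \<and> T 0 = mat 1 \<and>
     (AE x in lebesgue_on {0<..}.
        (T has_vector_derivative (coeff_matrix \<sigma> \<tau> z x ** T x)) (at x)))"

definition mat_norm :: "complex^2^2 \<Rightarrow> real" where
  "mat_norm A = onorm (\<lambda>v. A *v v)"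

section \<open>Weyl function, spectral measure, absolutely continuous spectrum\<close>

text \<open>
  For nonreal \<open>z\<close> the Weyl solution is unique up to a nonzero factor, of which \<open>m_fun\<close> is independent.
\<close>

definition weyl_sol :: "(real \<Rightarrow> real) \<Rightarrow> (real \<Rightarrow> real) \<Rightarrow> complex \<Rightarrow> real \<Rightarrow> complex" where
  "weyl_sol \<sigma> \<tau> z = (SOME \<psi>. L2_halfline \<psi> \<and> (\<exists>x>0. \<psi> x \<noteq> 0) \<and>
     has_ell \<sigma> \<tau> \<psi> (\<lambda>x. z * \<psi> x))"

definition m_fun :: "(real \<Rightarrow> real) \<Rightarrow> (real \<Rightarrow> real) \<Rightarrow> real \<Rightarrow> complex \<Rightarrow> complex" where
  "m_fun \<sigma> \<tau> \<alpha> z =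
     (let p0 = val0 (weyl_sol \<sigma> \<tau> z); p1 = val0 (quasi_deriv \<sigma> (weyl_sol \<sigma> \<tau> z))
      in (cos \<alpha> * p1 - sin \<alpha> * p0) / (sin \<alpha> * p1 + cos \<alpha> * p0))"

text \<open>
  \<open>L \<delta>\<close> is the inner limit; it is required to exist (only \<open>\<delta>\<close> near \<open>0\<close> matter).
\<close>

definition is_spectral_measure ::
  "(real \<Rightarrow> real) \<Rightarrow> (real \<Rightarrow> real) \<Rightarrow> real \<Rightarrow> real measure \<Rightarrow> bool" where
  "is_spectral_measure \<sigma> \<tau> \<alpha> \<mu> \<longleftrightarrow> sets \<mu> = sets borel \<and>
     (\<forall>a b. a < b \<longrightarrow> emeasure \<mu> {a<..b} < \<infinity> \<and>
       (\<exists>L. (\<forall>\<^sub>F \<delta> in at_right 0.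
               ((\<lambda>\<epsilon>. 1 / pi * (LINT E:{a+\<delta>..b+\<delta>}|lborel. Im (m_fun \<sigma> \<tau> \<alpha> (Complex E \<epsilon>))))
                 \<longlongrightarrow> L \<delta>) (at_right 0)) \<and>
            (L \<longlongrightarrow> measure \<mu> {a<..b}) (at_right 0)))"

definition spectral_measure :: "(real \<Rightarrow> real) \<Rightarrow> (real \<Rightarrow> real) \<Rightarrow> real \<Rightarrow> real measure" where
  "spectral_measure \<sigma> \<tau> \<alpha> = (THE \<mu>. is_spectral_measure \<sigma> \<tau> \<alpha> \<mu>)"

text \<open>
  Purely absolutely continuous spectrum on \<open>I\<close> of the operator \<open>H \<sigma> \<tau> \<alpha>\<close>, which is unitarily
  equivalent to multiplication by the independent variable in the L2 space of its spectral measure.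
\<close>

definition purely_ac_spectrum_on ::
  "(real \<Rightarrow> real) \<Rightarrow> (real \<Rightarrow> real) \<Rightarrow> real \<Rightarrow> real set \<Rightarrow> bool" where
  "purely_ac_spectrum_on \<sigma> \<tau> \<alpha> I \<longleftrightarrow>
     absolutely_continuous (restrict_space lborel I) (restrict_space (spectral_measure \<sigma> \<tau> \<alpha>) I)"

end

theory Submission
  imports Defs "HOL-Complex_Analysis.Cauchy_Integral_Formula" "HOL-Probability.Helly_Selection"
begin

text \<open>
  Truncate the problem at \<open>L\<close> with the boundary condition \<open>u\<^sup>[\<^sup>1\<^sup>](L) = \<i> u(L)\<close>. Its Weyl function \<open>m\<^sub>L\<close>
  is holomorphic near the closed upper half-plane, and on the real line Carmona's formula and the
  constancy of the Wronskian give \<open>0 < Im m\<^sub>L(E) = 1 / (\<bar>\<phi>(L)\<bar>\<^sup>2 + \<bar>\<phi>\<^sup>[\<^sup>1\<^sup>](L)\<bar>\<^sup>2) \<le> \<parallel>T(E;L)\<parallel>\<^sup>2\<close>, where \<open>\<phi>\<close>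
  satisfies the boundary condition at \<open>0\<close>. A square-integrable solution decays together with its
  quasi-derivative, because the coefficients are uniformly locally integrable; hence
  \<open>m\<^sub>L(z) \<rightarrow> m\<^sub>\<alpha>(z)\<close> for \<open>Im z > 0\<close> as \<open>L \<rightarrow> \<infinity>\<close>. Along a sequence of truncations realizing the lower limit
  the densities \<open>Im m\<^sub>L(E)\<close> are bounded in \<open>L\<^sup>p\<^sup>/\<^sup>2\<close> on \<open>(E\<^sub>1, E\<^sub>2)\<close>. Transported to the unit circle,
  the corresponding measures have a weak limit, which yields the Herglotz representation of
  \<open>m\<^sub>\<alpha>\<close>, hence the spectral measure by Stieltjes inversion; since \<open>p/2 > 1\<close>, the bound prevents the limit
  from charging Lebesgue null subsets of \<open>(E\<^sub>1, E\<^sub>2)\<close>.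
\<close>

section \<open>The Poisson formula and weak limits of densities\<close>

text \<open>A real boundary condition at \<open>L\<close> would give discrete spectrum, that is,
  atoms instead of densities. The condition with \<i> is not self-adjoint, and by Green's identity
  its sign keeps all zeros of the denominator of \<open>mL\<close> out of the closed upper
  half-plane. Since Im of \<open>mL\<close> is quadratic in the transfer matrix, the exponent left
  over is q = p / 2; boundedness in L^1 alone would let the densities concentrate at points. The
  circle is used for compactness: normalised by their values at \<i>, all measures are probability
  measures on one compact interval of angles and Helly's theorem applies. The price is the boundary
  point 1, the image of infinity. Mass collecting there is the linear term of the Herglotz
  representation; it has to be carried through the Poisson integral and then gives nothing to the
  spectral measure. The coefficients are only measurable and locally integrable, so solutions are
  absolutely continuous and no better. Product rule, Gronwall's inequality, Picard iteration and
  Green's identity all rest on the fundamental theorem of calculus for the epsilon-delta notion of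
  absolute continuity.\<close>

definition poisson :: "complex \<Rightarrow> real \<Rightarrow> real" where
  "poisson w \<theta> = (1 - (cmod w)\<^sup>2) / (cmod (cis \<theta> - w))\<^sup>2"

text \<open>For nonzero \<open>w\<close> the second summand is minus the Cauchy kernel of the
  reflected point 1 / cnj w. Adding it to the Cauchy kernel at \<open>w\<close> makes the product
  with cis \<theta> real on the circle.\<close>

lemma poisson_kernel_eq:
  assumes "cmod w < 1"
  shows "cis \<theta> * (1 / (cis \<theta> - w) + cnj w / (1 - cnj w * cis \<theta>)) = of_real (poisson w \<theta>)"
proof -
  have c: "cis \<theta> * cnj (cis \<theta>) = 1" "cnj (cis \<theta>) * cis \<theta> = 1"
    by (simp_all add: cis_cnj cis_mult)
  have ne: "cis \<theta> - w \<noteq> 0" using assms by auto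
  have ne': "cnj (cis \<theta>) - cnj w \<noteq> 0" using ne by (metis complex_cnj_diff complex_cnj_zero_iff)
  have e: "1 - cnj w * cis \<theta> = cis \<theta> * (cnj (cis \<theta>) - cnj w)"
    using c by (simp add: algebra_simps)
  have "cis \<theta> * (1 / (cis \<theta> - w) + cnj w / (1 - cnj w * cis \<theta>)) 
      = cis \<theta> / (cis \<theta> - w) + cnj w / (cnj (cis \<theta>) - cnj w)"
    unfolding e using c by (simp add: distrib_left)
  also have "\<dots> = (cis \<theta> * (cnj (cis \<theta>) - cnj w) + cnj w * (cis \<theta> - w)) / ((cis \<theta> - w) * (cnj (cis \<theta>) - cnj w))"
    using ne ne' by (simp add: field_simps)
  also have "cis \<theta> * (cnj (cis \<theta>) - cnj w) + cnj w * (cis \<theta> - w) = 1 - w * cnj w"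
    using c by (simp add: algebra_simps)
  also have "(cis \<theta> - w) * (cnj (cis \<theta>) - cnj w) = of_real ((cmod (cis \<theta> - w))\<^sup>2)"
    by (metis complex_cnj_diff complex_norm_square)
  also have "1 - w * cnj w = of_real (1 - (cmod w)\<^sup>2)"
    by (simp add: complex_norm_square[symmetric])
  finally show ?thesis by (simp add: poisson_def)
qed

lemma poisson_nonneg: "cmod w < 1 \<Longrightarrow> 0 \<le> poisson w \<theta>"
  unfolding poisson_def by (simp add: power_le_one)

lemma isCont_poisson: "cmod w < 1 \<Longrightarrow> isCont (poisson w) \<theta>"
proof -
  assume "cmod w < 1"
  hence "cis \<theta> \<noteq> w" for \<theta> by auto
  thus ?thesis unfolding poisson_def
    unfolding cis_conv_exp by (intro continuous_intros) (auto simp: cis_conv_exp[symmetric])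
qed

lemma poisson_bounded: "cmod w < 1 \<Longrightarrow> \<bar>poisson w \<theta>\<bar> \<le> 1 / (1 - cmod w)\<^sup>2"
proof -
  assume w: "cmod w < 1"
  have "1 - cmod w \<le> cmod (cis \<theta> - w)"
    using norm_triangle_ineq2[of "cis \<theta>" w] by simp
  hence "(1 - cmod w)\<^sup>2 \<le> (cmod (cis \<theta> - w))\<^sup>2" using w by (intro power_mono) auto
  moreover have "1 - (cmod w)\<^sup>2 \<le> 1" by simp
  ultimately have "poisson w \<theta> \<le> 1 / (1 - cmod w)\<^sup>2"
    unfolding poisson_def using w by (intro frac_le) auto
  thus ?thesis using poisson_nonneg[OF w] by simp
qed

text \<open>Cauchy's formula at \<open>w\<close> plus Cauchy's theorem for the kernel of the
  reflected point, whose pole lies outside the closed disc. The second integral is 0 and serves to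
  make the kernel real, after which real parts pass under the integral.\<close>

lemma poisson_formula:
  assumes G: "G holomorphic_on ball 0 R" and R: "1 < R" and w: "cmod w < 1"
  shows "((\<lambda>\<theta>. Re (G (cis \<theta>)) * poisson w \<theta>) has_integral 2 * pi * Re (G w)) {0..2*pi}"
proof -
  have sub: "cball 0 1 \<subseteq> ball (0::complex) R" using R by auto
  have 1: "((\<lambda>u. G u / (u - w)) has_contour_integral 2 * of_real pi * \<i> * G w) (circlepath 0 1)"
    by (rule Cauchy_integral_circlepath)
      (use w in \<open>auto intro: holomorphic_on_imp_continuous_on[OF holomorphic_on_subset[OF G sub]]
          holomorphic_on_subset[OF G order_trans[OF ball_subset_cball sub]]\<close>)
  \<comment> \<open>The radius is at most the modulus 1 / cmod w of the reflected pole but still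
    above 1; for w = 0 there is no pole.\<close>
  define R' where "R' = (if w = 0 then R else min R (1 / cmod w))"
  have R': "1 < R'" using w R by (auto simp: R'_def field_simps)
  have nz: "1 - cnj w * u \<noteq> 0" if "u \<in> ball 0 R'" for u
  proof
    assume "1 - cnj w * u = 0"
    hence "cnj w * u = 1" by (simp add: algebra_simps)
    hence "cmod w * cmod u = 1" by (metis complex_mod_cnj norm_mult norm_one)
    moreover have "w \<noteq> 0" using \<open>cnj w * u = 1\<close> by auto
    ultimately show False using that by (auto simp: R'_def field_simps)
  qed
  have 2: "((\<lambda>u. G u * cnj w / (1 - cnj w * u)) has_contour_integral 0) (circlepath 0 1)"
  proof (rule Cauchy_theorem_disc_simple[of _ 0 R'])
    show "(\<lambda>u. G u * cnj w / (1 - cnj w * u)) holomorphic_on ball 0 R'"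
      by (intro holomorphic_intros holomorphic_on_subset[OF G])
        (use nz in \<open>auto simp: R'_def split: if_splits\<close>)
    show "path_image (circlepath 0 1) \<subseteq> ball (0::complex) R'"
      using R' by (auto simp: path_image_circlepath)
  qed auto
  from has_contour_integral_add[OF 1 2]
  have "((\<lambda>t. (G (cis t) / (cis t - w) + G (cis t) * cnj w / (1 - cnj w * cis t)) * \<i> * cis t)
     has_integral 2 * of_real pi * \<i> * G w) {0..2*pi}"
    unfolding circlepath_def by (subst (asm) has_contour_integral_part_circlepath_iff) auto
  hence "((\<lambda>t. (1/\<i>) * ((G (cis t) / (cis t - w) + G (cis t) * cnj w / (1 - cnj w * cis t)) * \<i> * cis t))
     has_integral (1/\<i>) * (2 * of_real pi * \<i> * G w)) {0..2*pi}"
    by (rule has_integral_mult_right)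
  also have "(\<lambda>t. (1/\<i>) * ((G (cis t) / (cis t - w) + G (cis t) * cnj w / (1 - cnj w * cis t)) * \<i> * cis t))
     = (\<lambda>t. G (cis t) * of_real (poisson w t))"
    by (rule ext, subst poisson_kernel_eq[OF w, symmetric]) (simp add: algebra_simps)
  finally have "((\<lambda>t. Re (G (cis t) * of_real (poisson w t))) has_integral Re (2 * of_real pi * G w)) {0..2*pi}"
    by (intro has_integral_Re) (simp add: mult_ac)
  thus ?thesis by simp
qed

text \<open>Helly selection: all measures live on one compact interval, so they are tight. The
  support of the limit is recovered afterwards from a suitable test function.\<close>

lemma weak_limit_of_densities:
  fixes f :: "nat \<Rightarrow> real \<Rightarrow> real"
  assumes cont: "\<And>n. continuous_on {a..b} (f n)" and nn: "\<And>n x. x \<in> {a..b} \<Longrightarrow> 0 \<le> f n x"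
    and int: "\<And>n. (f n has_integral 1) {a..b}" and ab: "a \<le> b"
  shows "\<exists>s \<nu>. strict_mono s \<and> real_distribution \<nu> \<and> (AE x in \<nu>. x \<in> {a..b}) \<and>
    (\<forall>F B. (\<forall>x. isCont F x) \<longrightarrow> (\<forall>x. \<bar>F x\<bar> \<le> B) \<longrightarrow>
       (\<lambda>n. integral {a..b} (\<lambda>x. F x * f (s n) x)) \<longlonglongrightarrow> integral\<^sup>L \<nu> F)"
proof -
  define d where "d n x = (indicator {a..b} x * f n x :: real)" for n x
  define M where "M n = density lborel (\<lambda>x. ennreal (d n x))" for n
  have dm[measurable]: "d n \<in> borel_measurable borel" for n
  proof -
    have "(\<lambda>x. indicator {a..b} x *\<^sub>R f n x) \<in> borel_measurable borel"
      by (rule borel_measurable_continuous_on_indicator) (use cont in auto)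
    thus ?thesis by (simp add: d_def[abs_def])
  qed
  have dnn: "0 \<le> d n x" for n x using nn by (auto simp: d_def indicator_def)
  have inte: "set_integrable lborel {a..b} (\<lambda>x. F x * f n x)"
    and ieq: "integral\<^sup>L (M n) F = integral {a..b} (\<lambda>x. F x * f n x)"
    if F: "\<And>x. isCont F x" for F :: "real \<Rightarrow> real" and n
  proof -
    have "continuous_on {a..b} F" using F continuous_at_imp_continuous_on by blast
    thus i: "set_integrable lborel {a..b} (\<lambda>x. F x * f n x)"
      by (intro borel_integrable_atLeastAtMost' continuous_intros cont)
    have [measurable]: "F \<in> borel_measurable borel"
      using F by (simp add: borel_measurable_continuous_onI continuous_at_imp_continuous_on)
    have "integral\<^sup>L (M n) F = (\<integral>x. d n x *\<^sub>R F x \<partial>lborel)"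
      unfolding M_def by (rule integral_density) (use dnn in auto)
    also have "\<dots> = (LINT x:{a..b}|lborel. F x * f n x)"
      unfolding set_lebesgue_integral_def d_def by (simp add: mult_ac)
    also have "\<dots> = integral {a..b} (\<lambda>x. F x * f n x)"
      by (rule set_borel_integral_eq_integral(2)[OF i])
    finally show "integral\<^sup>L (M n) F = integral {a..b} (\<lambda>x. F x * f n x)" .
  qed
  have em: "emeasure (M n) A = 1" if A: "{a..b} \<subseteq> A" "A \<in> sets borel" for n A
  proof -
    have "emeasure (M n) A = (\<integral>\<^sup>+x. ennreal (d n x) * indicator A x \<partial>lborel)"
      unfolding M_def using A by (subst emeasure_density) auto
    also have "\<dots> = (\<integral>\<^sup>+x. ennreal (d n x) \<partial>lborel)"
      using A by (intro nn_integral_cong) (auto simp: indicator_def d_def)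
    also have "\<dots> = ennreal (\<integral>x. d n x \<partial>lborel)"
      using inte[of "\<lambda>_. 1" n] dnn
      by (intro nn_integral_eq_integral) (auto simp: set_integrable_def d_def[abs_def])
    also have "(\<integral>x. d n x \<partial>lborel) = integral {a..b} (f n)"
      using set_borel_integral_eq_integral(2)[OF inte[of "\<lambda>_. 1" n]]
      by (simp add: set_lebesgue_integral_def d_def[abs_def])
    also have "\<dots> = 1" using int by (rule integral_unique)
    finally show ?thesis by simp
  qed
  have rd: "real_distribution (M n)" for n
  proof -
    have "prob_space (M n)" by (rule prob_spaceI) (use em[of UNIV] in \<open>simp add: M_def\<close>)
    thus ?thesis by (simp add: real_distribution_def real_distribution_axioms_def M_def)
  qed
  have "tight M" unfolding tight_def
  proof (intro conjI allI impI rd)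
    fix e :: real assume "e > 0"
    have "measure (M n) {a-1<..b} = 1" for n
      using em[of "{a-1<..b}" n] by (simp add: measure_def subset_iff)
    thus "\<exists>a b. a < b \<and> (\<forall>n. 1 - e < measure (M n) {a<..b})"
      using ab \<open>e > 0\<close> by (intro exI[of _ "a-1"] exI[of _ b]) auto
  qed
  from tight_imp_convergent_subsubsequence[OF this, of id]
  obtain s \<nu> where s: "strict_mono s" and nu: "real_distribution \<nu>" and wc: "weak_conv_m (M \<circ> id \<circ> s) \<nu>"
    by (auto simp: strict_mono_def)
  interpret nu: real_distribution \<nu> by fact
  have lim: "(\<lambda>n. integral {a..b} (\<lambda>x. F x * f (s n) x)) \<longlonglongrightarrow> integral\<^sup>L \<nu> F"
    if F: "\<And>x. isCont F x" "\<And>x. \<bar>F x\<bar> \<le> B" for F B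
    using weak_conv_imp_integral_bdd_continuous_conv[OF _ nu wc, of F B] rd F ieq[of F] by simp
  have "AE x in \<nu>. x \<in> {a..b}"
  proof -
    \<comment> \<open>A bounded continuous function that vanishes exactly on {a..b}; its integral
      being 0 forces \<open>\<nu>\<close> to live there.\<close>
    define F where "F x = min 1 (max 0 (max (a - x) (x - b)))" for x
    have F: "isCont F x" "\<bar>F x\<bar> \<le> 1" "0 \<le> F x" for x unfolding F_def by (auto intro!: continuous_intros)
    have "integral {a..b} (\<lambda>x. F x * f (s n) x) = integral {a..b} (\<lambda>x. 0)" for n
      by (rule integral_cong) (auto simp: F_def)
    hence "(\<lambda>n. 0) \<longlonglongrightarrow> integral\<^sup>L \<nu> F" using lim[of F 1] F by simp
    hence z: "integral\<^sup>L \<nu> F = 0" by (simp add: LIMSEQ_const_iff)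
    have Fm[measurable]: "F \<in> borel_measurable borel" unfolding F_def by measurable
    have "integrable \<nu> F" by (rule nu.integrable_const_bound[of _ 1]) (use F in auto)
    hence "AE x in \<nu>. F x = 0"
      using integral_nonneg_eq_0_iff_AE[of \<nu> F] z F by simp
    thus ?thesis by eventually_elim (auto simp: F_def min_def max_def split: if_splits)
  qed
  with s nu lim show ?thesis by blast
qed

text \<open>For \<open>0 \<le> F \<le> 1\<close> and \<open>M > 0\<close> one has \<open>F w \<le> M F + M\<^sup>1\<^sup>-\<^sup>q w\<^sup>q\<close>. Taking for \<open>F\<close> functions that decrease to the
  indicator of a compact null set and then letting \<open>M \<rightarrow> \<infinity>\<close> replaces Hoelder's inequality.\<close>

lemma weak_limit_null_set:
  fixes f w :: "nat \<Rightarrow> real \<Rightarrow> real"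
  assumes nu: "real_distribution \<nu>"
    and lim: "\<And>F B. (\<And>x. isCont F x) \<Longrightarrow> (\<And>x. \<bar>F x\<bar> \<le> B) \<Longrightarrow>
       (\<lambda>n. integral {a..b} (\<lambda>x. F x * f n x)) \<longlonglongrightarrow> integral\<^sup>L \<nu> F"
    and sub: "a \<le> c" "d \<le> b"
    and fc: "\<And>n. continuous_on {a..b} (f n)"
    and wc: "\<And>n. continuous_on {c..d} (w n)"
    and w0: "\<And>n x. x \<in> {c..d} \<Longrightarrow> 0 \<le> w n x"
    and fw: "\<And>n x. x \<in> {c..d} \<Longrightarrow> f n x \<le> k * (1 + w n x)" and k: "0 \<le> k"
    and q: "1 < q" and C: "\<And>n. integral {c..d} (\<lambda>x. w n x powr q) \<le> C"
    and N: "N \<in> null_sets lborel" "N \<subseteq> {c<..<d}"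
  shows "emeasure \<nu> N = 0"
proof -
  interpret nu: real_distribution \<nu> by fact
  have Nb: "N \<in> sets borel" using N by auto
  have comp: "emeasure \<nu> K = 0" if K: "compact K" "K \<subseteq> N" for K
  proof (cases "K = {}")
    case False
    have Kb: "K \<in> sets borel" using K(1) by (simp add: borel_compact)
    have Knull: "K \<in> null_sets lborel"
      using null_sets_subset[OF N(1) _ K(2)] Kb by simp
    have Kcd: "K \<subseteq> {c<..<d}" using K N by auto
    \<comment> \<open>A collar around \<open>K\<close> inside the open interval: for j >= 1 / \<eta>
      the function \<open>F j\<close> vanishes off {c<..<d}, and only on {c..d} is
      \<open>f n\<close> controlled by \<open>w n\<close>.\<close>
    obtain \<eta> where eta: "\<eta> > 0" "\<And>x. infdist x K \<le> \<eta> \<Longrightarrow> x \<in> {c<..<d}"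
    proof -
      obtain e where e: "e > 0" "(\<Union>x\<in>K. cball x e) \<subseteq> {c<..<d}"
        using compact_subset_open_imp_cball_epsilon_subset[OF K(1) _ Kcd] by auto
      have "x \<in> {c<..<d}" if "infdist x K \<le> e" for x
      proof -
        obtain y where "y \<in> K" "infdist x K = dist x y"
          using infdist_attains_inf[of K x] K(1) False compact_imp_closed by auto
        thus ?thesis using that e by (auto simp: dist_commute subset_iff)
      qed
      with e show ?thesis using that by blast
    qed
    define F where "F j x = max 0 (1 - real j * infdist x K)" for j x
    have Fc: "isCont (F j) x" for j x unfolding F_def by (intro continuous_intros)
    have F01: "0 \<le> F j x" "F j x \<le> 1" for j x unfolding F_def by (auto simp: infdist_nonneg)
    have Fco: "continuous_on S (F j)" for S j using Fc continuous_at_imp_continuous_on by blast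
    have F1: "F j x = 1" if "x \<in> K" for j x using that by (simp add: F_def)
    have F0: "(\<lambda>j. F j x) \<longlonglongrightarrow> indicator K x" for x
    proof (cases "x \<in> K")
      case True thus ?thesis by (simp add: F1)
    next
      case nx: False
      hence p: "infdist x K > 0"
        using K(1) False by (metis compact_imp_closed in_closed_iff_infdist_zero infdist_nonneg less_eq_real_def)
      have "eventually (\<lambda>j. real j \<ge> 1 / infdist x K) sequentially"
        by (meson eventually_sequentiallyI nle_le of_nat_le_iff order_trans real_arch_simple)
      hence "eventually (\<lambda>j. F j x = 0) sequentially"
        by eventually_elim (use p in \<open>auto simp: F_def field_simps\<close>)
      thus ?thesis using nx by (simp add: tendsto_eventually)
    qed
    have Flim: "(\<lambda>j. integral {c..d} (F j)) \<longlonglongrightarrow> integral {c..d} (indicator K :: real \<Rightarrow> real)"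
      by (rule dominated_convergence(2)[where h="\<lambda>x. 1"])
        (use Fco F01 F0 in \<open>auto intro!: integrable_continuous_interval\<close>)
    have "negligible K" using Knull by (simp add: negligible_iff_null_sets null_sets_completionI)
    hence "integral {c..d} (indicator K :: real \<Rightarrow> real) = 0"
      by (meson integral_unique negligible)
    hence Flim0: "(\<lambda>j. integral {c..d} (F j)) \<longlonglongrightarrow> 0" using Flim by simp
    have key: "measure \<nu> K \<le> k * ((1 + M) * integral {c..d} (F j) + M powr (1 - q) * C)"
      if j: "real j \<ge> 1 / \<eta>" and M: "M > 0" for j M
    proof -
      have "measure \<nu> K = (\<integral>x. indicator K x \<partial>\<nu>)" using Kb by simp
      also have "\<dots> \<le> integral\<^sup>L \<nu> (F j)"
      proof (rule integral_mono)
        show "integrable \<nu> (indicator K :: real \<Rightarrow> real)" using Kb by (simp add: nu.emeasure_eq_measure)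
        have "F j \<in> borel_measurable borel" using Fco by (simp add: borel_measurable_continuous_onI)
        thus "integrable \<nu> (F j)" by (intro nu.integrable_const_bound[of _ 1]) (use F01 in auto)
      qed (use F1 F01 in \<open>auto simp: indicator_def\<close>)
      also have "\<dots> \<le> k * ((1 + M) * integral {c..d} (F j) + M powr (1 - q) * C)"
      proof (rule LIMSEQ_le_const2[OF lim[of "F j" 1]])
        show "\<exists>N. \<forall>n\<ge>N. integral {a..b} (\<lambda>x. F j x * f n x) \<le> k * ((1 + M) * integral {c..d} (F j) + M powr (1 - q) * C)"
        proof (intro exI allI impI)
          fix n
          have z: "F j x = 0" if "x \<notin> {c<..<d}" for x
          proof -
            have "infdist x K > \<eta>" using eta that by force
            hence "1 / \<eta> * \<eta> \<le> real j * infdist x K" using j eta(1)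
              by (intro mult_mono) auto
            hence "real j * infdist x K \<ge> 1" using eta(1) by simp
            thus ?thesis by (simp add: F_def)
          qed
          have i: "(\<lambda>x. F j x * f n x) integrable_on {c..d}"
            by (intro integrable_continuous_interval continuous_intros Fco continuous_on_subset[OF fc]) (use sub in auto)
          have "((\<lambda>x. F j x * f n x) has_integral integral {c..d} (\<lambda>x. F j x * f n x)) {a..b}"
            by (rule has_integral_on_superset[OF integrable_integral[OF i]]) (use sub z in auto)
          hence "integral {a..b} (\<lambda>x. F j x * f n x) = integral {c..d} (\<lambda>x. F j x * f n x)"
            by (rule integral_unique)
          also have "\<dots> \<le> integral {c..d} (\<lambda>x. k * ((1 + M) * F j x + M powr (1 - q) * w n x powr q))"
          proof (rule integral_le)
            show "(\<lambda>x. F j x * f n x) integrable_on {c..d}" by (rule i)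
            have "continuous_on {c..d} (\<lambda>x. w n x powr q)"
              by (rule continuous_on_powr') (use wc w0 q in \<open>auto intro!: continuous_intros\<close>)
            thus "(\<lambda>x. k * ((1 + M) * F j x + M powr (1 - q) * w n x powr q)) integrable_on {c..d}"
              by (intro integrable_continuous_interval continuous_on_mult continuous_on_add continuous_on_const Fco)
            fix x assume x: "x \<in> {c..d}"
            \<comment> \<open>Split at the level \<open>M\<close>: above it w = w^(1-q) w^q <=
              M^(1-q) w^q, because 1 - q is negative.\<close>
            have "F j x * w n x \<le> M * F j x + M powr (1 - q) * w n x powr q"
            proof (cases "w n x \<le> M")
              case True
              hence "F j x * w n x \<le> M * F j x" using F01[of j x] by (simp add: mult.commute[of "F j x"] mult_right_mono)
              moreover have "0 \<le> M powr (1 - q) * w n x powr q" by simp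
              ultimately show ?thesis by linarith
            next
              case False
              have "F j x * w n x \<le> w n x" using F01[of j x] w0[OF x] by (simp add: mult_left_le_one_le)
              also have "w n x = w n x powr (1 - q) * w n x powr q"
                using False M by (simp add: powr_add[symmetric])
              also have "\<dots> \<le> M powr (1 - q) * w n x powr q"
                using False M q by (intro mult_right_mono powr_mono2') auto
              finally have "F j x * w n x \<le> M powr (1 - q) * w n x powr q" .
              moreover have "0 \<le> M * F j x" using F01[of j x] M by simp
              ultimately show ?thesis by linarith
            qed
            hence "F j x * (1 + w n x) \<le> (1 + M) * F j x + M powr (1 - q) * w n x powr q"
              by (simp add: algebra_simps)
            hence "k * (F j x * (1 + w n x)) \<le> k * ((1 + M) * F j x + M powr (1 - q) * w n x powr q)"
              using k by (rule mult_left_mono)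
            moreover have "F j x * f n x \<le> F j x * (k * (1 + w n x))"
              using fw[OF x] F01 by (intro mult_left_mono) auto
            ultimately show "F j x * f n x \<le> k * ((1 + M) * F j x + M powr (1 - q) * w n x powr q)"
              by (simp add: algebra_simps)
          qed
          also have "\<dots> = k * ((1 + M) * integral {c..d} (F j) + M powr (1 - q) * integral {c..d} (\<lambda>x. w n x powr q))"
          proof -
            have "continuous_on {c..d} (\<lambda>x. w n x powr q)"
              by (rule continuous_on_powr') (use wc w0 q in \<open>auto intro!: continuous_intros\<close>)
            hence i: "(\<lambda>x. w n x powr q) integrable_on {c..d}" by (rule integrable_continuous_interval)
            have i2: "F j integrable_on {c..d}" by (intro integrable_continuous_interval Fco)
            show ?thesis
              by (subst integral_mult_right, subst integral_add)
                (use i i2 in \<open>auto intro!: integrable_on_mult_right simp: integral_mult_right\<close>)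
          qed
          also have "\<dots> \<le> k * ((1 + M) * integral {c..d} (F j) + M powr (1 - q) * C)"
            using k C[of n] by (intro mult_left_mono add_left_mono) auto
          finally show "integral {a..b} (\<lambda>x. F j x * f n x) \<le> k * ((1 + M) * integral {c..d} (F j) + M powr (1 - q) * C)" .
        qed
      qed (use Fc F01 in auto)
      finally show ?thesis .
    qed
    \<comment> \<open>With \<open>M\<close> fixed, \<open>j\<close> goes to infinity first and
      removes the term with the factor 1 + M; only then may \<open>M\<close> grow.\<close>
    have key2: "measure \<nu> K \<le> k * (M powr (1 - q) * C)" if M: "M > 0" for M
    proof (rule LIMSEQ_le_const)
      show "(\<lambda>j. k * ((1 + M) * integral {c..d} (F j) + M powr (1 - q) * C)) \<longlonglongrightarrow> k * (M powr (1 - q) * C)"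
        by (rule tendsto_eq_intros Flim0 refl | simp)+
      obtain j0 where "real j0 \<ge> 1 / \<eta>" using real_arch_simple by blast
      thus "\<exists>N. \<forall>n\<ge>N. measure \<nu> K \<le> k * ((1 + M) * integral {c..d} (F n) + M powr (1 - q) * C)"
        using key M by (meson of_nat_le_iff order_trans)
    qed
    have "measure \<nu> K \<le> 0"
    proof (rule tendsto_lowerbound)
      have "((\<lambda>M::real. M powr (1 - q)) \<longlongrightarrow> 0) at_top"
        using q by (intro tendsto_neg_powr filterlim_ident) auto
      from tendsto_mult[OF tendsto_const[of k] tendsto_mult[OF this tendsto_const[of C]]]
      show "((\<lambda>M. k * (M powr (1 - q) * C)) \<longlongrightarrow> 0) at_top" by simp
      show "\<forall>\<^sub>F M in at_top. measure \<nu> K \<le> k * (M powr (1 - q) * C)"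
        using eventually_gt_at_top[of 0] by eventually_elim (rule key2)
    qed auto
    thus ?thesis by (simp add: nu.emeasure_eq_measure measure_le_0_iff)
  qed simp
  \<comment> \<open>Inner regularity of the finite measure \<open>\<nu>\<close> passes from compact
    sets to the Borel null set.\<close>
  have "emeasure \<nu> N = (SUP K \<in> {K. K \<subseteq> N \<and> compact K}. emeasure \<nu> K)"
    by (rule inner_regular) (use Nb in \<open>auto simp: nu.emeasure_eq_measure\<close>)
  also have "\<dots> = 0" using comp by (auto simp: SUP_eq_iff intro!: antisym SUP_least)
  finally show ?thesis .
qed

section \<open>Limits of Herglotz functions\<close>

text \<open>The disc is mapped to the upper half-plane with 0 going to \<i> and the boundary point 1
  to infinity. Hence the value at \<i> is the mean over the circle, and 1 is the only boundary point
  that needs care.\<close>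

definition cayley :: "complex \<Rightarrow> complex" where
  "cayley w = \<i> * (1 + w) / (1 - w)"

lemma Im_cayley: "Im (cayley w) = (1 - (cmod w)\<^sup>2) / (cmod (1 - w))\<^sup>2"
proof -
  have "Im (\<i> * (1 + w) / (1 - w)) = (Re (1 + w) * Re (1 - w) - Im w * Im w) / ((Re (1 - w))\<^sup>2 + (Im (1 - w))\<^sup>2)"
    by (simp add: Im_divide)
  also have "Re (1 + w) * Re (1 - w) - Im w * Im w = 1 - (cmod w)\<^sup>2"
    unfolding cmod_power2 by (simp add: algebra_simps power2_eq_square)
  finally show ?thesis unfolding cayley_def cmod_power2[of "1 - w"] .
qed

text \<open>Squaring cis (arctan t) = (1 + \<i> t) / sqrt (1 + t^2) gives cis (2 arctan t) = (1 +
  \<i> t) / (1 - \<i> t). The shift by pi puts t = -infinity and t = +infinity at the angles 0 and 2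
  pi, so the real line fills the open interval between them.\<close>

lemma cayley_cis_arctan: "cayley (cis (pi + 2 * arctan t)) = of_real t"
proof -
  have s: "1 + t\<^sup>2 \<noteq> 0" by (smt (verit) zero_le_power2)
  have n: "1 - \<i> * of_real t \<noteq> 0" by (auto simp: complex_eq_iff)
  have n2: "1 + \<i> * of_real t \<noteq> 0" by (auto simp: complex_eq_iff)
  have f: "of_real (1 + t\<^sup>2) = (1 + \<i> * of_real t) * (1 - \<i> * of_real t)"
    by (simp add: algebra_simps power2_eq_square)
  have "cis (arctan t) = (1 + \<i> * of_real t) / of_real (sqrt (1 + t\<^sup>2))"
    by (simp add: complex_eq_iff cos_arctan sin_arctan)
  hence "cis (arctan t) * cis (arctan t) = (1 + \<i> * of_real t) * (1 + \<i> * of_real t) / of_real (1 + t\<^sup>2)"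
    by (simp flip: of_real_mult)
  also have "\<dots> = (1 + \<i> * of_real t) / (1 - \<i> * of_real t)"
    unfolding f using n2 by simp
  finally have e: "cis (2 * arctan t) = (1 + \<i> * of_real t) / (1 - \<i> * of_real t)" by (simp add: cis_mult)
  have e2: "cis (pi + 2 * arctan t) = - ((1 + \<i> * of_real t) / (1 - \<i> * of_real t))"
    unfolding cis_mult[symmetric] e by (simp only: cis_pi mult_minus1)
  show ?thesis unfolding cayley_def e2 using n by (simp add: field_simps)
qed

text \<open>Uniform continuity of (r, w) -> g (r w) on the compact product of {1/2..1} and
  \<open>K\<close>. The excluded point 1 is avoided since r w = 1 with both moduli at most 1 forces
  r = 1 and w = 1; the lower limit 1/2 is arbitrary.\<close>

lemma radial_approximation:
  fixes g :: "complex \<Rightarrow> complex"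
  assumes g: "continuous_on {w. cmod w \<le> 1 \<and> w \<noteq> 1} g"
    and K: "compact K" "K \<subseteq> {w. cmod w \<le> 1 \<and> w \<noteq> 1}" and e: "0 < e"
  shows "\<exists>r. 0 < r \<and> r < 1 \<and> (\<forall>w\<in>K. cmod (g (of_real r * w) - g w) < e)"
proof -
  define P where "P = (\<lambda>(r::real, w::complex). of_real r * w)"
  have "P ` ({1/2..1} \<times> K) \<subseteq> {w. cmod w \<le> 1 \<and> w \<noteq> 1}"
  proof
    fix v assume "v \<in> P ` ({1/2..1} \<times> K)"
    then obtain r w where r: "1/2 \<le> r" "r \<le> 1" and "w \<in> K" and v: "v = of_real r * w"
      by (auto simp: P_def)
    hence w: "cmod w \<le> 1" "w \<noteq> 1" using K by auto
    have le: "cmod (of_real r * w) \<le> r" using r w by (simp add: norm_mult mult_left_le)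
    have "of_real r * w \<noteq> 1"
    proof
      assume a: "of_real r * w = 1"
      hence "r = 1" using le r by auto
      thus False using a w by auto
    qed
    thus "v \<in> {w. cmod w \<le> 1 \<and> w \<noteq> 1}"
      using order_trans[OF le r(2)] by (simp add: v)
  qed
  hence Pg: "continuous_on (P ` ({1/2..1} \<times> K)) g" by (rule continuous_on_subset[OF g])
  have "continuous_on ({1/2..1} \<times> K) P"
    unfolding P_def by (auto simp: case_prod_unfold intro!: continuous_intros)
  from continuous_on_compose[OF this Pg]
  have "continuous_on ({1/2..1} \<times> K) (g \<circ> P)" .
  hence "uniformly_continuous_on ({1/2..1} \<times> K) (g \<circ> P)"
    by (intro compact_uniformly_continuous compact_Times K) auto
  then obtain d where d: "d > 0" and D: "\<And>x y. x \<in> {1/2..1} \<times> K \<Longrightarrow> y \<in> {1/2..1} \<times> K \<Longrightarrow> dist y x < d \<Longrightarrow>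
      dist ((g \<circ> P) y) ((g \<circ> P) x) < e"
    using e unfolding uniformly_continuous_on_def by meson
  define r where "r = max (1/2) (1 - d / 2)"
  have r: "1/2 \<le> r" "r < 1" "1 - r < d" using d by (auto simp: r_def)
  have "cmod (g (of_real r * w) - g w) < e" if "w \<in> K" for w
    using D[of "(1, w)" "(r, w)"] r that by (simp add: dist_Pair_Pair P_def dist_norm)
  thus ?thesis using r by (intro exI[of _ r]) auto
qed

text \<open>The functions \<open>h n \<circ> cayley\<close> may be singular at \<open>1\<close>. They are therefore composed with contractions
  \<open>w \<mapsto> r n * w\<close> so close to the identity that neither the interior limits nor the bound on the arc
  over \<open>{E\<^sub>1..E\<^sub>2}\<close> are affected.\<close>

lemma herglotz_disc_limit:
  fixes h :: "nat \<Rightarrow> complex \<Rightarrow> complex" and m :: "complex \<Rightarrow> complex"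
  assumes hol: "\<And>n. \<exists>S. open S \<and> {z. 0 \<le> Im z} \<subseteq> S \<and> h n holomorphic_on S"
    and pos: "\<And>n z. 0 < Im z \<Longrightarrow> 0 < Im (h n z)"
    and lim: "\<And>z. 0 < Im z \<Longrightarrow> (\<lambda>n. h n z) \<longlonglongrightarrow> m z"
    and mpos: "0 < Im (m \<i>)"
    and E: "E\<^sub>1 \<le> E\<^sub>2" and q: "1 < q"
    and bd: "\<And>n. integral {E\<^sub>1..E\<^sub>2} (\<lambda>t. Im (h n (of_real t)) powr q) \<le> C"
  shows "\<exists>\<nu>. real_distribution \<nu> \<and> (AE \<theta> in \<nu>. \<theta> \<in> {0..2*pi}) \<and>
    (\<forall>w. cmod w < 1 \<longrightarrow> Im (m (cayley w)) = Im (m \<i>) * integral\<^sup>L \<nu> (poisson w)) \<and>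
    (\<forall>N\<in>null_sets lborel. N \<subseteq> {pi + 2 * arctan E\<^sub>1<..<pi + 2 * arctan E\<^sub>2} \<longrightarrow> emeasure \<nu> N = 0)"
proof -
  define D where "D = {w. cmod w \<le> 1 \<and> w \<noteq> 1}"
  \<comment> \<open>The factor -\<i> turns positive imaginary part into positive real part, the form
    in which \<open>poisson_formula\<close> is stated.\<close>
  define g where "g n w = -\<i> * h n (cayley w)" for n w
  define \<theta>\<^sub>1 where "\<theta>\<^sub>1 = pi + 2 * arctan E\<^sub>1"
  define \<theta>\<^sub>2 where "\<theta>\<^sub>2 = pi + 2 * arctan E\<^sub>2"
  have th: "0 < \<theta>\<^sub>1" "\<theta>\<^sub>1 \<le> \<theta>\<^sub>2" "\<theta>\<^sub>2 < 2 * pi"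
    using arctan_bounded[of E\<^sub>1] arctan_bounded[of E\<^sub>2] E by (auto simp: \<theta>\<^sub>1_def \<theta>\<^sub>2_def arctan_le_iff)
  have Re_g: "Re (g n w) = Im (h n (cayley w))" for n w by (simp add: g_def)
  have hol_c: "cayley holomorphic_on - {1}" unfolding cayley_def by (intro holomorphic_intros) auto
  have ghol: "\<exists>S. open S \<and> D \<subseteq> S \<and> g n holomorphic_on S" for n
  proof -
    obtain S where S: "open S" "{z. 0 \<le> Im z} \<subseteq> S" "h n holomorphic_on S" using hol by blast
    define T where "T = - {1} \<inter> cayley -` S"
    have "open T" unfolding T_def
      by (rule continuous_open_preimage) (use S holomorphic_on_imp_continuous_on[OF hol_c] in auto)
    moreover have "D \<subseteq> T" using S by (auto simp: D_def T_def Im_cayley power_le_one subset_iff)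
    moreover have "h n \<circ> cayley holomorphic_on T"
      by (rule holomorphic_on_compose_gen[OF holomorphic_on_subset[OF hol_c] S(3)]) (auto simp: T_def)
    hence "g n holomorphic_on T" unfolding g_def comp_def by (intro holomorphic_intros)
    ultimately show ?thesis by blast
  qed
  have gcont: "continuous_on D (g n)" for n
    using ghol by (metis holomorphic_on_imp_continuous_on holomorphic_on_subset)
  have gdisc: "g n holomorphic_on ball 0 1" for n
  proof -
    have "ball 0 1 \<subseteq> D" by (auto simp: D_def)
    thus ?thesis using ghol[of n] by (meson holomorphic_on_subset subset_trans)
  qed
  have gpos: "0 < Re (g n w)" if "cmod w < 1" for n w
  proof -
    have "(cmod w)\<^sup>2 < 1" using that by (simp add: power_less_one_iff abs_square_less_1)
    moreover have "w \<noteq> 1" using that by auto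
    ultimately show ?thesis unfolding Re_g by (intro pos) (simp add: Im_cayley)
  qed
  \<comment> \<open>Positivity is given above the real line only; on the line it is a limit from
    above.\<close>
  have hreal: "0 \<le> Im (h n (of_real t))" for n t
  proof -
    obtain S where S: "open S" "{z. 0 \<le> Im z} \<subseteq> S" "h n holomorphic_on S" using hol by blast
    have "isCont (h n) (of_real t)"
      using S holomorphic_on_imp_continuous_on[OF S(3)] by (auto simp: continuous_on_eq_continuous_at subset_iff)
    moreover have "(\<lambda>k. of_real t + \<i> * of_real (1 / real (Suc k))) \<longlonglongrightarrow> of_real t + \<i> * of_real 0"
      by (intro tendsto_intros LIMSEQ_Suc[OF lim_1_over_n])
    hence "(\<lambda>k. of_real t + \<i> * of_real (1 / real (Suc k))) \<longlonglongrightarrow> of_real t" by simp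
    ultimately have "(\<lambda>k. h n (of_real t + \<i> * of_real (1 / real (Suc k)))) \<longlonglongrightarrow> h n (of_real t)"
      by (rule isCont_tendsto_compose)
    hence "(\<lambda>k. Im (h n (of_real t + \<i> * of_real (1 / real (Suc k))))) \<longlonglongrightarrow> Im (h n (of_real t))"
      by (intro tendsto_Im)
    thus ?thesis by (rule LIMSEQ_le_const) (auto intro!: less_imp_le pos)
  qed
  have cis_eq: "cayley (cis \<theta>) = of_real (tan ((\<theta> - pi) / 2))" and cisD: "cis \<theta> \<in> D" 
    if "\<theta> \<in> {\<theta>\<^sub>1..\<theta>\<^sub>2}" for \<theta>
  proof -
    have "arctan (tan ((\<theta> - pi) / 2)) = (\<theta> - pi) / 2"
      using that th by (intro arctan_tan) auto
    hence "\<theta> = pi + 2 * arctan (tan ((\<theta> - pi) / 2))" by simp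
    thus "cayley (cis \<theta>) = of_real (tan ((\<theta> - pi) / 2))" using cayley_cis_arctan by metis
    have "cis \<theta> \<noteq> 1"
    proof
      assume "cis \<theta> = 1"
      hence "cos \<theta> = 1" by (metis cis.sel(1) one_complex.sel(1))
      then obtain k :: int where k: "\<theta> = k * 2 * pi" using cos_one_2pi_int by auto
      have "0 < \<theta>" "\<theta> < 2 * pi" using that th by auto
      hence a: "0 * (2 * pi) < real_of_int k * (2 * pi)" and b: "real_of_int k * (2 * pi) < 1 * (2 * pi)"
        unfolding k by (simp_all only: mult.assoc mult_zero_left mult_1_left)
      have "0 < real_of_int k" by (rule mult_right_less_imp_less[OF a]) simp
      moreover have "real_of_int k < 1" by (rule mult_right_less_imp_less[OF b]) simp
      ultimately show False by simp
    qed
    thus "cis \<theta> \<in> D" by (simp add: D_def)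
  qed
  \<comment> \<open>Discs exhausting the open disc give the limit at every interior point; the
    closed arc is where the L^q bound has to survive the contraction.\<close>
  define K where "K n = cball 0 (1 - 1 / real (Suc n)) \<union> cis ` {\<theta>\<^sub>1..\<theta>\<^sub>2}" for n
  have "\<exists>r. 0 < r \<and> r < 1 \<and> (\<forall>w\<in>K n. cmod (g n (of_real r * w) - g n w) < 1 / real (Suc n))" for n
  proof (rule radial_approximation)
    show "continuous_on {w. cmod w \<le> 1 \<and> w \<noteq> 1} (g n)" using gcont by (simp add: D_def)
    have "continuous_on {\<theta>\<^sub>1..\<theta>\<^sub>2} cis" unfolding cis_conv_exp by (intro continuous_intros)
    thus "compact (K n)" unfolding K_def by (intro compact_Un compact_continuous_image) auto
    show "K n \<subseteq> {w. cmod w \<le> 1 \<and> w \<noteq> 1}"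
      using cisD by (force simp: K_def D_def intro: order_trans[of _ "1 - 1 / (1 + real n)"])
  qed auto
  then obtain r where r: "\<And>n. 0 < r n" "\<And>n. r n < 1"
    and rK: "\<And>n w. w \<in> K n \<Longrightarrow> cmod (g n (of_real (r n) * w) - g n w) < 1 / real (Suc n)"
    by metis
  define A where "A n = Re (g n 0)" for n
  have c0: "cayley 0 = \<i>" by (simp add: cayley_def)
  have Apos: "0 < A n" for n using gpos[of 0 n] by (simp add: A_def)
  have Alim: "A \<longlonglongrightarrow> Im (m \<i>)"
    using tendsto_Im[OF lim[of \<i>]] by (simp add: A_def[abs_def] Re_g c0)
  \<comment> \<open>Dividing by 2 pi times the value at the centre makes \<open>f n\<close> a
    probability density, by the Poisson formula at 0.\<close>
  define f where "f n \<theta> = Re (g n (of_real (r n) * cis \<theta>)) / (2 * pi * A n)" for n \<theta>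
  define w where "w n \<theta> = Re (g n (cis \<theta>))" for n \<theta>
  have rc: "cmod (of_real (r n) * cis \<theta>) < 1" for n \<theta> using r[of n] by (simp add: norm_mult)
  have f_int: "((\<lambda>\<theta>. poisson v \<theta> * f n \<theta>) has_integral Re (g n (of_real (r n) * v)) / A n) {0..2*pi}"
    if v: "cmod v < 1" for n v
  proof -
    have "(g n \<circ> (\<lambda>w. of_real (r n) * w)) holomorphic_on ball 0 (1 / r n)"
      by (rule holomorphic_on_compose_gen[OF _ gdisc])
        (use r[of n] in \<open>auto intro!: holomorphic_intros simp: norm_mult field_simps\<close>)
    from poisson_formula[OF this _ v]
    have "((\<lambda>\<theta>. Re (g n (of_real (r n) * cis \<theta>)) * poisson v \<theta>) has_integral
       2 * pi * Re (g n (of_real (r n) * v))) {0..2*pi}"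
      using r[of n] by simp
    hence "((\<lambda>\<theta>. Re (g n (of_real (r n) * cis \<theta>)) * poisson v \<theta> / (2 * pi * A n)) has_integral
       (2 * pi * Re (g n (of_real (r n) * v)) / (2 * pi * A n))) {0..2*pi}"
      by (rule has_integral_divide)
    thus ?thesis by (simp add: f_def mult_ac)
  qed
  have ccis: "continuous_on S cis" for S unfolding cis_conv_exp by (intro continuous_intros)
  have fcont: "continuous_on S (f n)" for S n
  proof -
    have "continuous_on UNIV (g n \<circ> (\<lambda>\<theta>. of_real (r n) * cis \<theta>))"
      by (intro continuous_on_compose continuous_intros ccis
          continuous_on_subset[OF holomorphic_on_imp_continuous_on[OF gdisc]]) (use rc in auto)
    hence "continuous_on UNIV (f n)" unfolding f_def comp_def using Apos[of n] by (intro continuous_intros) auto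
    thus ?thesis by (rule continuous_on_subset) simp
  qed
  have f0: "0 \<le> f n \<theta>" for n \<theta> using gpos[OF rc, of n n \<theta>] Apos[of n] by (simp add: f_def)
  have fint1: "(f n has_integral 1) {0..2*pi}" for n
    using f_int[of 0 n] Apos[of n] by (simp add: poisson_def A_def)
  have "0 \<le> 2 * pi" by simp
  from weak_limit_of_densities[of 0 "2*pi" f, OF fcont f0 fint1 this]
  obtain s \<nu> where s: "strict_mono s" and nu: "real_distribution \<nu>" and AE: "AE x in \<nu>. x \<in> {0..2*pi}"
    and wlim: "\<And>F B. (\<And>x. isCont F x) \<Longrightarrow> (\<And>x. \<bar>F x\<bar> \<le> B) \<Longrightarrow>
       (\<lambda>n. integral {0..2*pi} (\<lambda>x. F x * f (s n) x)) \<longlonglongrightarrow> integral\<^sup>L \<nu> F"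
    by blast
  have rep: "Im (m (cayley v)) = Im (m \<i>) * integral\<^sup>L \<nu> (poisson v)" if v: "cmod v < 1" for v
  proof -
    have "(\<lambda>n. Re (g n (of_real (r n) * v))) \<longlonglongrightarrow> Im (m (cayley v))"
    proof (rule Lim_transform)
      have "(cmod v)\<^sup>2 < 1" using v by (simp add: power_less_one_iff abs_square_less_1)
      moreover have "v \<noteq> 1" using v by auto
      ultimately have "0 < Im (cayley v)" by (simp add: Im_cayley)
      from tendsto_Im[OF lim[OF this]]
      show "(\<lambda>n. Re (g n v)) \<longlonglongrightarrow> Im (m (cayley v))" by (simp add: Re_g)
      show "(\<lambda>n. Re (g n (of_real (r n) * v)) - Re (g n v)) \<longlonglongrightarrow> 0"
      proof (rule Lim_null_comparison[OF _ LIMSEQ_Suc[OF lim_1_over_n]])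
        obtain n0 where n0: "1 / (1 - cmod v) < real n0" using reals_Archimedean2 by blast
        show "\<forall>\<^sub>F n in sequentially. norm (Re (g n (of_real (r n) * v)) - Re (g n v)) \<le> 1 / real (Suc n)"
          using eventually_ge_at_top[of n0]
        proof eventually_elim
          case (elim n)
          have "1 / (1 - cmod v) < real (Suc n)" using n0 elim by linarith
          hence "v \<in> K n" using v by (auto simp: K_def field_simps)
          from rK[OF this] have "cmod (g n (of_real (r n) * v) - g n v) \<le> 1 / real (Suc n)" by simp
          thus ?case using abs_Re_le_cmod[of "g n (of_real (r n) * v) - g n v"] by simp
        qed
      qed
    qed
    hence "(\<lambda>n. Re (g n (of_real (r n) * v)) / A n) \<longlonglongrightarrow> Im (m (cayley v)) / Im (m \<i>)"
      using Alim mpos by (intro tendsto_divide) auto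
    hence "(\<lambda>n. Re (g (s n) (of_real (r (s n)) * v)) / A (s n)) \<longlonglongrightarrow> Im (m (cayley v)) / Im (m \<i>)"
      using LIMSEQ_subseq_LIMSEQ[OF _ s] by (fastforce simp: comp_def)
    moreover have "(\<lambda>n. Re (g (s n) (of_real (r (s n)) * v)) / A (s n)) \<longlonglongrightarrow> integral\<^sup>L \<nu> (poisson v)"
      using wlim[OF isCont_poisson[OF v] poisson_bounded[OF v]] integral_unique[OF f_int[OF v]] by simp
    ultimately show ?thesis using LIMSEQ_unique mpos by (metis nonzero_eq_divide_eq less_irrefl mult.commute)
  qed
  \<comment> \<open>The normalising values \<open>A n\<close> converge to a positive limit, so their
    reciprocals form a bounded sequence.\<close>
  have "\<exists>k. \<forall>n. 1 / (2 * pi * A n) \<le> k"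
  proof -
    have "(\<lambda>n. 1 / (2 * pi * A n)) \<longlonglongrightarrow> 1 / (2 * pi * Im (m \<i>))"
      using mpos by (intro tendsto_intros Alim) auto
    hence "Bseq (\<lambda>n. 1 / (2 * pi * A n))" by (intro convergent_imp_Bseq) (auto simp: convergent_def)
    then obtain k where "\<forall>n. \<bar>1 / (2 * pi * A n)\<bar> \<le> k" unfolding Bseq_def by auto
    thus ?thesis using abs_le_D1 by blast
  qed
  then obtain k where k: "\<And>n. 1 / (2 * pi * A n) \<le> k" by blast
  have k0: "0 \<le> k" using k[of 0] Apos[of 0] by (smt (verit) divide_nonneg_pos mult_pos_pos pi_gt_zero)
  have wc: "continuous_on {\<theta>\<^sub>1..\<theta>\<^sub>2} (w n)" for n
  proof -
    have "continuous_on {\<theta>\<^sub>1..\<theta>\<^sub>2} (g n \<circ> cis)"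
      by (intro continuous_on_compose ccis continuous_on_subset[OF gcont]) (use cisD in auto)
    thus ?thesis unfolding w_def comp_def by (intro continuous_intros)
  qed
  have w0: "0 \<le> w n \<theta>" if "\<theta> \<in> {\<theta>\<^sub>1..\<theta>\<^sub>2}" for n \<theta>
    unfolding w_def Re_g cis_eq[OF that] by (rule hreal)
  \<comment> \<open>The contraction changes the boundary values by at most 1 / (n + 1) <= 1: this is
    the summand 1 beside \<open>w n \<theta>\<close>.\<close>
  have fw: "f n \<theta> \<le> k * (1 + w n \<theta>)" if t: "\<theta> \<in> {\<theta>\<^sub>1..\<theta>\<^sub>2}" for n \<theta>
  proof -
    have "cis \<theta> \<in> K n" using t by (auto simp: K_def)
    from rK[OF this] have "cmod (g n (of_real (r n) * cis \<theta>) - g n (cis \<theta>)) < 1 / real (Suc n)" .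
    also have "\<dots> \<le> 1" by simp
    finally have "Re (g n (of_real (r n) * cis \<theta>)) \<le> 1 + w n \<theta>"
      using abs_Re_le_cmod[of "g n (of_real (r n) * cis \<theta>) - g n (cis \<theta>)"] by (simp add: w_def)
    hence "f n \<theta> \<le> (1 + w n \<theta>) / (2 * pi * A n)"
      unfolding f_def using Apos[of n] by (intro divide_right_mono) auto
    also have "\<dots> = 1 / (2 * pi * A n) * (1 + w n \<theta>)" by simp
    also have "\<dots> \<le> k * (1 + w n \<theta>)" using k w0[OF t, of n] by (intro mult_right_mono) auto
    finally show ?thesis .
  qed
  \<comment> \<open>Change of variable from angle to energy; the factor 2 bounds the derivative 2 /
    (1 + t^2) of the angle.\<close>
  have wint: "integral {\<theta>\<^sub>1..\<theta>\<^sub>2} (\<lambda>x. w n x powr q) \<le> 2 * C" for n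
  proof -
    define u where "u t = pi + 2 * arctan t" for t
    have wc': "continuous_on {\<theta>\<^sub>1..\<theta>\<^sub>2} (\<lambda>x. w n x powr q)"
      by (rule continuous_on_powr') (use wc w0 q in \<open>auto intro!: continuous_intros\<close>)
    have wu: "w n (u t) = Im (h n (of_real t))" for t
      by (simp add: w_def Re_g u_def cayley_cis_arctan)
    have ran: "u ` {E\<^sub>1..E\<^sub>2} \<subseteq> {\<theta>\<^sub>1..\<theta>\<^sub>2}" by (auto simp: u_def \<theta>\<^sub>1_def \<theta>\<^sub>2_def arctan_le_iff)
    have "((\<lambda>t. (2 / (1 + t\<^sup>2)) *\<^sub>R (w n (u t) powr q)) has_integral
       integral {u E\<^sub>1..u E\<^sub>2} (\<lambda>x. w n x powr q)) {E\<^sub>1..E\<^sub>2}"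
    proof (rule has_integral_substitution[where c="\<theta>\<^sub>1" and d="\<theta>\<^sub>2"])
      show "u E\<^sub>1 \<le> u E\<^sub>2" using E by (simp add: u_def arctan_le_iff)
      fix t assume "t \<in> {E\<^sub>1..E\<^sub>2}"
      have "(u has_real_derivative 2 / (1 + t\<^sup>2)) (at t)"
        unfolding u_def by (auto intro!: derivative_eq_intros simp: field_simps)
      thus "(u has_real_derivative 2 / (1 + t\<^sup>2)) (at t within {E\<^sub>1..E\<^sub>2})" by (rule DERIV_subset) simp
    qed (use ran wc' E in auto)
    hence I: "((\<lambda>t. (2 / (1 + t\<^sup>2)) * (Im (h n (of_real t)) powr q)) has_integral
       integral {\<theta>\<^sub>1..\<theta>\<^sub>2} (\<lambda>x. w n x powr q)) {E\<^sub>1..E\<^sub>2}"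
      unfolding wu by (simp add: u_def \<theta>\<^sub>1_def \<theta>\<^sub>2_def)
    have uc: "continuous_on {E\<^sub>1..E\<^sub>2} u" unfolding u_def by (intro continuous_intros)
    have "continuous_on {E\<^sub>1..E\<^sub>2} ((\<lambda>x. w n x powr q) \<circ> u)"
      by (intro continuous_on_compose uc continuous_on_subset[OF wc']) (use ran in auto)
    hence i: "(\<lambda>t. Im (h n (of_real t)) powr q) integrable_on {E\<^sub>1..E\<^sub>2}"
      by (intro integrable_continuous_interval) (simp add: comp_def wu)
    have "integral {\<theta>\<^sub>1..\<theta>\<^sub>2} (\<lambda>x. w n x powr q) = integral {E\<^sub>1..E\<^sub>2} (\<lambda>t. (2 / (1 + t\<^sup>2)) * (Im (h n (of_real t)) powr q))"
      using integral_unique[OF I] by simp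
    also have "\<dots> \<le> integral {E\<^sub>1..E\<^sub>2} (\<lambda>t. 2 * (Im (h n (of_real t)) powr q))"
    proof (rule integral_le)
      show "(\<lambda>t. (2 / (1 + t\<^sup>2)) * (Im (h n (of_real t)) powr q)) integrable_on {E\<^sub>1..E\<^sub>2}" using I by blast
      show "(\<lambda>t. 2 * (Im (h n (of_real t)) powr q)) integrable_on {E\<^sub>1..E\<^sub>2}"
        using integrable_on_mult_right[OF i, of 2] by simp
      fix t :: real
      have "2 / (1 + t\<^sup>2) \<le> 2 / 1" by (intro divide_left_mono) (auto intro: add_pos_nonneg)
      thus "(2 / (1 + t\<^sup>2)) * (Im (h n (of_real t)) powr q) \<le> 2 * (Im (h n (of_real t)) powr q)"
        by (intro mult_right_mono) auto
    qed
    also have "\<dots> \<le> 2 * C" using bd[of n] by simp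
    finally show ?thesis .
  qed
  have "emeasure \<nu> N = 0" if N: "N \<in> null_sets lborel" "N \<subseteq> {\<theta>\<^sub>1<..<\<theta>\<^sub>2}" for N
    by (rule weak_limit_null_set[OF nu wlim _ _ fcont, where w="\<lambda>n. w (s n)" and c="\<theta>\<^sub>1" and d="\<theta>\<^sub>2" and k=k and q=q and C="2 * C"])
      (use th wc w0 fw k0 q wint N in auto)
  thus ?thesis using nu AE rep by (intro exI[of _ \<nu>]) (auto simp: \<theta>\<^sub>1_def \<theta>\<^sub>2_def)
qed

section \<open>Stieltjes inversion\<close>

definition icayley :: "complex \<Rightarrow> complex" where
  "icayley z = (z - \<i>) / (z + \<i>)"

text \<open>In the coordinate \<open>t\<close> the kernel of the disc is the half-plane kernel times
  1 + t^2, a weight that later enters the density of the spectral measure. At the angles 0 and 2 pi,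
  that is at infinity, the kernel equals Im z, which gives the linear term of the Herglotz
  representation.\<close>

lemma
  assumes "0 < Im z"
  shows cayley_icayley: "cayley (icayley z) = z" and norm_icayley: "cmod (icayley z) < 1"
    and poisson_icayley_arctan:
      "poisson (icayley z) (pi + 2 * arctan t) = Im z * (1 + t\<^sup>2) / ((Re z - t)\<^sup>2 + (Im z)\<^sup>2)"
    and poisson_icayley_0: "poisson (icayley z) 0 = Im z"
    and poisson_icayley_2pi: "poisson (icayley z) (2 * pi) = Im z"
proof -
  have zi: "z + \<i> \<noteq> 0" using assms by (auto simp: complex_eq_iff)
  have 1: "1 - icayley z = 2 * \<i> / (z + \<i>)" using zi by (simp add: icayley_def field_simps)
  have 2: "1 + icayley z = 2 * z / (z + \<i>)" using zi by (simp add: icayley_def field_simps)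
  have "\<i> * (2 * z / (z + \<i>)) = z * (2 * \<i> / (z + \<i>))" by simp
  thus "cayley (icayley z) = z" unfolding cayley_def 1 2 using zi by simp
  define R where "R = (cmod (z + \<i>))\<^sup>2"
  have R: "0 < R" using zi by (simp add: R_def)
  have d: "(cmod (z + \<i>))\<^sup>2 - (cmod (z - \<i>))\<^sup>2 = 4 * Im z"
    unfolding cmod_power2 by (simp add: power2_eq_square algebra_simps)
  have p: "1 - (cmod (icayley z))\<^sup>2 = 4 * Im z / R"
    using d R unfolding icayley_def norm_divide power_divide R_def[symmetric] by (simp add: field_simps)
  moreover have "0 < 4 * Im z / R" using R assms by simp
  ultimately have "(cmod (icayley z))\<^sup>2 < 1" by linarith
  thus lt: "cmod (icayley z) < 1" by (simp add: abs_square_less_1)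
  have "(cmod (1 - icayley z))\<^sup>2 = 4 / R"
    unfolding 1 norm_divide power_divide R_def[symmetric] by simp
  thus "poisson (icayley z) 0 = Im z" "poisson (icayley z) (2 * pi) = Im z"
    unfolding poisson_def p using R by (simp_all add: cis_2pi)
  have ti: "of_real t + \<i> \<noteq> 0" by (auto simp: complex_eq_iff)
  have "cis (pi + 2 * arctan t) = (of_real t - \<i>) / (of_real t + \<i>)"
  proof -
    have c: "cayley (cis (pi + 2 * arctan t)) = of_real t" by (rule cayley_cis_arctan)
    have "cis (pi + 2 * arctan t) \<noteq> 1"
    proof
      assume "cis (pi + 2 * arctan t) = 1"
      hence "cos (pi + 2 * arctan t) = 1" by (metis cis.sel(1) one_complex.sel(1))
      hence "cos (2 * arctan t) = - 1" by simp
      hence "cos (arctan t) = 0" by (simp add: cos_double_cos)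
      thus False by simp
    qed
    with c have "\<i> * (1 + cis (pi + 2 * arctan t)) = of_real t * (1 - cis (pi + 2 * arctan t))"
      unfolding cayley_def by (simp add: field_simps)
    thus ?thesis using ti by (simp add: field_simps)
  qed
  hence "cis (pi + 2 * arctan t) - icayley z =
      ((of_real t - \<i>) * (z + \<i>) - (z - \<i>) * (of_real t + \<i>)) / ((of_real t + \<i>) * (z + \<i>))"
    unfolding icayley_def using ti zi by (simp add: diff_frac_eq)
  also have "(of_real t - \<i>) * (z + \<i>) - (z - \<i>) * (of_real t + \<i>) = 2 * \<i> * (of_real t - z)"
    by (simp add: algebra_simps)
  finally have "cis (pi + 2 * arctan t) - icayley z = 2 * \<i> * (of_real t - z) / ((of_real t + \<i>) * (z + \<i>))" .
  hence e: "(cmod (cis (pi + 2 * arctan t) - icayley z))\<^sup>2 = 4 * (cmod (of_real t - z))\<^sup>2 / ((cmod (of_real t + \<i>))\<^sup>2 * R)"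
    by (simp add: norm_divide norm_mult power_mult_distrib power_divide R_def)
  have e1: "(cmod (of_real t + \<i>))\<^sup>2 = 1 + t\<^sup>2" "(cmod (of_real t - z))\<^sup>2 = (Re z - t)\<^sup>2 + (Im z)\<^sup>2"
    by (simp_all add: cmod_power2 power2_commute)
  define X where "X = (Re z - t)\<^sup>2 + (Im z)\<^sup>2"
  have "0 < X" "0 < 1 + t\<^sup>2" using assms by (auto intro: add_nonneg_pos add_pos_nonneg simp: X_def)
  thus "poisson (icayley z) (pi + 2 * arctan t) = Im z * (1 + t\<^sup>2) / ((Re z - t)\<^sup>2 + (Im z)\<^sup>2)"
    unfolding poisson_def p e e1 X_def[symmetric] using R by simp
qed

text \<open>The boundary coordinate: \<open>cayley (cis \<theta>) = half_tan \<theta>\<close> for \<open>0 < \<theta> < 2 * pi\<close>.\<close>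

definition half_tan :: "real \<Rightarrow> real" where
  "half_tan \<theta> = tan ((\<theta> - pi) / 2)"

lemma arctan_half_tan: "0 < \<theta> \<Longrightarrow> \<theta> < 2 * pi \<Longrightarrow> pi + 2 * arctan (half_tan \<theta>) = \<theta>"
proof -
  assume "0 < \<theta>" "\<theta> < 2 * pi"
  hence "arctan (tan ((\<theta> - pi) / 2)) = (\<theta> - pi) / 2" by (intro arctan_tan) auto
  thus ?thesis unfolding half_tan_def by simp
qed

lemma half_tan_measurable[measurable]: "half_tan \<in> borel_measurable borel"
  unfolding half_tan_def tan_def by measurable

text \<open>\<open>pi * swept y a b \<theta>\<close> is the integral of the Poisson kernel over the segment from \<open>a + \<i> y\<close> to \<open>b + \<i> y\<close>.
  The second case matters for \<open>\<theta> = 0\<close> and \<open>\<theta> = 2 * pi\<close>, which correspond to the boundary point \<open>\<infinity>\<close>.\<close>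

definition swept :: "real \<Rightarrow> real \<Rightarrow> real \<Rightarrow> real \<Rightarrow> real" where
  "swept y a b \<theta> = (if 0 < \<theta> \<and> \<theta> < 2 * pi
     then (1 + (half_tan \<theta>)\<^sup>2) * (arctan ((b - half_tan \<theta>) / y) - arctan ((a - half_tan \<theta>) / y)) / pi
     else y * (b - a) / pi)"

text \<open>An antiderivative, along a horizontal line, of the kernel found in
  \<open>poisson_icayley_arctan\<close>.\<close>

lemma arctan_scaled_derivative:
  fixes t y :: real
  assumes y: "0 < y"
  shows "((\<lambda>x. (1 + t\<^sup>2) * arctan ((x - t) / y)) has_real_derivative
     y * (1 + t\<^sup>2) / ((x - t)\<^sup>2 + y\<^sup>2)) (at x)"
proof -
  have pos: "0 < (x - t)\<^sup>2 + y\<^sup>2" using y by (auto intro: add_nonneg_pos)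
  have "((\<lambda>x. (1 + t\<^sup>2) * arctan ((x - t) / y)) has_real_derivative
     (1 + t\<^sup>2) * (inverse (1 + ((x - t) / y)\<^sup>2) * (1 / y))) (at x)"
    by (rule derivative_eq_intros refl | use y in simp)+
  also have "1 + ((x - t) / y)\<^sup>2 = ((x - t)\<^sup>2 + y\<^sup>2) / y\<^sup>2"
    using y by (simp add: power_divide add_divide_distrib)
  also have "(1 + t\<^sup>2) * (inverse (((x - t)\<^sup>2 + y\<^sup>2) / y\<^sup>2) * (1 / y)) = y * (1 + t\<^sup>2) / ((x - t)\<^sup>2 + y\<^sup>2)"
    using y pos by (simp add: power2_eq_square)
  finally show ?thesis .
qed

lemma nn_integral_poisson:
  assumes y: "0 < y" and ab: "a \<le> b" and th: "\<theta> \<in> {0..2*pi}"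
  shows "(\<integral>\<^sup>+x. ennreal (poisson (icayley (Complex x y)) \<theta>) * indicator {a..b} x \<partial>lborel)
    = ennreal (pi * swept y a b \<theta>)"
proof (cases "0 < \<theta> \<and> \<theta> < 2 * pi")
  case True
  define t where "t = half_tan \<theta>"
  have th': "\<theta> = pi + 2 * arctan t" using arctan_half_tan True by (simp add: t_def)
  have e: "poisson (icayley (Complex x y)) \<theta> = y * (1 + t\<^sup>2) / ((x - t)\<^sup>2 + y\<^sup>2)" for x
    unfolding th' using poisson_icayley_arctan[of "Complex x y"] y by simp
  have pos: "0 < (x - t)\<^sup>2 + y\<^sup>2" for x using y by (auto intro: add_nonneg_pos)
  have "(\<integral>\<^sup>+x. ennreal (y * (1 + t\<^sup>2) / ((x - t)\<^sup>2 + y\<^sup>2)) * indicator {a..b} x \<partial>lborel)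
    = (1 + t\<^sup>2) * arctan ((b - t) / y) - (1 + t\<^sup>2) * arctan ((a - t) / y)"
  proof (rule nn_integral_FTC_Icc)
    fix x 
    show "((\<lambda>x. (1 + t\<^sup>2) * arctan ((x - t) / y)) has_real_derivative y * (1 + t\<^sup>2) / ((x - t)\<^sup>2 + y\<^sup>2)) (at x)"
      by (rule arctan_scaled_derivative[OF y])
    show "0 \<le> y * (1 + t\<^sup>2) / ((x - t)\<^sup>2 + y\<^sup>2)" using y pos[of x] by (intro divide_nonneg_pos mult_nonneg_nonneg) auto
  qed (use ab in auto)
  moreover have "pi * swept y a b \<theta> = (1 + t\<^sup>2) * (arctan ((b - t) / y) - arctan ((a - t) / y))"
    using True by (simp add: swept_def t_def)
  hence "pi * swept y a b \<theta> = (1 + t\<^sup>2) * arctan ((b - t) / y) - (1 + t\<^sup>2) * arctan ((a - t) / y)"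
    by (simp add: right_diff_distrib)
  ultimately show ?thesis unfolding e by simp
next
  case False
  hence "\<theta> = 0 \<or> \<theta> = 2 * pi" using th by auto
  hence e: "poisson (icayley (Complex x y)) \<theta> = y" for x
    using poisson_icayley_0[of "Complex x y"] poisson_icayley_2pi[of "Complex x y"] y by auto
  have "(\<integral>\<^sup>+x. ennreal y * indicator {a..b} x \<partial>lborel) = ennreal y * ennreal (b - a)"
    using ab by (subst nn_integral_cmult_indicator) auto
  moreover have "swept y a b \<theta> = y * (b - a) / pi" unfolding swept_def using False by (rule if_not_P)
  ultimately show ?thesis unfolding e using y ab by (simp add: ennreal_mult)
qed

lemma swept_nonneg:
  assumes "0 < y" "a \<le> b" shows "0 \<le> swept y a b \<theta>"
proof -
  have "arctan ((a - t) / y) \<le> arctan ((b - t) / y)" for t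
    using assms by (intro arctan_monotone' divide_right_mono) auto
  hence "0 \<le> (1 + t\<^sup>2) * (arctan ((b - t) / y) - arctan ((a - t) / y)) / pi" for t
    by (intro divide_nonneg_pos mult_nonneg_nonneg) auto
  moreover have "0 \<le> y * (b - a) / pi" using assms by simp
  ultimately show ?thesis unfolding swept_def by presburger
qed

lemma swept_measurable[measurable]: "swept y a b \<in> borel_measurable borel"
  unfolding swept_def[abs_def] by measurable

text \<open>Dominated convergence as y tends to 0 requires a bound uniform in the angle, although
  the weight 1 + t^2 is unbounded. For bounded \<open>t\<close> the arctangents differ by at most
  pi; for large \<open>t\<close> the mean value theorem bounds the increment by 8 y (b - a).\<close>

lemma swept_bound:
  assumes y: "0 < y" and ab: "a \<le> b"
  shows "swept y a b \<theta> \<le> 1 + (2 * (\<bar>a\<bar> + \<bar>b\<bar> + 1))\<^sup>2 + 8 * y * (b - a)"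
proof (cases "0 < \<theta> \<and> \<theta> < 2 * pi")
  case True
  define t where "t = half_tan \<theta>"
  \<comment> \<open>Chosen so that |t| > R implies |t| >= 1 and |z| <= |t| / 2 for z between
    \<open>a\<close> and \<open>b\<close>; then (z - t)^2 >= t^2 / 4.\<close>
  define R where "R = 2 * (\<bar>a\<bar> + \<bar>b\<bar> + 1)"
  have e: "swept y a b \<theta> = (1 + t\<^sup>2) * ((arctan ((b - t) / y) - arctan ((a - t) / y)) / pi)"
    using True by (simp add: swept_def t_def)
  show ?thesis
  proof (cases "\<bar>t\<bar> \<le> R")
    case True
    have "arctan ((b - t) / y) - arctan ((a - t) / y) \<le> pi / 2 - - (pi / 2)"
      using arctan_ubound[of "(b - t) / y"] arctan_lbound[of "(a - t) / y"] by linarith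
    hence "(arctan ((b - t) / y) - arctan ((a - t) / y)) / pi \<le> 1" by simp
    hence "swept y a b \<theta> \<le> (1 + t\<^sup>2) * 1" unfolding e by (intro mult_left_mono) auto
    also have "t\<^sup>2 \<le> R\<^sup>2" using True by (simp add: abs_le_square_iff[symmetric] R_def)
    finally have "swept y a b \<theta> \<le> 1 + R\<^sup>2" by simp
    moreover have "0 \<le> 8 * y * (b - a)" using y ab by simp
    ultimately show ?thesis unfolding R_def by linarith
  next
    case False
    hence t: "\<bar>t\<bar> > R" by simp
    have "pi * swept y a b \<theta> \<le> 8 * y * (b - a)"
    proof -
      define F where "F x = (1 + t\<^sup>2) * arctan ((x - t) / y)" for x
      have "F b - F a \<le> 8 * y * (b - a)"
      proof (cases "a = b")
        case False
        have pos: "0 < (x - t)\<^sup>2 + y\<^sup>2" for x using y by (auto intro: add_nonneg_pos)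
        have D: "(F has_real_derivative y * (1 + t\<^sup>2) / ((x - t)\<^sup>2 + y\<^sup>2)) (at x)" for x
          unfolding F_def by (rule arctan_scaled_derivative[OF y])
        obtain z where z: "a < z" "z < b" "F b - F a = (b - a) * (y * (1 + t\<^sup>2) / ((z - t)\<^sup>2 + y\<^sup>2))"
          using MVT2[of a b F "\<lambda>x. y * (1 + t\<^sup>2) / ((x - t)\<^sup>2 + y\<^sup>2)"] D False ab by auto
        have "\<bar>z\<bar> \<le> \<bar>t\<bar> / 2" using z t by (auto simp: R_def)
        hence "\<bar>t\<bar> / 2 \<le> \<bar>z - t\<bar>" by linarith
        hence "(\<bar>t\<bar> / 2)\<^sup>2 \<le> (\<bar>z - t\<bar>)\<^sup>2" by (intro power_mono) auto
        hence 1: "t\<^sup>2 / 4 \<le> (z - t)\<^sup>2" by (simp add: power_divide)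
        have "1 \<le> \<bar>t\<bar>" using t by (simp add: R_def)
        hence 2: "1 \<le> t\<^sup>2" by (simp add: abs_le_square_iff[of 1, simplified])
        have "1 + t\<^sup>2 \<le> 2 * t\<^sup>2" using 2 by simp
        also have "\<dots> = 8 * (t\<^sup>2 / 4)" by simp
        also have "\<dots> \<le> 8 * ((z - t)\<^sup>2 + y\<^sup>2)" by (intro mult_left_mono add_increasing2 1) auto
        finally have "1 + t\<^sup>2 \<le> 8 * ((z - t)\<^sup>2 + y\<^sup>2)" .
        hence "y * (1 + t\<^sup>2) \<le> y * (8 * ((z - t)\<^sup>2 + y\<^sup>2))" using y by (intro mult_left_mono) auto
        hence "y * (1 + t\<^sup>2) / ((z - t)\<^sup>2 + y\<^sup>2) \<le> 8 * y" using pos[of z] by (simp add: divide_le_eq mult_ac)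
        hence "(b - a) * (y * (1 + t\<^sup>2) / ((z - t)\<^sup>2 + y\<^sup>2)) \<le> (b - a) * (8 * y)"
          using ab by (intro mult_left_mono) auto
        thus ?thesis using z by (simp add: mult_ac)
      qed simp
      moreover have "pi * swept y a b \<theta> = F b - F a" unfolding e F_def by (simp add: right_diff_distrib[symmetric])
      ultimately show ?thesis by simp
    qed
    moreover have "1 * swept y a b \<theta> \<le> pi * swept y a b \<theta>"
      using pi_ge_two by (intro mult_right_mono swept_nonneg y ab) auto
    moreover have "0 \<le> 1 + (2 * (\<bar>a\<bar> + \<bar>b\<bar> + 1))\<^sup>2" by simp
    ultimately show ?thesis by linarith
  qed
next
  case False
  have "y * (b - a) / pi \<le> 8 * y * (b - a)"
  proof -
    have "y * (b - a) / pi \<le> y * (b - a) / 1" using y ab pi_ge_two by (intro divide_left_mono) auto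
    moreover have "0 \<le> y * (b - a)" using y ab by simp
    ultimately show ?thesis by simp
  qed
  moreover have "swept y a b \<theta> = y * (b - a) / pi" unfolding swept_def using False by (rule if_not_P)
  moreover have "0 \<le> 1 + (2 * (\<bar>a\<bar> + \<bar>b\<bar> + 1))\<^sup>2" by simp
  ultimately show ?thesis by linarith
qed

text \<open>The limit of \<open>swept\<close> as y decreases to 0. The step formed by the
  arctangents has the value 1/2 at its endpoints, hence the mean of the closed and the open
  indicator; at infinity the limit is 0.\<close>

definition swept_lim :: "real \<Rightarrow> real \<Rightarrow> real \<Rightarrow> real" where
  "swept_lim a b \<theta> = indicator {0<..<2*pi} \<theta> * (1 + (half_tan \<theta>)\<^sup>2) *
     ((indicator {a..b} (half_tan \<theta>) + indicator {a<..<b} (half_tan \<theta>)) / 2)"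

lemma swept_lim_measurable[measurable]: "swept_lim a b \<in> borel_measurable borel"
  unfolding swept_lim_def[abs_def] by measurable

lemma arctan_scale_lim:
  assumes X: "X \<longlonglongrightarrow> 0" "\<And>n. 0 < X n"
  shows "(\<lambda>n. arctan (c / X n)) \<longlonglongrightarrow> sgn c * (pi / 2)"
proof -
  have inv: "filterlim (\<lambda>n. inverse (X n)) at_top sequentially"
    using X by (intro filterlim_inverse_at_top) auto
  have top: "filterlim (\<lambda>n. c / X n) at_top sequentially" if "c > 0" for c
    using filterlim_tendsto_pos_mult_at_top[OF tendsto_const that inv] by (simp add: divide_inverse)
  consider "c > 0" | "c = 0" | "c < 0" by linarith
  thus ?thesis
  proof cases
    case 1
    from filterlim_compose[OF tendsto_arctan_at_top top[OF 1]] show ?thesis using 1 by simp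
  next
    case 3
    hence "0 < - c" by simp
    from tendsto_minus[OF filterlim_compose[OF tendsto_arctan_at_top top[OF this]]] show ?thesis using 3 by (simp add: arctan_minus)
  qed simp
qed

lemma swept_tendsto:
  assumes X: "X \<longlonglongrightarrow> 0" "\<And>n. 0 < X n" and ab: "a < b"
  shows "(\<lambda>n. swept (X n) a b \<theta>) \<longlonglongrightarrow> swept_lim a b \<theta>"
proof (cases "0 < \<theta> \<and> \<theta> < 2 * pi")
  case True
  define t where "t = half_tan \<theta>"
  have "(\<lambda>n. (1 + t\<^sup>2) * (arctan ((b - t) / X n) - arctan ((a - t) / X n)) / pi) \<longlonglongrightarrow>
     (1 + t\<^sup>2) * (sgn (b - t) * (pi / 2) - sgn (a - t) * (pi / 2)) / pi"
    by (intro tendsto_intros arctan_scale_lim X) auto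
  also have "(1 + t\<^sup>2) * (sgn (b - t) * (pi / 2) - sgn (a - t) * (pi / 2)) / pi = swept_lim a b \<theta>"
    using True ab by (auto simp: swept_lim_def t_def sgn_if indicator_def field_simps)
  finally show ?thesis using True by (simp add: swept_def t_def)
next
  case False
  have "(\<lambda>n. X n * (b - a) / pi) \<longlonglongrightarrow> 0 * (b - a) / pi" by (intro tendsto_intros X) auto
  thus ?thesis using False by (auto simp: swept_def swept_lim_def)
qed

text \<open>Tonelli's theorem for the positive Poisson kernel: averaging over a segment and
  integrating against \<open>\<nu>\<close> are exchanged.\<close>

lemma swept_integral:
  assumes nu: "real_distribution \<nu>" "AE \<theta> in \<nu>. \<theta> \<in> {0..2*pi}"
    and rep: "\<And>w. cmod w < 1 \<Longrightarrow> M (cayley w) = A * integral\<^sup>L \<nu> (poisson w)"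
    and A: "0 \<le> A" and y: "0 < y" and ab: "a \<le> b"
  shows "1 / pi * (LINT x:{a..b}|lborel. M (Complex x y)) = A * integral\<^sup>L \<nu> (swept y a b)"
proof -
  interpret nu: real_distribution \<nu> by fact
  define k where "k x \<theta> = poisson (icayley (Complex x y)) \<theta>" for x \<theta>
  have lt: "cmod (icayley (Complex x y)) < 1" for x using norm_icayley[of "Complex x y"] y by simp
  have k0: "0 \<le> k x \<theta>" for x \<theta> unfolding k_def by (rule poisson_nonneg[OF lt])
  have kc: "continuous_on UNIV (\<lambda>p. k (fst p) (snd p))"
  proof -
    have ne: "cis \<theta> \<noteq> icayley (Complex x y)" for x \<theta> using lt[of x] by (metis norm_cis less_irrefl)
    have ne2: "Complex x y + \<i> \<noteq> 0" for x using y by (auto simp: complex_eq_iff)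
    have C: "Complex x y = of_real x + \<i> * of_real y" for x by (simp add: complex_eq_iff)
    have "continuous_on UNIV (\<lambda>p::real\<times>real. icayley (Complex (fst p) y))"
      unfolding icayley_def using ne2 unfolding C by (intro continuous_intros) auto
    moreover have "continuous_on UNIV (\<lambda>p::real\<times>real. cis (snd p))"
      unfolding cis_conv_exp by (intro continuous_intros)
    ultimately show ?thesis unfolding k_def poisson_def
      by (intro continuous_intros) (use ne in auto)
  qed
  have km: "(\<lambda>p. k (fst p) (snd p)) \<in> borel_measurable (borel \<Otimes>\<^sub>M borel)"
    unfolding borel_prod by (rule borel_measurable_continuous_onI[OF kc])
  have [measurable]: "(\<lambda>p. k (fst p) (snd p)) \<in> borel_measurable (lborel \<Otimes>\<^sub>M \<nu>)"
    using km by (subst measurable_cong_sets[OF sets_pair_measure_cong[of lborel borel \<nu> borel] refl]) auto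
  have km2[measurable]: "k x \<in> borel_measurable borel" for x
    using measurable_compose[OF measurable_Pair1'[of x borel borel] km] by simp
  have ki: "integrable \<nu> (k x)" for x
    by (rule nu.integrable_const_bound[where B="1 / (1 - cmod (icayley (Complex x y)))\<^sup>2"])
      (use poisson_bounded[OF lt] in \<open>auto simp: k_def\<close>)
  have Mk: "M (Complex x y) = A * integral\<^sup>L \<nu> (k x)" for x
    using rep[OF lt[of x]] cayley_icayley[of "Complex x y"] y by (simp add: k_def[abs_def])
  have Mm: "(\<lambda>x. integral\<^sup>L \<nu> (k x)) \<in> borel_measurable lborel"
    by (rule nu.borel_measurable_lebesgue_integral) (simp add: case_prod_unfold)
  interpret P: pair_sigma_finite lborel \<nu> by standard
  have "ennreal (pi) * ennreal (integral\<^sup>L \<nu> (swept y a b)) = (\<integral>\<^sup>+x. ennreal (indicator {a..b} x * integral\<^sup>L \<nu> (k x)) \<partial>lborel)"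
  proof -
    have "(\<integral>\<^sup>+x. ennreal (indicator {a..b} x * integral\<^sup>L \<nu> (k x)) \<partial>lborel)
      = (\<integral>\<^sup>+x. \<integral>\<^sup>+\<theta>. ennreal (k x \<theta>) * indicator {a..b} x \<partial>\<nu> \<partial>lborel)"
    proof (rule nn_integral_cong)
      fix x
      have "(\<integral>\<^sup>+\<theta>. ennreal (k x \<theta>) \<partial>\<nu>) = ennreal (integral\<^sup>L \<nu> (k x))"
        by (rule nn_integral_eq_integral[OF ki]) (simp add: k0)
      thus "ennreal (indicator {a..b} x * integral\<^sup>L \<nu> (k x)) = (\<integral>\<^sup>+\<theta>. ennreal (k x \<theta>) * indicator {a..b} x \<partial>\<nu>)"
        by (cases "x \<in> {a..b}") auto
    qed
    also have "\<dots> = (\<integral>\<^sup>+\<theta>. \<integral>\<^sup>+x. ennreal (k x \<theta>) * indicator {a..b} x \<partial>lborel \<partial>\<nu>)"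
      by (rule P.Fubini'[symmetric]) (simp add: case_prod_unfold)
    also have "\<dots> = (\<integral>\<^sup>+\<theta>. ennreal (pi * swept y a b \<theta>) \<partial>\<nu>)"
      by (rule nn_integral_cong_AE) (use nu(2) in eventually_elim, simp add: k_def nn_integral_poisson[OF y ab])
    also have "\<dots> = ennreal (integral\<^sup>L \<nu> (\<lambda>\<theta>. pi * swept y a b \<theta>))"
    proof (rule nn_integral_eq_integral)
      show "integrable \<nu> (\<lambda>\<theta>. pi * swept y a b \<theta>)"
        by (intro integrable_mult_right nu.integrable_const_bound[where B="1 + (2 * (\<bar>a\<bar> + \<bar>b\<bar> + 1))\<^sup>2 + 8 * y * (b - a)"])
          (use swept_bound[OF y ab] swept_nonneg[OF y ab] in auto)
    qed (use swept_nonneg[OF y ab] in auto)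
    also have "\<dots> = ennreal pi * ennreal (integral\<^sup>L \<nu> (swept y a b))"
      using swept_nonneg[OF y ab] by (simp add: ennreal_mult)
    finally show ?thesis by simp
  qed
  also have "(\<integral>\<^sup>+x. ennreal (indicator {a..b} x * integral\<^sup>L \<nu> (k x)) \<partial>lborel) = (\<integral>\<^sup>+x. ennreal (indicator {a..b} x *\<^sub>R integral\<^sup>L \<nu> (k x)) \<partial>lborel)"
    by simp
  finally have e: "ennreal pi * ennreal (integral\<^sup>L \<nu> (swept y a b)) = (\<integral>\<^sup>+x. ennreal (indicator {a..b} x *\<^sub>R integral\<^sup>L \<nu> (k x)) \<partial>lborel)" .
  have "enn2real (\<integral>\<^sup>+x. ennreal (indicator {a..b} x *\<^sub>R integral\<^sup>L \<nu> (k x)) \<partial>lborel) = pi * integral\<^sup>L \<nu> (swept y a b)"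
    unfolding e[symmetric] using swept_nonneg[OF y ab] by (simp flip: ennreal_mult)
  moreover have "(LINT x:{a..b}|lborel. integral\<^sup>L \<nu> (k x)) = enn2real (\<integral>\<^sup>+x. ennreal (indicator {a..b} x *\<^sub>R integral\<^sup>L \<nu> (k x)) \<partial>lborel)"
    unfolding set_lebesgue_integral_def
    by (rule integral_eq_nn_integral) (use Mm k0 in \<open>auto intro!: AE_I2 mult_nonneg_nonneg\<close>)
  ultimately show ?thesis unfolding Mk by simp
qed

text \<open>The measure is the image under \<open>half_tan\<close> of \<open>\<nu>\<close> weighted
  by A (1 + t^2), with the angles 0 and 2 pi removed. The inner limit counts the endpoints a +
  \<delta> and b + \<delta> by half; as \<delta> decreases to 0 both lie to the right of
  \<open>a\<close> and \<open>b\<close>, so \<open>a\<close> is left out and \<open>b\<close> is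
  counted in full.\<close>

lemma herglotz_spectral_measure:
  assumes nu: "real_distribution \<nu>" "AE \<theta> in \<nu>. \<theta> \<in> {0..2*pi}"
    and rep: "\<And>w. cmod w < 1 \<Longrightarrow> M (cayley w) = A * integral\<^sup>L \<nu> (poisson w)"
    and A: "0 < A"
    and null: "\<And>N. N \<in> null_sets lborel \<Longrightarrow> N \<subseteq> {pi + 2 * arctan E\<^sub>1<..<pi + 2 * arctan E\<^sub>2} \<Longrightarrow> emeasure \<nu> N = 0"
  shows "\<exists>\<mu>. sets \<mu> = sets borel \<and>
     (\<forall>a b. a < b \<longrightarrow> emeasure \<mu> {a<..b} < \<infinity> \<and>
       (\<exists>L. (\<forall>\<^sub>F \<delta> in at_right 0.
               ((\<lambda>\<epsilon>. 1 / pi * (LINT E:{a+\<delta>..b+\<delta>}|lborel. M (Complex E \<epsilon>)))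
                 \<longlongrightarrow> L \<delta>) (at_right 0)) \<and>
            (L \<longlongrightarrow> measure \<mu> {a<..b}) (at_right 0))) \<and>
     (\<forall>N\<in>null_sets lborel. N \<subseteq> {E\<^sub>1<..<E\<^sub>2} \<longrightarrow> emeasure \<mu> N = 0)"
proof -
  interpret nu: real_distribution \<nu> by fact
  define d where "d \<theta> = indicator {0<..<2*pi} \<theta> * (A * (1 + (half_tan \<theta>)\<^sup>2))" for \<theta> :: real
  have [measurable]: "d \<in> borel_measurable borel" unfolding d_def[abs_def] by measurable
  have d0: "0 \<le> d \<theta>" for \<theta> using A by (simp add: d_def)
  define \<mu> where "\<mu> = distr (density \<nu> (\<lambda>\<theta>. ennreal (d \<theta>))) borel half_tan"
  have em: "emeasure \<mu> B = (\<integral>\<^sup>+\<theta>. ennreal (d \<theta> * indicator B (half_tan \<theta>)) \<partial>\<nu>)" if [measurable]: "B \<in> sets borel" for B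
  proof -
    have "emeasure \<mu> B = emeasure (density \<nu> (\<lambda>\<theta>. ennreal (d \<theta>))) (half_tan -` B)"
      unfolding \<mu>_def by (subst emeasure_distr) auto
    also have "\<dots> = (\<integral>\<^sup>+\<theta>. ennreal (d \<theta>) * indicator (half_tan -` B) \<theta> \<partial>\<nu>)"
      by (rule emeasure_density) (use measurable_sets[OF half_tan_measurable that] in auto)
    also have "\<dots> = (\<integral>\<^sup>+\<theta>. ennreal (d \<theta> * indicator B (half_tan \<theta>)) \<partial>\<nu>)"
      by (intro nn_integral_cong) (auto simp: indicator_def)
    finally show ?thesis .
  qed
  have dint: "integrable \<nu> (\<lambda>\<theta>. d \<theta> * indicator B (half_tan \<theta>))" if [measurable]: "B \<in> sets borel" and B: "bounded B" for B
  proof -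
    obtain c where c: "\<And>x. x \<in> B \<Longrightarrow> \<bar>x\<bar> \<le> c" using B unfolding bounded_iff by auto
    have "\<bar>d \<theta> * indicator B (half_tan \<theta>)\<bar> \<le> A * (1 + c\<^sup>2)" for \<theta>
    proof (cases "half_tan \<theta> \<in> B")
      case True
      hence "(half_tan \<theta>)\<^sup>2 \<le> c\<^sup>2" using c by (metis abs_le_square_iff abs_of_nonneg abs_ge_zero order_trans)
      hence "A * (1 + (half_tan \<theta>)\<^sup>2) \<le> A * (1 + c\<^sup>2)" using A by simp
      moreover have "0 \<le> A * (1 + c\<^sup>2)" "0 \<le> A * (1 + (half_tan \<theta>)\<^sup>2)" using A by auto
      ultimately show ?thesis by (auto simp: d_def indicator_def)
    qed (use A in auto)
    thus ?thesis by (intro nu.integrable_const_bound[where B="A * (1 + c\<^sup>2)"]) auto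
  qed
  have emB: "emeasure \<mu> B = ennreal (\<integral>\<theta>. d \<theta> * indicator B (half_tan \<theta>) \<partial>\<nu>)"
    and mB: "measure \<mu> B = (\<integral>\<theta>. d \<theta> * indicator B (half_tan \<theta>) \<partial>\<nu>)"
    if B: "B \<in> sets borel" "bounded B" for B
  proof -
    show e: "emeasure \<mu> B = ennreal (\<integral>\<theta>. d \<theta> * indicator B (half_tan \<theta>) \<partial>\<nu>)"
      unfolding em[OF B(1)] by (rule nn_integral_eq_integral[OF dint[OF B]]) (use d0 in auto)
    show "measure \<mu> B = (\<integral>\<theta>. d \<theta> * indicator B (half_tan \<theta>) \<partial>\<nu>)"
      unfolding measure_def e using d0 by (simp add: integral_nonneg)
  qed
  define L where "L a b \<delta> = A * integral\<^sup>L \<nu> (swept_lim (a + \<delta>) (b + \<delta>))" for a b \<delta>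
  have lim1: "((\<lambda>\<epsilon>. 1 / pi * (LINT E:{a..b}|lborel. M (Complex E \<epsilon>))) \<longlongrightarrow> A * integral\<^sup>L \<nu> (swept_lim a b)) (at_right 0)"
    if ab: "a < b" for a b
  proof (subst tendsto_at_iff_sequentially, intro allI impI)
    fix X assume X: "\<forall>i. X i \<in> {0<..} - {0::real}" "X \<longlonglongrightarrow> 0"
    have X0: "0 < X n" for n using X by auto
    have ab': "a \<le> b" using ab by simp
    obtain K where K: "\<And>n. \<bar>X n\<bar> \<le> K" using convergent_imp_Bseq[of X] X(2) unfolding Bseq_def convergent_def by auto
    have K': "X n \<le> K" for n using K[of n] by simp
    have "(\<lambda>n. integral\<^sup>L \<nu> (swept (X n) a b)) \<longlonglongrightarrow> integral\<^sup>L \<nu> (swept_lim a b)"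
    proof (rule integral_dominated_convergence[where w="\<lambda>_. 1 + (2 * (\<bar>a\<bar> + \<bar>b\<bar> + 1))\<^sup>2 + 8 * K * (b - a)"])
      show "AE x in \<nu>. (\<lambda>i. swept (X i) a b x) \<longlonglongrightarrow> swept_lim a b x"
        using swept_tendsto[OF X(2) X0 ab] by simp
      fix n
      have "norm (swept (X n) a b x) \<le> 1 + (2 * (\<bar>a\<bar> + \<bar>b\<bar> + 1))\<^sup>2 + 8 * K * (b - a)" for x
      proof -
        have "8 * X n * (b - a) \<le> 8 * K * (b - a)" using K'[of n] ab by (intro mult_right_mono) auto
        thus ?thesis using swept_bound[OF X0 ab', of n x] swept_nonneg[OF X0 ab', of n x] by simp
      qed
      thus "AE x in \<nu>. norm (swept (X n) a b x) \<le> 1 + (2 * (\<bar>a\<bar> + \<bar>b\<bar> + 1))\<^sup>2 + 8 * K * (b - a)" by simp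
    qed auto
    hence "(\<lambda>n. A * integral\<^sup>L \<nu> (swept (X n) a b)) \<longlonglongrightarrow> A * integral\<^sup>L \<nu> (swept_lim a b)"
      by (intro tendsto_intros)
    moreover have "1 / pi * (LINT E:{a..b}|lborel. M (Complex E (X n))) = A * integral\<^sup>L \<nu> (swept (X n) a b)" for n
      by (rule swept_integral[OF nu rep less_imp_le[OF A] X0 ab'])
    ultimately show "((\<lambda>\<epsilon>. 1 / pi * (LINT E:{a..b}|lborel. M (Complex E \<epsilon>))) \<circ> X) \<longlonglongrightarrow> A * integral\<^sup>L \<nu> (swept_lim a b)"
      by (simp add: comp_def)
  qed
  have sl: "A * swept_lim a b \<theta> = d \<theta> * ((indicator {a..b} (half_tan \<theta>) + indicator {a<..<b} (half_tan \<theta>)) / 2)" for a b \<theta>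
    by (simp add: swept_lim_def d_def)
  have lim2: "(L a b \<longlongrightarrow> measure \<mu> {a<..b}) (at_right 0)" if ab: "a < b" for a b
  proof (subst tendsto_at_iff_sequentially, intro allI impI)
    fix X assume X: "\<forall>i. X i \<in> {0<..} - {0::real}" "X \<longlonglongrightarrow> 0"
    have X0: "0 < X n" for n using X by auto
    obtain K where K: "\<And>n. \<bar>X n\<bar> \<le> K" using convergent_imp_Bseq[of X] X(2) unfolding Bseq_def convergent_def by auto
    have K': "X n \<le> K" for n using K[of n] by simp
    have "(\<lambda>n. \<integral>\<theta>. A * swept_lim (a + X n) (b + X n) \<theta> \<partial>\<nu>) \<longlonglongrightarrow> (\<integral>\<theta>. d \<theta> * indicator {a<..b} (half_tan \<theta>) \<partial>\<nu>)"
    proof (rule integral_dominated_convergence[where w="\<lambda>\<theta>. d \<theta> * indicator {a..b+K} (half_tan \<theta>)"])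
      \<comment> \<open>All shifted intervals lie in the bounded interval {a..b+K}, on which the
        weight is bounded.\<close>
      show "integrable \<nu> (\<lambda>\<theta>. d \<theta> * indicator {a..b+K} (half_tan \<theta>))" by (rule dint) auto
      have "norm (A * swept_lim (a + X n) (b + X n) \<theta>) \<le> d \<theta> * indicator {a..b+K} (half_tan \<theta>)" for n \<theta>
      proof -
        have "norm (A * swept_lim (a + X n) (b + X n) \<theta>) = d \<theta> * ((indicator {a + X n..b + X n} (half_tan \<theta>) + indicator {a + X n<..<b + X n} (half_tan \<theta>)) / 2)"
          unfolding sl using d0[of \<theta>] by simp
        also have "\<dots> \<le> d \<theta> * indicator {a..b+K} (half_tan \<theta>)"
          using X0[of n] K'[of n] by (intro mult_left_mono d0) (auto simp: indicator_def)
        finally show ?thesis .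
      qed
      thus "AE x in \<nu>. norm (A * swept_lim (a + X n) (b + X n) x) \<le> d x * indicator {a..b+K} (half_tan x)" for n
        by simp
      have "(\<lambda>n. A * swept_lim (a + X n) (b + X n) \<theta>) \<longlonglongrightarrow> d \<theta> * indicator {a<..b} (half_tan \<theta>)" for \<theta>
        unfolding sl
      proof (intro tendsto_mult tendsto_const tendsto_eventually)
        define t where "t = half_tan \<theta>"
        have ev: "\<forall>\<^sub>F n in sequentially. X n < e" if "e > 0" for e
          using X(2) that by (rule order_tendstoD(2))
        \<comment> \<open>The shifts are positive: points t <= a are never in the shifted interval,
          points of {a<..b}, even t = b, eventually are in its interior, and points beyond
          \<open>b\<close> eventually leave it.\<close>
        consider "t \<le> a" | "a < t" "t \<le> b" | "b < t" by linarith
        thus "\<forall>\<^sub>F n in sequentially. (indicator {a + X n..b + X n} (half_tan \<theta>) + indicator {a + X n<..<b + X n} (half_tan \<theta>)) / 2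
          = (indicator {a<..b} (half_tan \<theta>) :: real)"
          unfolding t_def[symmetric]
        proof cases
          case 1
          thus "\<forall>\<^sub>F n in sequentially. (indicator {a + X n..b + X n} t + indicator {a + X n<..<b + X n} t) / 2 = (indicator {a<..b} t :: real)"
            by (intro always_eventually allI) (use X0 in \<open>auto simp: indicator_def not_le intro: le_less_trans\<close>, (smt (verit) X0)+)
        next
          case 2
          have "0 < t - a" using 2 by simp
          from ev[OF this] show "\<forall>\<^sub>F n in sequentially. (indicator {a + X n..b + X n} t + indicator {a + X n<..<b + X n} t) / 2 = (indicator {a<..b} t :: real)"
          proof eventually_elim
            case (elim n)
            thus ?case using 2 X0[of n] by (auto simp: indicator_def)
          qed
        next
          case 3
          have "0 < t - b" using 3 by simp
          from ev[OF this] show "\<forall>\<^sub>F n in sequentially. (indicator {a + X n..b + X n} t + indicator {a + X n<..<b + X n} t) / 2 = (indicator {a<..b} t :: real)"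
          proof eventually_elim
            case (elim n)
            thus ?case using 3 X0[of n] by (auto simp: indicator_def)
          qed
        qed
      qed
      thus "AE x in \<nu>. (\<lambda>i. A * swept_lim (a + X i) (b + X i) x) \<longlonglongrightarrow> d x * indicator {a<..b} (half_tan x)" by simp
    qed auto
    thus "(L a b \<circ> X) \<longlonglongrightarrow> measure \<mu> {a<..b}"
      by (simp add: mB L_def comp_def)
  qed
  \<comment> \<open>The angle is a differentiable function of the energy, so null sets of energies
    become null sets of angles, to which the hypothesis on \<open>\<nu>\<close> applies.\<close>
  have nullmu: "emeasure \<mu> N = 0" if N: "N \<in> null_sets lborel" "N \<subseteq> {E\<^sub>1<..<E\<^sub>2}" for N
  proof -
    have Nb[measurable]: "N \<in> sets borel" using N by auto
    define N' where "N' = {0<..<2*pi} \<inter> half_tan -` N"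
    have N'b: "N' \<in> sets borel" unfolding N'_def using measurable_sets[OF half_tan_measurable Nb] by auto
    have N'sub: "N' \<subseteq> (\<lambda>t. pi + 2 * arctan t) ` N"
    proof
      fix \<theta> assume "\<theta> \<in> N'"
      thus "\<theta> \<in> (\<lambda>t. pi + 2 * arctan t) ` N"
        using arctan_half_tan[of \<theta>] by (intro image_eqI[of _ _ "half_tan \<theta>"]) (auto simp: N'_def)
    qed
    have "negligible ((\<lambda>t. pi + 2 * arctan t) ` N)"
    proof (rule negligible_differentiable_image_negligible)
      show "negligible N" using N(1) by (simp add: negligible_iff_null_sets null_sets_completionI)
      have "((\<lambda>t. pi + 2 * arctan t) has_derivative (*) (2 / (1 + x\<^sup>2))) (at x)" for x
        unfolding has_field_derivative_def[symmetric]
        by (auto intro!: derivative_eq_intros simp: field_simps)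
      thus "(\<lambda>t. pi + 2 * arctan t) differentiable_on N"
        unfolding differentiable_on_def differentiable_def using has_derivative_at_withinI by blast
    qed simp
    hence "negligible N'" using N'sub negligible_subset by blast
    hence "N' \<in> null_sets lborel"
      using N'b by (simp add: negligible_iff_null_sets null_sets_completion_iff)
    moreover have "N' \<subseteq> {pi + 2 * arctan E\<^sub>1<..<pi + 2 * arctan E\<^sub>2}"
      using N'sub N(2) by (auto simp: arctan_less_iff dest!: subsetD)
    ultimately have "emeasure \<nu> N' = 0" by (rule null)
    hence "AE \<theta> in \<nu>. \<theta> \<notin> N'" using N'b by (intro AE_not_in) (auto simp: null_sets_def)
    hence "AE \<theta> in \<nu>. ennreal (d \<theta> * indicator N (half_tan \<theta>)) = 0"
      by eventually_elim (auto simp: N'_def d_def indicator_def)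
    thus ?thesis unfolding em[OF Nb] by (subst nn_integral_0_iff_AE) auto
  qed
  show ?thesis
  proof (intro exI[of _ \<mu>] conjI allI impI ballI)
    fix a b :: real assume ab: "a < b"
    show "emeasure \<mu> {a<..b} < \<infinity>" by (simp add: emB)
    show "\<exists>L. (\<forall>\<^sub>F \<delta> in at_right 0. ((\<lambda>\<epsilon>. 1 / pi * (LINT E:{a+\<delta>..b+\<delta>}|lborel. M (Complex E \<epsilon>))) \<longlongrightarrow> L \<delta>) (at_right 0)) \<and>
            (L \<longlongrightarrow> measure \<mu> {a<..b}) (at_right 0)"
      using lim1[of "a + _" "b + _"] lim2[OF ab] ab by (intro exI[of _ "L a b"]) (auto simp: L_def[abs_def])
  qed (use nullmu in \<open>auto simp: \<mu>_def\<close>)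
qed

section \<open>Calculus of absolutely continuous functions\<close>

lemma division_Inf_Sup:
  fixes D :: "real set set"
  assumes "D division_of i" "K \<in> D"
  shows "Inf K \<in> K" "Sup K \<in> K" "Inf K \<le> Sup K" "K = {Inf K..Sup K}" "measure lborel K = Sup K - Inf K"
proof -
  obtain c d where K: "K = cbox c d" using division_ofD(4)[OF assms] by blast
  have "K \<noteq> {}" using division_ofD(3)[OF assms] .
  hence "c \<le> d" using K by auto
  thus "Inf K \<in> K" "Sup K \<in> K" "Inf K \<le> Sup K" "K = {Inf K..Sup K}" "measure lborel K = Sup K - Inf K" using K by auto
qed

section \<open>Absolute continuity: dominated increments and indefinite integrals\<close>

lemma abs_cont_on_imp_continuous_on:
  assumes "abs_cont_on {a..b} u" shows "continuous_on {a..b} u"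
  unfolding continuous_on_iff
proof (intro ballI allI impI)
  fix x e :: real assume x: "x \<in> {a..b}" and e: "e > 0"
  from assms e obtain \<delta> where d: "\<delta> > 0" and D: "\<And>D. D division_of (\<Union>D) \<Longrightarrow> \<Union>D \<subseteq> {a..b} \<Longrightarrow>
      (\<Sum>K\<in>D. Sup K - Inf K) < \<delta> \<Longrightarrow> (\<Sum>K\<in>D. norm (u (Sup K) - u (Inf K))) < e"
    unfolding abs_cont_on_def by meson
  have "norm (u y - u x) < e" if "x \<in> {a..b}" "y \<in> {a..b}" "x \<le> y" "y - x < \<delta>" for x y
    using D[of "{{x..y}}"] that division_of_self[of x y] by auto
  from this[of x] this[of _ x] x show "\<exists>d>0. \<forall>x'\<in>{a..b}. dist x' x < d \<longrightarrow> dist (u x') (u x) < e"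
    using d by (intro exI[of _ \<delta>]) (auto simp: dist_norm norm_minus_commute abs_real_def split: if_splits)
qed

text \<open>The common source of the closure properties: sums, products, linear images and
  exponentials have increments dominated by those of functions already known to be absolutely
  continuous.\<close>

lemma abs_cont_on_dominated:
  assumes u: "abs_cont_on {a..b} u" and v: "abs_cont_on {a..b} v"
    and le: "\<And>x y. x \<in> {a..b} \<Longrightarrow> y \<in> {a..b} \<Longrightarrow> norm (w x - w y) \<le> C * (norm (u x - u y) + norm (v x - v y))"
  shows "abs_cont_on {a..b} w"
  unfolding abs_cont_on_def
proof (intro allI impI)
  fix e :: real assume e: "e > 0"
  define C' where "C' = max C 1"
  have C': "C' > 0" "C \<le> C'" by (auto simp: C'_def)
  have e': "e / (2 * C') > 0" using e C' by simp
  obtain \<delta>1 where d1: "\<delta>1 > 0" and D1: "\<And>D. D division_of (\<Union>D) \<Longrightarrow> \<Union>D \<subseteq> {a..b} \<Longrightarrow>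
      (\<Sum>K\<in>D. Sup K - Inf K) < \<delta>1 \<Longrightarrow> (\<Sum>K\<in>D. norm (u (Sup K) - u (Inf K))) < e / (2 * C')"
    using u e' unfolding abs_cont_on_def by meson
  obtain \<delta>2 where d2: "\<delta>2 > 0" and D2: "\<And>D. D division_of (\<Union>D) \<Longrightarrow> \<Union>D \<subseteq> {a..b} \<Longrightarrow>
      (\<Sum>K\<in>D. Sup K - Inf K) < \<delta>2 \<Longrightarrow> (\<Sum>K\<in>D. norm (v (Sup K) - v (Inf K))) < e / (2 * C')"
    using v e' unfolding abs_cont_on_def by meson
  show "\<exists>\<delta>>0. \<forall>D. D division_of \<Union>D \<and> \<Union>D \<subseteq> {a..b} \<and> (\<Sum>K\<in>D. Sup K - Inf K) < \<delta> \<longrightarrow>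
      (\<Sum>K\<in>D. norm (w (Sup K) - w (Inf K))) < e"
  proof (intro exI[of _ "min \<delta>1 \<delta>2"] conjI allI impI; (elim conjE)?)
    fix D assume D: "D division_of \<Union>D" "\<Union>D \<subseteq> {a..b}" "(\<Sum>K\<in>D. Sup K - Inf K) < min \<delta>1 \<delta>2"
    have "(\<Sum>K\<in>D. norm (w (Sup K) - w (Inf K))) \<le>
        (\<Sum>K\<in>D. C' * (norm (u (Sup K) - u (Inf K)) + norm (v (Sup K) - v (Inf K))))"
    proof (rule sum_mono)
      fix K assume "K \<in> D"
      hence "Sup K \<in> {a..b}" "Inf K \<in> {a..b}" using division_Inf_Sup[OF D(1)] D(2) by blast+
      from le[OF this] show "norm (w (Sup K) - w (Inf K)) \<le> C' * (norm (u (Sup K) - u (Inf K)) + norm (v (Sup K) - v (Inf K)))"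
        by (rule order_trans) (use C' in \<open>auto intro!: mult_right_mono\<close>)
    qed
    also have "\<dots> = C' * ((\<Sum>K\<in>D. norm (u (Sup K) - u (Inf K))) + (\<Sum>K\<in>D. norm (v (Sup K) - v (Inf K))))"
      by (simp add: sum_distrib_left sum.distrib distrib_left)
    also have "\<dots> < C' * (e / (2 * C') + e / (2 * C'))"
      using D1[OF D(1,2)] D2[OF D(1,2)] D(3) C' by (intro mult_strict_left_mono add_strict_mono) auto
    also have "\<dots> = e" using C' by (simp add: field_simps)
    finally show "(\<Sum>K\<in>D. norm (w (Sup K) - w (Inf K))) < e" .
  qed (use d1 d2 in auto)
qed

lemma abs_cont_on_const: "abs_cont_on S (\<lambda>x. c)"
  unfolding abs_cont_on_def by (auto intro: exI[of _ 1])

lemma abs_cont_on_dominated1: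
  assumes u: "abs_cont_on {a..b} u"
    and le: "\<And>x y. x \<in> {a..b} \<Longrightarrow> y \<in> {a..b} \<Longrightarrow> norm (w x - w y) \<le> C * norm (u x - u y)"
  shows "abs_cont_on {a..b} w"
  by (rule abs_cont_on_dominated[OF u abs_cont_on_const[where c="0::real"]]) (use le in auto)

lemma abs_cont_on_subset:
  assumes "abs_cont_on S u" "T \<subseteq> S" shows "abs_cont_on T u"
  using assms unfolding abs_cont_on_def by (meson order_trans)

lemma abs_cont_on_cong:
  assumes "abs_cont_on S u" "\<And>x. x \<in> S \<Longrightarrow> u x = v x" shows "abs_cont_on S v"
  unfolding abs_cont_on_def
proof (intro allI impI)
  fix e :: real assume "e > 0"
  then obtain d where d: "d > 0" "\<And>D. D division_of (\<Union>D) \<Longrightarrow> \<Union>D \<subseteq> S \<Longrightarrow>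
      (\<Sum>K\<in>D. Sup K - Inf K) < d \<Longrightarrow> (\<Sum>K\<in>D. norm (u (Sup K) - u (Inf K))) < e"
    using assms(1) unfolding abs_cont_on_def by meson
  have "(\<Sum>K\<in>D. norm (v (Sup K) - v (Inf K))) = (\<Sum>K\<in>D. norm (u (Sup K) - u (Inf K)))"
    if "D division_of (\<Union>D)" "\<Union>D \<subseteq> S" for D
  proof (rule sum.cong)
    fix K assume "K \<in> D"
    hence "Sup K \<in> S" "Inf K \<in> S" using division_Inf_Sup[OF that(1)] that(2) by blast+
    thus "norm (v (Sup K) - v (Inf K)) = norm (u (Sup K) - u (Inf K))" using assms(2) by simp
  qed simp
  thus "\<exists>d>0. \<forall>D. D division_of \<Union>D \<and> \<Union>D \<subseteq> S \<and> (\<Sum>K\<in>D. Sup K - Inf K) < d \<longrightarrow>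
      (\<Sum>K\<in>D. norm (v (Sup K) - v (Inf K))) < e" using d by auto
qed

text \<open>Truncation: the norm of \<open>f\<close> is at most a constant \<open>M\<close> plus a
  tail \<open>t\<close> of small integral. A small total length makes the first part small, and the
  tail is small over every family of intervals.\<close>

lemma abs_cont_on_integral:
  fixes f :: "real \<Rightarrow> 'a::euclidean_space"
  assumes f: "f absolutely_integrable_on {a..b}"
  shows "abs_cont_on {a..b} (\<lambda>x. integral {a..x} f)"
  unfolding abs_cont_on_def
proof (intro allI impI)
  fix e :: real assume e: "e > 0"
  define g where "g x = norm (f x)" for x
  have g: "g absolutely_integrable_on {a..b}" unfolding g_def using absolutely_integrable_norm[OF f] by (simp add: comp_def)
  have gi: "g integrable_on {a..b}" and fi: "f integrable_on {a..b}"
    using f g by (auto dest: set_lebesgue_integral_eq_integral(1))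
  have mini: "(\<lambda>x. min (g x) (real k)) absolutely_integrable_on {a..b}" for k
    by (rule absolutely_integrable_min_1[OF g]) auto
  have "(\<lambda>k. integral {a..b} (\<lambda>x. min (g x) (real k))) \<longlonglongrightarrow> integral {a..b} g"
  proof (rule dominated_convergence(2)[OF _ gi])
    show "(\<lambda>x. min (g x) (real k)) integrable_on {a..b}" for k
      using mini[of k] by (rule set_lebesgue_integral_eq_integral(1))
    fix x assume "x \<in> {a..b}"
    have "\<forall>\<^sub>F k in sequentially. min (g x) (real k) = g x"
    proof -
      obtain n where "g x \<le> real n" using real_arch_simple by blast
      thus ?thesis unfolding eventually_sequentially by (intro exI[of _ n]) (auto simp: min_def)
    qed
    thus "(\<lambda>k. min (g x) (real k)) \<longlonglongrightarrow> g x" by (rule tendsto_eventually)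
  qed (auto simp: g_def)
  then obtain k where k: "\<bar>integral {a..b} (\<lambda>x. min (g x) (real k)) - integral {a..b} g\<bar> < e / 2"
    using LIMSEQ_D[of _ _ "e/2"] e by (metis half_gt_zero le_refl real_norm_def)
  \<comment> \<open>The summand 1 keeps \<open>M\<close> positive for k = 0, since the total length
    is compared with e / (2 M).\<close>
  define M where "M = real k + 1"
  define t where "t x = g x - min (g x) (real k)" for x
  have ti: "t integrable_on {a..b}" unfolding t_def
    using mini[of k] gi by (intro integrable_diff) (auto dest: set_lebesgue_integral_eq_integral(1))
  have "integral {a..b} t = integral {a..b} g - integral {a..b} (\<lambda>x. min (g x) (real k))"
    unfolding t_def using gi mini[of k] by (intro integral_diff) (auto dest: set_lebesgue_integral_eq_integral(1))
  hence tl: "integral {a..b} t < e / 2" using k by linarith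
  show "\<exists>\<delta>>0. \<forall>D. D division_of \<Union>D \<and> \<Union>D \<subseteq> {a..b} \<and> (\<Sum>K\<in>D. Sup K - Inf K) < \<delta> \<longrightarrow>
      (\<Sum>K\<in>D. norm (integral {a..Sup K} f - integral {a..Inf K} f)) < e"
  proof (intro exI[of _ "e / (2 * M)"] conjI allI impI; (elim conjE)?)
    show "0 < e / (2 * M)" using e by (simp add: M_def)
    fix D assume D: "D division_of \<Union>D" "\<Union>D \<subseteq> {a..b}" "(\<Sum>K\<in>D. Sup K - Inf K) < e / (2 * M)"
    have tK: "t integrable_on K" if "K \<in> D" for K
    proof -
      have "K \<subseteq> {a..b}" using D that by auto
      thus ?thesis using integrable_subinterval_real[OF ti] division_Inf_Sup(4)[OF D(1) that] by metis
    qed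
    have "(\<Sum>K\<in>D. norm (integral {a..Sup K} f - integral {a..Inf K} f)) \<le> (\<Sum>K\<in>D. M * (Sup K - Inf K) + integral K t)"
    proof (rule sum_mono)
      fix K assume K: "K \<in> D"
      define c d where "c = Inf K" and "d = Sup K"
      have cd: "K = {c..d}" "c \<le> d" and sub: "{c..d} \<subseteq> {a..b}"
        using division_Inf_Sup[OF D(1) K] D(2) K unfolding c_def d_def by auto
      have ac: "a \<le> c" "d \<le> b" using sub cd by auto
      have fcd: "f integrable_on {c..d}" "g integrable_on {c..d}"
        using integrable_subinterval_real[OF fi sub] integrable_subinterval_real[OF gi sub] by auto
      have "integral {a..d} f = integral {a..c} f + integral {c..d} f"
        using Henstock_Kurzweil_Integration.integral_combine[of a c d f] ac cd(2) integrable_subinterval_real[OF fi, of a d] by auto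
      hence "norm (integral {a..d} f - integral {a..c} f) = norm (integral {c..d} f)" by simp
      also have "\<dots> \<le> integral {c..d} g"
        using fcd by (intro integral_norm_bound_integral) (auto simp: g_def)
      also have "\<dots> \<le> integral {c..d} (\<lambda>x. M + t x)"
      proof (rule integral_le)
        have "t integrable_on {c..d}" using tK[OF K] cd by simp
        thus "(\<lambda>x. M + t x) integrable_on {c..d}" by (intro integrable_add integrable_const_ivl)
      qed (use fcd in \<open>auto simp: t_def M_def\<close>)
      also have "\<dots> = M * (d - c) + integral K t"
        using tK[OF K] cd by (subst integral_add) auto
      finally show "norm (integral {a..Sup K} f - integral {a..Inf K} f) \<le> M * (Sup K - Inf K) + integral K t"
        by (simp add: c_def d_def)
    qed
    also have "\<dots> = M * (\<Sum>K\<in>D. Sup K - Inf K) + (\<Sum>K\<in>D. integral K t)"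
      by (simp add: sum.distrib sum_distrib_left)
    also have "(\<Sum>K\<in>D. integral K t) = integral (\<Union>D) t"
      using integral_combine_division_bottomup[OF D(1) tK] by simp
    also have "\<dots> \<le> integral {a..b} t"
    proof (rule integral_subset_le[OF D(2) _ ti])
      show "t integrable_on \<Union>D" using has_integral_combine_division[OF D(1)] tK
        by (metis integrable_integral integrable_on_def)
    qed (auto simp: t_def)
    finally have "(\<Sum>K\<in>D. norm (integral {a..Sup K} f - integral {a..Inf K} f)) \<le> M * (\<Sum>K\<in>D. Sup K - Inf K) + integral {a..b} t"
      by simp
    also have "M * (\<Sum>K\<in>D. Sup K - Inf K) \<le> M * (e / (2 * M))"
      using D(3) by (intro mult_left_mono) (auto simp: M_def)
    also have "M * (e / (2 * M)) = e / 2" using \<open>0 < e / (2 * M)\<close> by (auto simp: zero_less_divide_iff)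
    finally show "(\<Sum>K\<in>D. norm (integral {a..Sup K} f - integral {a..Inf K} f)) < e" using tl by simp
  qed
qed

section \<open>Lebesgue differentiation and the fundamental theorem of calculus\<close>

lemma right_Lebesgue_differentiation:
  fixes f :: "real \<Rightarrow> 'a::euclidean_space"
  assumes f: "f integrable_on {a..b}"
  obtains N where "negligible N"
    "\<And>x e. x \<in> {a<..<b} - N \<Longrightarrow> 0 < e \<Longrightarrow> \<exists>d>0. \<forall>h. 0 < h \<and> h < d \<longrightarrow> x + h \<le> b \<and>
        norm (integral {x..x+h} f - h *\<^sub>R f x) \<le> e * h"
proof -
  \<comment> \<open>Extension by 0 gives integrability on every interval; at points inside {a<..<b}
    the averages over short intervals are those of \<open>f\<close>.\<close>
  define f' where "f' x = (if x \<in> {a..b} then f x else 0)" for x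
  have "f' integrable_on cbox c d" for c d
  proof -
    have "f' integrable_on UNIV" unfolding f'_def integrable_restrict_UNIV by (rule f)
    thus ?thesis by (rule integrable_on_subcbox) auto
  qed
  then obtain N where N: "negligible N"
    "\<And>x e. \<lbrakk>x \<notin> N; 0 < e\<rbrakk> \<Longrightarrow> \<exists>d>0. \<forall>h. 0 < h \<and> h < d \<longrightarrow>
       norm(integral (cbox x (x + h *\<^sub>R One)) f' /\<^sub>R h ^ DIM(real) - f' x) < e"
    using integrable_ccontinuous_explicit[of f'] by metis
  show ?thesis
  proof (rule that[OF N(1)])
    fix x e :: real assume x: "x \<in> {a<..<b} - N" and e: "0 < e"
    then obtain d where d: "d > 0" "\<And>h. 0 < h \<Longrightarrow> h < d \<Longrightarrow> norm(integral {x..x + h} f' /\<^sub>R h - f' x) < e"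
      using N(2)[of x e] by auto
    show "\<exists>d>0. \<forall>h. 0 < h \<and> h < d \<longrightarrow> x + h \<le> b \<and> norm (integral {x..x+h} f - h *\<^sub>R f x) \<le> e * h"
    proof (intro exI[of _ "min d (b - x)"] conjI allI impI)
      fix h assume h: "0 < h \<and> h < min d (b - x)"
      show "x + h \<le> b" using h by simp
      have "integral {x..x+h} f' = integral {x..x+h} f"
        using x h by (intro integral_cong) (auto simp: f'_def)
      hence "norm (integral {x..x + h} f /\<^sub>R h - f x) < e" using d(2)[of h] h x by (simp add: f'_def)
      hence "h * norm (integral {x..x + h} f /\<^sub>R h - f x) \<le> h * e" using h by (intro mult_left_mono) auto
      also have "h * norm (integral {x..x + h} f /\<^sub>R h - f x) = norm (h *\<^sub>R (integral {x..x + h} f /\<^sub>R h - f x))"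
        using h by simp
      also have "h *\<^sub>R (integral {x..x + h} f /\<^sub>R h - f x) = integral {x..x+h} f - h *\<^sub>R f x"
        using h by (simp add: scaleR_right_diff_distrib)
      finally show "norm (integral {x..x+h} f - h *\<^sub>R f x) \<le> e * h" by (simp add: mult.commute)
    qed (use d x in auto)
  qed
qed

text \<open>Right-hand averages of the reflected function on {-b..-a} are left-hand averages of
  \<open>f\<close>; the exceptional set of the reflected problem is reflected back.\<close>

lemma Lebesgue_differentiation:
  fixes f :: "real \<Rightarrow> 'a::euclidean_space"
  assumes f: "f integrable_on {a..b}"
  obtains N where "negligible N"
    "\<And>x. x \<in> {a<..<b} - N \<Longrightarrow> ((\<lambda>x. integral {a..x} f) has_vector_derivative f x) (at x)"
proof -
  obtain N1 where N1: "negligible N1"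
    "\<And>x e. x \<in> {a<..<b} - N1 \<Longrightarrow> 0 < e \<Longrightarrow> \<exists>d>0. \<forall>h. 0 < h \<and> h < d \<longrightarrow> x + h \<le> b \<and>
        norm (integral {x..x+h} f - h *\<^sub>R f x) \<le> e * h"
    using right_Lebesgue_differentiation[OF f] by blast
  have f2: "(\<lambda>x. f (- x)) integrable_on {-b..-a}" using f by (simp add: integrable_reflect_real)
  obtain N2 where N2: "negligible N2"
    "\<And>x e. x \<in> {-b<..<-a} - N2 \<Longrightarrow> 0 < e \<Longrightarrow> \<exists>d>0. \<forall>h. 0 < h \<and> h < d \<longrightarrow> x + h \<le> -a \<and>
        norm (integral {x..x+h} (\<lambda>x. f (- x)) - h *\<^sub>R f (- x)) \<le> e * h"
    using right_Lebesgue_differentiation[OF f2] by blast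
  show ?thesis
  proof (rule that[of "N1 \<union> uminus ` N2"])
    show "negligible (N1 \<union> uminus ` N2)"
      using N1 N2 by (intro negligible_Un negligible_differentiable_image_negligible) (auto intro!: derivative_intros)
    fix x assume x: "x \<in> {a<..<b} - (N1 \<union> uminus ` N2)"
    have x2: "- x \<in> {-b<..<-a} - N2" using x by force
    have fi: "f integrable_on {c..d}" if "a \<le> c" "d \<le> b" for c d
      using integrable_subinterval_real[OF f] that by auto
    show "((\<lambda>x. integral {a..x} f) has_vector_derivative f x) (at x)"
      unfolding has_vector_derivative_def has_derivative_within_alt2
    proof (intro conjI allI impI)
      show "bounded_linear (\<lambda>y. y *\<^sub>R f x)" by (rule bounded_linear_scaleR_left)
      fix e :: real assume e: "e > 0"
      obtain d1 where d1: "d1 > 0" "\<And>h. 0 < h \<Longrightarrow> h < d1 \<Longrightarrow> x + h \<le> b \<and>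
        norm (integral {x..x+h} f - h *\<^sub>R f x) \<le> e * h" using N1(2)[of x e] x e by auto
      obtain d2 where d2: "d2 > 0" "\<And>h. 0 < h \<Longrightarrow> h < d2 \<Longrightarrow> - x + h \<le> -a \<and>
        norm (integral {-x..-x+h} (\<lambda>x. f (- x)) - h *\<^sub>R f x) \<le> e * h" using N2(2)[OF x2 e] by auto
      show "\<forall>\<^sub>F y in at x. norm (integral {a..y} f - integral {a..x} f - (y - x) *\<^sub>R f x) \<le> e * norm (y - x)"
        unfolding eventually_at
      proof (intro exI[of _ "min d1 d2"] conjI ballI impI)
        fix y assume y: "y \<noteq> x \<and> dist y x < min d1 d2"
        show "norm (integral {a..y} f - integral {a..x} f - (y - x) *\<^sub>R f x) \<le> e * norm (y - x)"
        proof (cases "x < y")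
          case True
          hence *: "y \<le> b" "norm (integral {x..y} f - (y - x) *\<^sub>R f x) \<le> e * (y - x)"
            using d1(2)[of "y - x"] y by (auto simp: dist_real_def)
          have "integral {a..y} f = integral {a..x} f + integral {x..y} f"
            using Henstock_Kurzweil_Integration.integral_combine[of a x y f] x True * fi by auto
          thus ?thesis using * True by simp
        next
          case False
          hence yx: "y < x" using y by auto
          hence *: "a \<le> y" "norm (integral {-x..-y} (\<lambda>x. f (- x)) - (x - y) *\<^sub>R f x) \<le> e * (x - y)"
            using d2(2)[of "x - y"] y by (auto simp: dist_real_def)
          have "integral {a..x} f = integral {a..y} f + integral {y..x} f"
            using Henstock_Kurzweil_Integration.integral_combine[of a y x f] x yx * fi by auto
          moreover have "integral {-x..-y} (\<lambda>x. f (- x)) = integral {y..x} f" using Henstock_Kurzweil_Integration.integral_reflect[where a=y and b=x and f=f] by simp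
          ultimately have "norm (integral {a..y} f - integral {a..x} f - (y - x) *\<^sub>R f x) =
             norm (- (integral {-x..-y} (\<lambda>x. f (- x)) - (x - y) *\<^sub>R f x))"
            by (simp add: algebra_simps)
          also have "\<dots> \<le> e * (x - y)" unfolding norm_minus_cancel by (rule *(2))
          finally show ?thesis using yx by simp
        qed
      qed (use d1 d2 in auto)
    qed
  qed
qed

text \<open>The derivative is two-sided but asked for in the open interval only, so values of
  \<open>u\<close> outside {a..b} have no influence. For b < a the predicate is vacuous, which makes
  it harmless to speak of solutions on {0..b} for all \<open>b\<close>.\<close>

definition ac_deriv :: "real \<Rightarrow> real \<Rightarrow> (real \<Rightarrow> 'a::real_normed_vector) \<Rightarrow> (real \<Rightarrow> 'a) \<Rightarrow> bool" where
  "ac_deriv a b u f \<longleftrightarrow> abs_cont_on {a..b} u \<and>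
     (\<exists>N. negligible N \<and> (\<forall>x\<in>{a<..<b} - N. (u has_vector_derivative f x) (at x)))"

lemma ac_deriv_continuous: "ac_deriv a b u f \<Longrightarrow> continuous_on {a..b} u"
  unfolding ac_deriv_def using abs_cont_on_imp_continuous_on by blast

text \<open>A direct gauge argument. At tags off the null set the gauge comes from
  differentiability, and the error is proportional to the length of the cell. At tags in the null
  set it comes from an open cover of measure below \<delta>, and absolute continuity bounds the
  increments of \<open>u\<close> over those cells.\<close>

lemma ac_deriv_imp_has_integral:
  fixes u :: "real \<Rightarrow> 'a::euclidean_space"
  assumes u: "ac_deriv a b u f" and ab: "a \<le> b"
  shows "(f has_integral (u b - u a)) {a..b}"
proof (cases "a = b")
  case True thus ?thesis using has_integral_null_real[of b b f] by simp
next
  case False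
  hence ab': "a < b" using ab by simp
  obtain N0 where N0: "negligible N0" "\<And>x. x \<in> {a<..<b} - N0 \<Longrightarrow> (u has_vector_derivative f x) (at x)"
    using u unfolding ac_deriv_def by blast
  have ac: "abs_cont_on {a..b} u" using u unfolding ac_deriv_def by blast
  define N where "N = N0 \<union> {a, b}"
  have N: "negligible N" unfolding N_def using N0(1) by (intro negligible_Un) auto
  \<comment> \<open>With the value 0 on \<open>N\<close>, cells tagged there contribute only their
    increments of \<open>u\<close>.\<close>
  define g where "g x = (if x \<in> N then 0 else f x)" for x
  have "(g has_integral (u b - u a)) {a..b}"
    unfolding has_integral_real
  proof (intro allI impI)
    fix e :: real assume e: "e > 0"
    \<comment> \<open>Cells tagged off \<open>N\<close> then have errors adding up to at most e / 4;
      the others are allotted e / 2.\<close>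
    define e1 where "e1 = e / 4 / (b - a)"
    have e1: "e1 > 0" using e ab' by (simp add: e1_def)
    obtain \<delta> where d: "\<delta> > 0" and D: "\<And>D. D division_of (\<Union>D) \<Longrightarrow> \<Union>D \<subseteq> {a..b} \<Longrightarrow>
        (\<Sum>K\<in>D. Sup K - Inf K) < \<delta> \<Longrightarrow> (\<Sum>K\<in>D. norm (u (Sup K) - u (Inf K))) < e / 2"
      using ac e unfolding abs_cont_on_def by (meson half_gt_zero)
    have Nm: "N \<in> lmeasurable" "measure lebesgue N = 0"
      using N by (auto simp: negligible_imp_measurable negligible_imp_measure0)
    obtain G where G: "open G" "N \<subseteq> G" "G \<in> lmeasurable" "measure lebesgue G < \<delta>"
    proof -
      obtain G where G: "open G" "N \<subseteq> G" "G - N \<in> lmeasurable" "emeasure lebesgue (G - N) < ennreal \<delta>"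
        using sets_lebesgue_outer_open[OF fmeasurableD[OF Nm(1)] d] by blast
      have "G \<in> lmeasurable" using fmeasurable.Un[OF Nm(1) G(3)] G(2) by (simp add: Un_absorb1)
      moreover have "measure lebesgue (G - N) < \<delta>"
        using G(3,4) d by (metis emeasure_eq_measure2 ennreal_less_iff measure_nonneg)
      moreover have "measure lebesgue G \<le> measure lebesgue N + measure lebesgue (G - N)"
        using measure_Un_le[of N lebesgue "G - N"] Nm(1) G(2,3) by (simp add: fmeasurableD Un_absorb1)
      ultimately show ?thesis using that G Nm(2) by auto
    qed
    have "\<exists>d>0. \<forall>y. \<bar>y - x\<bar> < d \<longrightarrow> norm (u y - u x - (y - x) *\<^sub>R f x) \<le> e1 * \<bar>y - x\<bar>" if "x \<in> {a..b} - N" for x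
    proof -
      have "(u has_vector_derivative f x) (at x)" using that N0(2)[of x] by (auto simp: N_def)
      hence "\<forall>e>0. \<forall>\<^sub>F y in at x. norm (u y - u x - (y - x) *\<^sub>R f x) \<le> e * norm (y - x)"
        unfolding has_vector_derivative_def has_derivative_within_alt2 by blast
      then obtain d where "d > 0" "\<And>y. y \<noteq> x \<Longrightarrow> dist y x < d \<Longrightarrow> norm (u y - u x - (y - x) *\<^sub>R f x) \<le> e1 * norm (y - x)"
        using e1 unfolding eventually_at by blast
      thus ?thesis by (intro exI[of _ d]) (metis dist_real_def real_norm_def diff_self scaleR_zero_left norm_zero mult_zero_right order_refl abs_zero)
    qed
    then obtain r where r: "\<And>x. x \<in> {a..b} - N \<Longrightarrow> r x > 0"
      "\<And>x y. x \<in> {a..b} - N \<Longrightarrow> \<bar>y - x\<bar> < r x \<Longrightarrow> norm (u y - u x - (y - x) *\<^sub>R f x) \<le> e1 * \<bar>y - x\<bar>" by metis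
    define \<gamma> where "\<gamma> x = (if x \<in> N then G else if x \<in> {a..b} then ball x (r x) else ball x 1)" for x
    have gauge: "gauge \<gamma>" unfolding gauge_def \<gamma>_def using G r by auto
    show "\<exists>\<gamma>. gauge \<gamma> \<and> (\<forall>\<D>. \<D> tagged_division_of {a..b} \<and> \<gamma> fine \<D> \<longrightarrow>
        norm ((\<Sum>(x, k)\<in>\<D>. measure lborel k *\<^sub>R g x) - (u b - u a)) < e)"
    proof (intro exI[of _ \<gamma>] conjI gauge allI impI; elim conjE)
      fix P assume P: "P tagged_division_of {a..b}" and fine: "\<gamma> fine P"
      note Pfin = tagged_division_of_finite[OF P]
      have cell: "K = {Inf K..Sup K} \<and> Inf K \<le> Sup K \<and> x \<in> K \<and> K \<subseteq> {a..b} \<and> measure lborel K = Sup K - Inf K"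
        if xK: "(x, K) \<in> P" for x K
      proof -
        obtain c d where K: "K = cbox c d" using tagged_division_ofD(4)[OF P xK] by blast
        have x: "x \<in> K" using tagged_division_ofD(2)[OF P xK] .
        hence "c \<le> d" using K by auto
        thus ?thesis using K x tagged_division_ofD(3)[OF P xK] by auto
      qed
      define P1 where "P1 = {(x, K) \<in> P. x \<notin> N}"
      define P2 where "P2 = {(x, K) \<in> P. x \<in> N}"
      have P12: "P = P1 \<union> P2" "P1 \<inter> P2 = {}" by (auto simp: P1_def P2_def)
      have fin: "finite P1" "finite P2" using Pfin P12 by auto
      have incr: "(\<Sum>(x, K)\<in>P. u (Sup K) - u (Inf K)) = u b - u a"
        by (rule additive_tagged_division_1[OF ab P])
      have "(\<Sum>(x, k)\<in>P. measure lborel k *\<^sub>R g x) - (u b - u a)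
          = (\<Sum>(x, K)\<in>P. measure lborel K *\<^sub>R g x - (u (Sup K) - u (Inf K)))"
        unfolding incr[symmetric] by (simp add: sum_subtractf case_prod_unfold)
      also have "\<dots> = (\<Sum>(x, K)\<in>P1. measure lborel K *\<^sub>R g x - (u (Sup K) - u (Inf K)))
          + (\<Sum>(x, K)\<in>P2. measure lborel K *\<^sub>R g x - (u (Sup K) - u (Inf K)))"
        unfolding P12(1) by (rule sum.union_disjoint[OF fin P12(2)])
      finally have eq: "(\<Sum>(x, k)\<in>P. measure lborel k *\<^sub>R g x) - (u b - u a) = \<dots>" .
      have b1: "norm (\<Sum>(x, K)\<in>P1. measure lborel K *\<^sub>R g x - (u (Sup K) - u (Inf K))) \<le> e / 4"
      proof -
        have "norm (\<Sum>(x, K)\<in>P1. measure lborel K *\<^sub>R g x - (u (Sup K) - u (Inf K))) \<le> (\<Sum>(x, K)\<in>P1. e1 * measure lborel K)"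
        proof (rule sum_norm_le, clarify)
          fix x K assume xK: "(x, K) \<in> P1"
          hence xP: "(x, K) \<in> P" and xN: "x \<notin> N" by (auto simp: P1_def)
          note c = cell[OF xP]
          define s t where "s = Inf K" and "t = Sup K"
          have K: "K = {s..t}" "s \<le> x" "x \<le> t" "measure lborel K = t - s" and xab: "x \<in> {a..b} - N"
            using c xN unfolding s_def t_def by auto
          have "K \<subseteq> \<gamma> x" using fine xP unfolding fine_def by auto
          hence "K \<subseteq> ball x (r x)" using xab by (simp add: \<gamma>_def)
          moreover have "s \<in> K" "t \<in> K" using K by auto
          ultimately have "s \<in> ball x (r x)" "t \<in> ball x (r x)" by auto
          hence "\<bar>s - x\<bar> < r x" "\<bar>t - x\<bar> < r x" by (auto simp: dist_real_def)
          hence 1: "norm (u s - u x - (s - x) *\<^sub>R f x) \<le> e1 * (x - s)" "norm (u t - u x - (t - x) *\<^sub>R f x) \<le> e1 * (t - x)"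
            using r(2)[OF xab, of s] r(2)[OF xab, of t] K by auto
          have "measure lborel K *\<^sub>R g x - (u t - u s) = (u s - u x - (s - x) *\<^sub>R f x) - (u t - u x - (t - x) *\<^sub>R f x)"
            using xN K by (simp add: g_def algebra_simps)
          also have "norm \<dots> \<le> e1 * (x - s) + e1 * (t - x)" using 1 by (meson add_mono norm_triangle_le_diff order_refl)
          also have "\<dots> = e1 * measure lborel K" using K by (simp add: algebra_simps)
          finally show "norm (measure lborel K *\<^sub>R g x - (u (Sup K) - u (Inf K))) \<le> e1 * measure lborel K"
            by (simp add: s_def t_def)
        qed
        also have "\<dots> \<le> (\<Sum>(x, K)\<in>P. e1 * measure lborel K)"
          using e1 P12 Pfin by (intro sum_mono2) auto
        also have "\<dots> = e1 * (\<Sum>(x, K)\<in>P. measure lborel K)" by (simp add: sum_distrib_left case_prod_unfold)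
        also have "(\<Sum>(x, K)\<in>P. measure lborel K) = b - a"
          using additive_content_tagged_division[of P a b] P ab by simp
        also have "e1 * (b - a) = e / 4"
        proof -
          have ne: "b - a \<noteq> 0" using ab' by simp
          show ?thesis unfolding e1_def using ne by (rule nonzero_eq_divide_eq[THEN iffD1, OF _ refl])
        qed
        finally show ?thesis .
      qed
      have b2: "norm (\<Sum>(x, K)\<in>P2. measure lborel K *\<^sub>R g x - (u (Sup K) - u (Inf K))) < e / 2"
      proof -
        have P2p: "P2 tagged_partial_division_of {a..b}"
          by (rule tagged_partial_division_subset[of P]) (use P in \<open>auto simp: P2_def tagged_division_of_def\<close>)
        have P2u: "P2 tagged_division_of (\<Union>(snd ` P2))" by (rule tagged_partial_division_of_Union_self[OF P2p])
        have div: "snd ` P2 division_of \<Union>(snd ` P2)" by (rule division_of_tagged_division[OF P2u])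
        have sub: "\<Union>(snd ` P2) \<subseteq> {a..b}" using cell P12 by fastforce
        have subG: "\<Union>(snd ` P2) \<subseteq> G"
        proof
          fix y assume "y \<in> \<Union>(snd ` P2)"
          then obtain x K where xK: "(x, K) \<in> P2" "y \<in> K" by auto
          hence "K \<subseteq> \<gamma> x" "x \<in> N" using fine unfolding fine_def P2_def by auto
          thus "y \<in> G" using xK by (auto simp: \<gamma>_def)
        qed
        have "(\<Sum>K\<in>snd ` P2. Sup K - Inf K) = (\<Sum>K\<in>snd ` P2. measure lebesgue K)"
        proof (rule sum.cong)
          fix K assume K: "K \<in> snd ` P2"
          have "measure lebesgue {Inf K..Sup K} = Sup K - Inf K" using division_Inf_Sup(3)[OF div K] by simp
          thus "Sup K - Inf K = measure lebesgue K" using division_Inf_Sup(4)[OF div K] by simp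
        qed simp
        also have "\<dots> = measure lebesgue (\<Union>(snd ` P2))"
          using content_division[OF div] by simp
        also have "\<dots> \<le> measure lebesgue G"
          by (rule measure_mono_fmeasurable[OF subG _ G(3)]) (use div in \<open>auto intro!: fmeasurableD lmeasurable_division\<close>)
        finally have "(\<Sum>K\<in>snd ` P2. norm (u (Sup K) - u (Inf K))) < e / 2"
          using G(4) by (intro D[OF div sub]) auto
        moreover have "(\<Sum>(x, K)\<in>P2. norm (u (Sup K) - u (Inf K))) = (\<Sum>K\<in>snd ` P2. norm (u (Sup K) - u (Inf K)))"
        proof -
          \<comment> \<open>Passing from tagged cells to the set of cells requires a function that
            vanishes on all degenerate boxes, including the empty one, whose Sup and Inf are
            unspecified.\<close>
          define \<phi> where "\<phi> K = (if K = {} then 0 else norm (u (Sup K) - u (Inf K)))" for K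
          have "(\<Sum>(x, K)\<in>P2. \<phi> K) = (\<Sum>K\<in>snd ` P2. \<phi> K)"
          proof (rule sum.over_tagged_division_lemma[OF P2u])
            fix c d :: real assume "box c d = {}"
            hence "d \<le> c" by auto
            thus "\<phi> (cbox c d) = 0" by (cases "c = d") (auto simp: \<phi>_def)
          qed
          moreover have "K \<noteq> {}" if "K \<in> snd ` P2" for K using division_Inf_Sup(1)[OF div that] by auto
          hence "\<phi> K = norm (u (Sup K) - u (Inf K))" if "K \<in> snd ` P2" for K using that by (simp add: \<phi>_def)
          hence \<phi>: "\<phi> (snd q) = norm (u (Sup (snd q)) - u (Inf (snd q)))" if "q \<in> P2" for q using that by blast
          have "(\<Sum>K\<in>snd ` P2. \<phi> K) = (\<Sum>K\<in>snd ` P2. norm (u (Sup K) - u (Inf K)))"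
            by (rule sum.cong) (use \<phi> in auto)
          moreover have "(\<Sum>(x, K)\<in>P2. \<phi> K) = (\<Sum>(x, K)\<in>P2. norm (u (Sup K) - u (Inf K)))"
            unfolding case_prod_unfold by (rule sum.cong) (use \<phi> in auto)
          ultimately show ?thesis by simp
        qed
        moreover have "norm (\<Sum>(x, K)\<in>P2. measure lborel K *\<^sub>R g x - (u (Sup K) - u (Inf K))) \<le> (\<Sum>(x, K)\<in>P2. norm (u (Sup K) - u (Inf K)))"
          by (rule sum_norm_le) (auto simp: P2_def g_def norm_minus_commute)
        ultimately show ?thesis by simp
      qed
      have "norm ((\<Sum>(x, k)\<in>P. measure lborel k *\<^sub>R g x) - (u b - u a)) \<le>
          norm (\<Sum>(x, K)\<in>P1. measure lborel K *\<^sub>R g x - (u (Sup K) - u (Inf K))) +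
          norm (\<Sum>(x, K)\<in>P2. measure lborel K *\<^sub>R g x - (u (Sup K) - u (Inf K)))"
        unfolding eq by (rule norm_triangle_ineq)
      thus "norm ((\<Sum>(x, k)\<in>P. measure lborel k *\<^sub>R g x) - (u b - u a)) < e" using b1 b2 e by linarith
    qed
  qed
  thus ?thesis by (rule has_integral_spike[OF N, rotated]) (auto simp: g_def)
qed

lemma ac_deriv_eq_integral:
  fixes u :: "real \<Rightarrow> 'a::euclidean_space"
  assumes "ac_deriv a b u f" "a \<le> b"
  shows "u b = u a + integral {a..b} f"
  using integral_unique[OF ac_deriv_imp_has_integral[OF assms]] by simp

lemma ac_deriv_integral:
  fixes f :: "real \<Rightarrow> 'a::euclidean_space"
  assumes "f absolutely_integrable_on {a..b}"
  shows "ac_deriv a b (\<lambda>x. c + integral {a..x} f) f"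
proof -
  have "abs_cont_on {a..b} (\<lambda>x. c + integral {a..x} f)"
    by (rule abs_cont_on_dominated1[OF abs_cont_on_integral[OF assms], where C=1]) simp
  moreover have "f integrable_on {a..b}" using assms by (rule set_lebesgue_integral_eq_integral(1))
  then obtain N where "negligible N"
    "\<And>x. x \<in> {a<..<b} - N \<Longrightarrow> ((\<lambda>x. integral {a..x} f) has_vector_derivative f x) (at x)"
    using Lebesgue_differentiation by blast
  hence "\<exists>N. negligible N \<and> (\<forall>x\<in>{a<..<b} - N. ((\<lambda>x. c + integral {a..x} f) has_vector_derivative f x) (at x))"
    by (intro exI[of _ N]) (auto intro!: derivative_eq_intros)
  ultimately show ?thesis unfolding ac_deriv_def by blast
qed

lemma ac_deriv_subinterval:
  assumes "ac_deriv a b u f" "a \<le> c" "d \<le> b"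
  shows "ac_deriv c d u f"
proof -
  have "{c..d} \<subseteq> {a..b}" "{c<..<d} \<subseteq> {a<..<b}" using assms by auto
  thus ?thesis using assms(1) unfolding ac_deriv_def by (meson abs_cont_on_subset Diff_mono order_refl subsetD)
qed

lemma ac_deriv_add:
  assumes "ac_deriv a b u f" "ac_deriv a b v g"
  shows "ac_deriv a b (\<lambda>x. u x + v x) (\<lambda>x. f x + g x)"
proof -
  obtain N M where "negligible N" "negligible M" "\<And>x. x \<in> {a<..<b} - N \<Longrightarrow> (u has_vector_derivative f x) (at x)"
    "\<And>x. x \<in> {a<..<b} - M \<Longrightarrow> (v has_vector_derivative g x) (at x)"
    using assms unfolding ac_deriv_def by blast
  moreover have "abs_cont_on {a..b} (\<lambda>x. u x + v x)"
    by (rule abs_cont_on_dominated[where u=u and v=v and C=1])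
      (use assms in \<open>auto simp: ac_deriv_def add_diff_add intro: norm_triangle_ineq\<close>)
  ultimately show ?thesis unfolding ac_deriv_def
    by (auto intro!: exI[of _ "N \<union> M"] has_vector_derivative_add)
qed

lemma ac_deriv_linear:
  assumes L: "bounded_linear L" and u: "ac_deriv a b u f"
  shows "ac_deriv a b (\<lambda>x. L (u x)) (\<lambda>x. L (f x))"
proof -
  obtain K where K: "\<And>x. norm (L x) \<le> norm x * K" using bounded_linear.bounded[OF L] by blast
  have "abs_cont_on {a..b} (\<lambda>x. L (u x))"
    by (rule abs_cont_on_dominated1[where u=u and C=K])
      (use u K in \<open>auto simp: ac_deriv_def bounded_linear.linear[OF L] mult.commute linear_diff[symmetric]\<close>)
  thus ?thesis using u unfolding ac_deriv_def
    using bounded_linear.has_vector_derivative[OF L] by blast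
qed

text \<open>One product rule for multiplication, inner products and scalar multiples: the increment
  splits into two terms, and continuity bounds the factor that is not differenced.\<close>

lemma ac_deriv_bilinear:
  assumes B: "bounded_bilinear pr" and u: "ac_deriv a b u f" and v: "ac_deriv a b v g"
  shows "ac_deriv a b (\<lambda>x. pr (u x) (v x)) (\<lambda>x. pr (u x) (g x) + pr (f x) (v x))"
proof -
  interpret bounded_bilinear pr by fact
  obtain K where K: "K > 0" "\<And>x y. norm (pr x y) \<le> norm x * norm y * K" using pos_bounded by blast
  have bdd: "\<exists>c>0. \<forall>x\<in>{a..b}. norm (w x) \<le> c" if "continuous_on {a..b} w" for w :: "real \<Rightarrow> 'z::real_normed_vector"
  proof -
    have "bounded (w ` {a..b})" by (intro compact_imp_bounded compact_continuous_image that) auto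
    then obtain c where "c > 0" "\<forall>x\<in>w ` {a..b}. norm x \<le> c" unfolding bounded_pos by blast
    thus ?thesis by auto
  qed
  obtain c where c: "c > 0" "\<And>x. x \<in> {a..b} \<Longrightarrow> norm (u x) \<le> c" using bdd[OF ac_deriv_continuous[OF u]] by blast
  obtain d where d: "d > 0" "\<And>x. x \<in> {a..b} \<Longrightarrow> norm (v x) \<le> d" using bdd[OF ac_deriv_continuous[OF v]] by blast
  obtain N M where NM: "negligible N" "negligible M" "\<And>x. x \<in> {a<..<b} - N \<Longrightarrow> (u has_vector_derivative f x) (at x)"
    "\<And>x. x \<in> {a<..<b} - M \<Longrightarrow> (v has_vector_derivative g x) (at x)"
    using u v unfolding ac_deriv_def by blast
  have "abs_cont_on {a..b} (\<lambda>x. pr (u x) (v x))"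
  proof (rule abs_cont_on_dominated[where u=u and v=v and C="(c + d) * K"])
    fix x y assume xy: "x \<in> {a..b}" "y \<in> {a..b}"
    have "pr (u x) (v x) - pr (u y) (v y) = pr (u x - u y) (v x) + pr (u y) (v x - v y)"
      by (simp add: diff_left diff_right)
    also have "norm \<dots> \<le> norm (u x - u y) * norm (v x) * K + norm (u y) * norm (v x - v y) * K"
      by (rule norm_triangle_le[OF add_mono[OF K(2) K(2)]])
    also have "\<dots> \<le> norm (u x - u y) * (c + d) * K + (c + d) * norm (v x - v y) * K"
      using c d K(1) c(2)[OF xy(2)] d(2)[OF xy(1)] by (intro add_mono mult_right_mono mult_left_mono) auto
    finally show "norm (pr (u x) (v x) - pr (u y) (v y)) \<le> (c + d) * K * (norm (u x - u y) + norm (v x - v y))"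
      by (simp add: algebra_simps)
  qed (use u v in \<open>auto simp: ac_deriv_def\<close>)
  moreover have "((\<lambda>x. pr (u x) (v x)) has_vector_derivative pr (u x) (g x) + pr (f x) (v x)) (at x)"
    if "x \<in> {a<..<b} - (N \<union> M)" for x
    by (rule has_vector_derivative[OF NM(3) NM(4)]) (use that in auto)
  ultimately show ?thesis unfolding ac_deriv_def using NM(1,2) by (blast intro: negligible_Un)
qed

lemmas ac_deriv_mult = ac_deriv_bilinear[OF bounded_bilinear_mult]

lemma ac_deriv_cong:
  assumes "ac_deriv a b u f" "\<And>x. x \<in> {a..b} \<Longrightarrow> u x = v x" "\<And>x. x \<in> {a<..<b} \<Longrightarrow> f x = g x"
  shows "ac_deriv a b v g"
proof -
  obtain N where N: "negligible N" "\<And>x. x \<in> {a<..<b} - N \<Longrightarrow> (u has_vector_derivative f x) (at x)"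
    using assms(1) unfolding ac_deriv_def by blast
  have "(v has_vector_derivative g x) (at x)" if x: "x \<in> {a<..<b} - N" for x
  proof -
    have "(u has_vector_derivative g x) (at x)" using N(2)[OF x] assms(3) x by auto
    thus ?thesis by (rule has_vector_derivative_transform_within_open[of _ _ _ "{a<..<b}"]) (use x assms(2) in auto)
  qed
  moreover have "abs_cont_on {a..b} v" using assms abs_cont_on_cong unfolding ac_deriv_def by blast
  ultimately show ?thesis unfolding ac_deriv_def using N(1) by blast
qed

lemma ac_deriv_cmult: 
  fixes c :: "'a::real_normed_algebra"
  shows "ac_deriv a b u f \<Longrightarrow> ac_deriv a b (\<lambda>x. c * u x) (\<lambda>x. c * f x)"
  by (rule ac_deriv_linear[OF bounded_linear_mult_right])

lemma ac_deriv_diff: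
  assumes "ac_deriv a b u f" "ac_deriv a b v g"
  shows "ac_deriv a b (\<lambda>x. u x - v x) (\<lambda>x. f x - g x)"
  using ac_deriv_add[OF assms(1) ac_deriv_linear[OF bounded_linear_minus[OF bounded_linear_ident] assms(2)]] by simp

lemma ac_deriv_exp:
  fixes u :: "real \<Rightarrow> real"
  assumes u: "ac_deriv a b u f"
  shows "ac_deriv a b (\<lambda>x. exp (u x)) (\<lambda>x. exp (u x) * f x)"
proof -
  have "bounded (u ` {a..b})" by (intro compact_imp_bounded compact_continuous_image ac_deriv_continuous[OF u]) auto
  then obtain c where "\<forall>x\<in>u ` {a..b}. \<bar>x\<bar> \<le> c" unfolding bounded_real by blast
  hence c: "u x \<le> c" if "x \<in> {a..b}" for x using that by (auto dest: abs_le_D1)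
  have *: "exp t - exp s \<le> exp c * (t - s)" if "t \<le> c" "s \<le> t" for s t :: real
  proof -
    have "1 - exp (s - t) \<le> t - s" using exp_ge_add_one_self[of "s - t"] by linarith
    hence "exp t * (1 - exp (s - t)) \<le> exp t * (t - s)" by (intro mult_left_mono) auto
    also have "\<dots> \<le> exp c * (t - s)" using that by (intro mult_right_mono) auto
    finally show ?thesis by (simp add: right_diff_distrib exp_diff)
  qed
  have "abs_cont_on {a..b} (\<lambda>x. exp (u x))"
  proof (rule abs_cont_on_dominated1[where u=u and C="exp c"])
    fix x y assume xy: "x \<in> {a..b}" "y \<in> {a..b}"
    show "norm (exp (u x) - exp (u y)) \<le> exp c * norm (u x - u y)"
      using *[OF c[OF xy(1)], of "u y"] *[OF c[OF xy(2)], of "u x"] by (cases "u x \<le> u y") auto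
  qed (use u in \<open>simp add: ac_deriv_def\<close>)
  moreover have "((\<lambda>x. exp (u x)) has_vector_derivative exp (u x) * f x) (at x)" if "(u has_vector_derivative f x) (at x)" for x
  proof -
    have "(u has_real_derivative f x) (at x)" using that by (simp add: has_real_derivative_iff_has_vector_derivative)
    hence "((\<lambda>x. exp (u x)) has_real_derivative exp (u x) * f x) (at x)" by (rule DERIV_fun_exp)
    thus ?thesis by (simp add: has_real_derivative_iff_has_vector_derivative)
  qed
  ultimately show ?thesis using u unfolding ac_deriv_def by blast
qed

section \<open>Linear differential equations with integrable coefficients\<close>

lemma absolutely_integrable_scaleR_continuous:
  fixes f :: "real \<Rightarrow> real" and g :: "real \<Rightarrow> 'a::euclidean_space"
  assumes f: "f absolutely_integrable_on {a..b}" and g: "continuous_on {a..b} g"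
  shows "(\<lambda>x. f x *\<^sub>R g x) absolutely_integrable_on {a..b}"
proof (rule absolutely_integrable_bounded_measurable_product[where h="\<lambda>y x. x *\<^sub>R y" and g=f and f=g])
  show "bilinear (\<lambda>(y::'a) x. x *\<^sub>R y)"
    by (simp add: bilinear_def linear_iff scaleR_add_left scaleR_add_right)
  show "g \<in> borel_measurable (lebesgue_on {a..b})"
    by (rule continuous_imp_measurable_on_sets_lebesgue[OF g]) simp
  show "bounded (g ` {a..b})" by (intro compact_imp_bounded compact_continuous_image g) auto
qed (use f in auto)

text \<open>Integrating factors: n exp (-C) has nonpositive and n exp C nonnegative derivative,
  where C is the integral of \<open>c\<close>. The second bound carries information backwards, from
  \<open>b\<close> to \<open>a\<close>.\<close>

lemma gronwall:
  fixes n f c :: "real \<Rightarrow> real"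
  assumes n: "ac_deriv a b n f" and c: "c absolutely_integrable_on {a..b}" and ab: "a \<le> b"
    and f: "\<And>x. x \<in> {a<..<b} \<Longrightarrow> \<bar>f x\<bar> \<le> c x * n x"
  shows "n b \<le> n a * exp (integral {a..b} c)" "n a \<le> n b * exp (integral {a..b} c)"
proof -
  define C where "C x = integral {a..x} c" for x
  have C: "ac_deriv a b C c" using ac_deriv_integral[OF c, of 0] by (simp add: C_def[abs_def])
  have mC: "ac_deriv a b (\<lambda>x. - C x) (\<lambda>x. - c x)" using ac_deriv_cmult[OF C, of "-1"] by simp
  have C0: "C a = 0" by (simp add: C_def)
  have "((\<lambda>x. n x * (exp (- C x) * - c x) + f x * exp (- C x)) has_integral (n b * exp (- C b) - n a * exp (- C a))) {a..b}"
    by (rule ac_deriv_imp_has_integral[OF ac_deriv_mult[OF n ac_deriv_exp[OF mC]] ab])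
  \<comment> \<open>The estimate on \<open>f\<close> holds in the open interval only, so the
    endpoints are dropped.\<close>
  hence "((\<lambda>x. n x * (exp (- C x) * - c x) + f x * exp (- C x)) has_integral (n b * exp (- C b) - n a * exp (- C a))) {a<..<b}"
    by (simp add: has_integral_Icc_iff_Ioo)
  moreover have "n x * (exp (- C x) * - c x) + f x * exp (- C x) \<le> 0" if "x \<in> {a<..<b}" for x
  proof -
    have "n x * (exp (- C x) * - c x) + f x * exp (- C x) = exp (- C x) * (f x - c x * n x)" by (simp add: algebra_simps)
    also have "\<dots> \<le> 0" using f[OF that] by (intro mult_nonneg_nonpos) auto
    finally show ?thesis .
  qed
  ultimately have "n b * exp (- C b) - n a * exp (- C a) \<le> 0"
    using has_integral_le[OF _ has_integral_0] by blast
  hence "n b * exp (- C b) * exp (C b) \<le> n a * exp (C b)" using C0 by (intro mult_right_mono) auto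
  thus "n b \<le> n a * exp (integral {a..b} c)" by (simp add: C_def mult.assoc flip: exp_add)
  have "((\<lambda>x. n x * (exp (C x) * c x) + f x * exp (C x)) has_integral (n b * exp (C b) - n a * exp (C a))) {a..b}"
    by (rule ac_deriv_imp_has_integral[OF ac_deriv_mult[OF n ac_deriv_exp[OF C]] ab])
  hence "((\<lambda>x. n x * (exp (C x) * c x) + f x * exp (C x)) has_integral (n b * exp (C b) - n a * exp (C a))) {a<..<b}"
    by (simp add: has_integral_Icc_iff_Ioo)
  moreover have "0 \<le> n x * (exp (C x) * c x) + f x * exp (C x)" if "x \<in> {a<..<b}" for x
  proof -
    have "n x * (exp (C x) * c x) + f x * exp (C x) = exp (C x) * (f x + c x * n x)" by (simp add: algebra_simps)
    moreover have "0 \<le> exp (C x) * (f x + c x * n x)" using f[OF that] by (intro mult_nonneg_nonneg) auto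
    ultimately show ?thesis by simp
  qed
  ultimately have "0 \<le> n b * exp (C b) - n a * exp (C a)"
    using has_integral_le[OF has_integral_0] by blast
  thus "n a \<le> n b * exp (integral {a..b} c)" using C0 by (simp add: C_def)
qed

lemma ac_deriv_power:
  fixes u :: "real \<Rightarrow> real"
  assumes u: "ac_deriv a b u f"
  shows "ac_deriv a b (\<lambda>x. u x ^ Suc n) (\<lambda>x. real (Suc n) * u x ^ n * f x)"
proof (induction n)
  case (Suc n)
  from ac_deriv_mult[OF u Suc] show ?case
    by (rule ac_deriv_cong) (auto simp: algebra_simps)
qed (use u in simp)

text \<open>Picard iteration under Caratheodory conditions. With \<open>a\<close> the integral of
  \<open>\<alpha>\<close>, the n-th term is bounded by |y0| a(x)^n / n!, so the series converges,
  and dominated convergence takes the limit inside the integral equation.\<close>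

proposition linear_ode_solution:
  fixes A :: "real \<Rightarrow> 'a::euclidean_space \<Rightarrow> 'a" and \<alpha> :: "real \<Rightarrow> real"
  assumes lin: "\<And>t. linear (A t)" and bd: "\<And>t x. norm (A t x) \<le> \<alpha> t * norm x"
    and int: "\<And>b Y. continuous_on {0..b} Y \<Longrightarrow> (\<lambda>t. A t (Y t)) absolutely_integrable_on {0..b}"
    and alpha: "\<And>b. \<alpha> absolutely_integrable_on {0..b}" and \<alpha>0: "\<And>t. 0 \<le> \<alpha> t"
  shows "\<exists>Z. Z 0 = y0 \<and> (\<forall>b. ac_deriv 0 b Z (\<lambda>t. A t (Z t)))"
proof -
  \<comment> \<open>These are the differences of successive Picard iterates; the iterates themselves
    are the partial sums \<open>S\<close>.\<close>
  define Y where "Y = rec_nat (\<lambda>x. y0) (\<lambda>n g x. integral {0..x} (\<lambda>t. A t (g t)))"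
  have Y0: "Y 0 = (\<lambda>x. y0)" and YS: "Y (Suc n) = (\<lambda>x. integral {0..x} (\<lambda>t. A t (Y n t)))" for n
    by (simp_all add: Y_def)
  define a where "a x = integral {0..x} \<alpha>" for x
  have a: "ac_deriv 0 b a \<alpha>" for b using ac_deriv_integral[OF alpha, where c=0] by (simp add: a_def[abs_def])
  have ai: "\<alpha> integrable_on {0..b}" for b using alpha by (rule set_lebesgue_integral_eq_integral(1))
  have a0: "0 \<le> a x" for x unfolding a_def using \<alpha>0 by (intro integral_nonneg ai) auto
  have amono: "a x \<le> a y" if "x \<le> y" for x y unfolding a_def
    using that \<alpha>0 by (intro integral_subset_le ai) auto
  have Yc: "continuous_on {0..b} (Y n)" for n b
  proof (induction n)
    case (Suc n)
    from ac_deriv_continuous[OF ac_deriv_integral[OF int[OF Suc], of 0]] show ?case by (simp add: YS)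
  qed (simp add: Y0)
  have AYi: "(\<lambda>t. A t (Y n t)) integrable_on {0..b}" for n b
    using int[OF Yc] by (rule set_lebesgue_integral_eq_integral(1))
  define c where "c = norm y0"
  have Yb: "norm (Y n x) \<le> c * a x ^ n / fact n" if "0 \<le> x" for n x
    using that
  proof (induction n arbitrary: x)
    case (Suc n)
    \<comment> \<open>The induction step integrates the bound exactly: the derivative of a^(n+1) /
      (n+1)! is \<alpha> a^n / n!.\<close>
    have "ac_deriv 0 x (\<lambda>t. (c / fact (Suc n)) * a t ^ Suc n) (\<lambda>t. (c / fact (Suc n)) * (real (Suc n) * a t ^ n * \<alpha> t))"
      by (intro ac_deriv_cmult ac_deriv_power a)
    hence "((\<lambda>t. (c / fact (Suc n)) * (real (Suc n) * a t ^ n * \<alpha> t)) has_integral ((c / fact (Suc n)) * a x ^ Suc n)) {0..x}"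
      using ac_deriv_imp_has_integral[OF _ Suc(2)] by (fastforce simp: a_def)
    also have "(\<lambda>t. (c / fact (Suc n)) * (real (Suc n) * a t ^ n * \<alpha> t)) = (\<lambda>t. \<alpha> t * (c * a t ^ n / fact n))"
      by (simp add: fun_eq_iff field_simps del: of_nat_Suc)
    finally have I: "((\<lambda>t. \<alpha> t * (c * a t ^ n / fact n)) has_integral ((c / fact (Suc n)) * a x ^ Suc n)) {0..x}" .
    have "norm (Y (Suc n) x) \<le> integral {0..x} (\<lambda>t. \<alpha> t * (c * a t ^ n / fact n))"
      unfolding YS
    proof (rule integral_norm_bound_integral)
      show "(\<lambda>t. A t (Y n t)) integrable_on {0..x}" by (rule AYi)
      show "(\<lambda>t. \<alpha> t * (c * a t ^ n / fact n)) integrable_on {0..x}" using I by blast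
      fix t assume t: "t \<in> {0..x}"
      have "norm (A t (Y n t)) \<le> \<alpha> t * norm (Y n t)" by (rule bd)
      also have "\<dots> \<le> \<alpha> t * (c * a t ^ n / fact n)" using Suc(1)[of t] t \<alpha>0 by (intro mult_left_mono) auto
      finally show "norm (A t (Y n t)) \<le> \<alpha> t * (c * a t ^ n / fact n)" .
    qed
    also have "\<dots> = (c / fact (Suc n)) * a x ^ Suc n" using I by (rule integral_unique)
    finally show ?case by simp
  qed (simp add: Y0 c_def)
  define S where "S N x = (\<Sum>n<N. Y n x)" for N x
  define Z where "Z x = (if 0 \<le> x then suminf (\<lambda>n. Y n x) else y0)" for x
  have expb: "(\<lambda>n. c * a x ^ n / fact n) sums (c * exp (a x))" for x
    using sums_mult[OF exp_converges[of "a x"], of c] by (simp add: scaleR_conv_of_real field_simps)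
  have summ: "summable (\<lambda>n. Y n x)" if "0 \<le> x" for x
    by (rule summable_comparison_test'[OF sums_summable[OF expb[of x]]]) (use Yb that in auto)
  have SZ: "(\<lambda>N. S N x) \<longlonglongrightarrow> Z x" if "0 \<le> x" for x
    unfolding S_def Z_def using summable_LIMSEQ[OF summ[OF that]] that by simp
  have Sb: "norm (S N x) \<le> c * exp (a x)" if "0 \<le> x" for N x
  proof -
    have "norm (S N x) \<le> (\<Sum>n<N. c * a x ^ n / fact n)" unfolding S_def by (rule sum_norm_le) (use Yb that in auto)
    also have "\<dots> \<le> c * exp (a x)"
      using sum_le_suminf[OF sums_summable[OF expb[of x]], of "{..<N}"] sums_unique[OF expb[of x]] a0[of x]
      by (simp add: c_def)
    finally show ?thesis .
  qed
  have AS: "A t (S N t) = (\<Sum>n<N. A t (Y n t))" for t N unfolding S_def by (rule linear_sum[OF lin])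
  have ASint: "(\<lambda>t. A t (S N t)) integrable_on {0..b}" for N b
    unfolding AS by (intro integrable_sum AYi) auto
  have SI: "S (Suc N) x = y0 + integral {0..x} (\<lambda>t. A t (S N t))" if "0 \<le> x" for N x
  proof -
    have "integral {0..x} (\<lambda>t. A t (S N t)) = (\<Sum>n<N. integral {0..x} (\<lambda>t. A t (Y n t)))"
      unfolding AS by (intro integral_sum AYi) auto
    also have "y0 + \<dots> = S (Suc N) x" unfolding S_def sum.lessThan_Suc_shift by (simp add: Y0 YS)
    finally show ?thesis by simp
  qed
  have dom: "norm (A t (S N t)) \<le> \<alpha> t * (c * exp (a b))" if "t \<in> {0..b}" for N t b
  proof -
    have "norm (A t (S N t)) \<le> \<alpha> t * norm (S N t)" by (rule bd)
    also have "\<dots> \<le> \<alpha> t * (c * exp (a t))" using that \<alpha>0 Sb by (intro mult_left_mono) auto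
    also have "\<dots> \<le> \<alpha> t * (c * exp (a b))" using that \<alpha>0 amono[of t b] by (intro mult_left_mono) (auto simp: c_def)
    finally show ?thesis .
  qed
  have limA: "(\<lambda>N. A t (S N t)) \<longlonglongrightarrow> A t (Z t)" if "0 \<le> t" for t
    using linear_continuous_at[OF linear_conv_bounded_linear[THEN iffD1, OF lin], of "Z t" t] SZ[OF that]
    by (rule isCont_tendsto_compose)
  have di: "(\<lambda>t. \<alpha> t * (c * exp (a b))) integrable_on {0..b}" for b
    by (intro integrable_on_mult_left ai)
  have dc: "(\<lambda>t. A t (Z t)) integrable_on {0..b} \<and> (\<lambda>N. integral {0..b} (\<lambda>t. A t (S N t))) \<longlonglongrightarrow> integral {0..b} (\<lambda>t. A t (Z t))" for b
  proof -
    have l: "(\<lambda>k. A x (S k x)) \<longlonglongrightarrow> A x (Z x)" if "x \<in> {0..b}" for x using limA that by auto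
    from dominated_convergence[OF ASint di dom l] show ?thesis by blast
  qed
  have Zb: "norm (A t (Z t)) \<le> \<alpha> t * (c * exp (a b))" if t: "t \<in> {0..b}" for t b
    by (rule LIMSEQ_le_const2[OF tendsto_norm[OF limA]]) (use t dom[OF t] in auto)
  have AZ: "(\<lambda>t. A t (Z t)) absolutely_integrable_on {0..b}" for b
    by (rule absolutely_integrable_integrable_bound[OF Zb _ di]) (use dc in auto)
  have ZI: "Z x = y0 + integral {0..x} (\<lambda>t. A t (Z t))" if "0 \<le> x" for x
  proof (rule LIMSEQ_unique[OF LIMSEQ_Suc[OF SZ[OF that]]])
    show "(\<lambda>N. S (Suc N) x) \<longlonglongrightarrow> y0 + integral {0..x} (\<lambda>t. A t (Z t))"
      unfolding SI[OF that] using dc by (intro tendsto_intros) auto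
  qed
  have "ac_deriv 0 b Z (\<lambda>t. A t (Z t))" for b
    by (rule ac_deriv_cong[OF ac_deriv_integral[OF AZ, where c=y0]]) (use ZI in auto)
  moreover have "Z 0 = y0" using ZI[of 0] by simp
  ultimately show ?thesis by blast
qed

section \<open>The first-order system of the Sturm--Liouville equation\<close>

lemma ac_deriv_inner:
  "ac_deriv a b u f \<Longrightarrow> ac_deriv a b v g \<Longrightarrow> ac_deriv a b (\<lambda>x. u x \<bullet> v x) (\<lambda>x. u x \<bullet> g x + f x \<bullet> v x)"
  by (rule ac_deriv_bilinear[OF bounded_bilinear_inner])

text \<open>In the application \<open>s = \<sigma>\<close> and \<open>q = \<tau> - \<sigma>\<^sup>2\<close>. A solution of \<open>\<ell> U = z U\<close> is treated as the pair of \<open>U\<close> and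
  its quasi-derivative \<open>V\<close>.\<close>

locale sturm =
  fixes s q :: "real \<Rightarrow> real"
  assumes s_int: "\<And>b. s absolutely_integrable_on {0..b}"
    and q_int: "\<And>b. q absolutely_integrable_on {0..b}"
begin

text \<open>The quasi-derivative \<open>V\<close> comes before \<open>U\<close>, in the order of the
  rows of the transfer matrix.\<close>

definition is_sol :: "complex \<Rightarrow> real \<Rightarrow> real \<Rightarrow> (real \<Rightarrow> complex) \<Rightarrow> (real \<Rightarrow> complex) \<Rightarrow> bool" where
  "is_sol z a b V U \<longleftrightarrow>
     ac_deriv a b V (\<lambda>x. - of_real (s x) * V x + (of_real (q x) - z) * U x) \<and>
     ac_deriv a b U (\<lambda>x. V x + of_real (s x) * U x)"

text \<open>The Gronwall coefficient for |V|^2 + |U|^2: the diagonal terms give 2 |s|, the mixed one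
  is bounded through 2 |V| |U| <= |V|^2 + |U|^2. The number \<open>r\<close> bounds |z|, so the
  estimates are uniform over discs of spectral parameters.\<close>

definition growth :: "real \<Rightarrow> real \<Rightarrow> real" where
  "growth r x = 2 * \<bar>s x\<bar> + \<bar>q x\<bar> + r + 1"

lemma abs_int_sub:
  fixes f :: "real \<Rightarrow> real"
  assumes "\<And>b. f absolutely_integrable_on {0..b}" "0 \<le> a"
  shows "f absolutely_integrable_on {a..b}"
  by (rule absolutely_integrable_on_subinterval[OF assms(1)[of b]]) (use assms in auto)

lemma growth_int: "0 \<le> a \<Longrightarrow> growth r absolutely_integrable_on {a..b}"
proof -
  assume a: "0 \<le> a"
  have "(\<lambda>x. \<bar>s x\<bar>) absolutely_integrable_on {a..b}" "(\<lambda>x. \<bar>q x\<bar>) absolutely_integrable_on {a..b}"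
    using absolutely_integrable_norm[OF abs_int_sub[OF s_int a]] absolutely_integrable_norm[OF abs_int_sub[OF q_int a]]
    by (simp_all add: comp_def)
  moreover have "(\<lambda>x. r + 1) absolutely_integrable_on {a..b}" by (rule absolutely_integrable_on_const) auto
  ultimately show ?thesis unfolding growth_def[abs_def]
    using set_integral_add(1)[OF set_integral_add(1)[OF set_integrable_mult_right[of 2]]] by (simp add: add.assoc)
qed

lemma is_sol_subinterval: "is_sol z a b V U \<Longrightarrow> a \<le> c \<Longrightarrow> d \<le> b \<Longrightarrow> is_sol z c d V U"
  unfolding is_sol_def using ac_deriv_subinterval by blast

lemma is_sol_continuous: "is_sol z a b V U \<Longrightarrow> continuous_on {a..b} V" "is_sol z a b V U \<Longrightarrow> continuous_on {a..b} U"
  unfolding is_sol_def using ac_deriv_continuous by blast+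

lemma is_sol_combine:
  assumes "is_sol z a b V U" "is_sol z a b v u"
  shows "is_sol z a b (\<lambda>x. c * V x + d * v x) (\<lambda>x. c * U x + d * u x)"
proof -
  have "ac_deriv a b (\<lambda>x. c * V x + d * v x) (\<lambda>x. c * (- of_real (s x) * V x + (of_real (q x) - z) * U x)
        + d * (- of_real (s x) * v x + (of_real (q x) - z) * u x))"
    "ac_deriv a b (\<lambda>x. c * U x + d * u x) (\<lambda>x. c * (V x + of_real (s x) * U x) + d * (v x + of_real (s x) * u x))"
    using assms unfolding is_sol_def by (auto intro!: ac_deriv_add ac_deriv_cmult)
  thus ?thesis unfolding is_sol_def
    by (auto intro!: ac_deriv_cong[where u="\<lambda>x. c * V x + d * v x"] ac_deriv_cong[where u="\<lambda>x. c * U x + d * u x"]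
        simp: algebra_simps)
qed

section \<open>Wronskians, Green's identity, growth and uniqueness of solutions\<close>

lemma is_sol_cnj:
  assumes "is_sol z a b V U" shows "is_sol (cnj z) a b (\<lambda>x. cnj (V x)) (\<lambda>x. cnj (U x))"
proof -
  have "ac_deriv a b (\<lambda>x. cnj (V x)) (\<lambda>x. cnj (- of_real (s x) * V x + (of_real (q x) - z) * U x))"
    "ac_deriv a b (\<lambda>x. cnj (U x)) (\<lambda>x. cnj (V x + of_real (s x) * U x))"
    using assms ac_deriv_linear[OF bounded_linear_cnj] unfolding is_sol_def by blast+
  thus ?thesis unfolding is_sol_def by simp
qed

text \<open>Lagrange's identity: the terms with \<open>s\<close> and \<open>q\<close> cancel and
  only the difference of the spectral parameters remains.\<close>

lemma wronskian_deriv: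
  assumes "is_sol z a b V U" "is_sol w a b v u"
  shows "ac_deriv a b (\<lambda>x. V x * u x - U x * v x) (\<lambda>x. (w - z) * (U x * u x))"
proof -
  have "ac_deriv a b (\<lambda>x. V x * u x - U x * v x)
     (\<lambda>x. (V x * (v x + of_real (s x) * u x) + (- of_real (s x) * V x + (of_real (q x) - z) * U x) * u x)
        - (U x * (- of_real (s x) * v x + (of_real (q x) - w) * u x) + (V x + of_real (s x) * U x) * v x))"
    using assms unfolding is_sol_def by (intro ac_deriv_diff ac_deriv_mult) auto
  thus ?thesis by (rule ac_deriv_cong) (auto simp: algebra_simps)
qed

lemma wronskian_diff:
  assumes "is_sol z a b V U" "is_sol w a b v u" "a \<le> b"
  shows "V b * u b - U b * v b = V a * u a - U a * v a + (w - z) * integral {a..b} (\<lambda>x. U x * u x)"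
  using ac_deriv_eq_integral[OF wronskian_deriv[OF assms(1,2)] assms(3)] by simp

lemma wronskian_const:
  assumes "is_sol z a b V U" "is_sol z a b v u" "a \<le> b"
  shows "V b * u b - U b * v b = V a * u a - U a * v a"
  using wronskian_diff[OF assms] by simp

text \<open>The Wronskian of a solution with its conjugate, which solves the equation for cnj z
  because the coefficients are real.\<close>

lemma green:
  assumes sol: "is_sol z a b V U" and ab: "a \<le> b"
  shows "Im (V b * cnj (U b)) = Im (V a * cnj (U a)) - Im z * integral {a..b} (\<lambda>x. (cmod (U x))\<^sup>2)"
proof -
  have e: "integral {a..b} (\<lambda>x. U x * cnj (U x)) = of_real (integral {a..b} (\<lambda>x. (cmod (U x))\<^sup>2))"
  proof -
    have "continuous_on {a..b} (\<lambda>x. (cmod (U x))\<^sup>2)" by (intro continuous_intros is_sol_continuous(2)[OF sol])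
    hence "(\<lambda>x. (cmod (U x))\<^sup>2) integrable_on {a..b}" by (rule integrable_continuous_interval)
    hence "((\<lambda>x. complex_of_real ((cmod (U x))\<^sup>2)) has_integral of_real (integral {a..b} (\<lambda>x. (cmod (U x))\<^sup>2))) {a..b}"
      by (intro has_integral_of_real integrable_integral)
    moreover have "(\<lambda>x. U x * cnj (U x)) = (\<lambda>x. of_real ((cmod (U x))\<^sup>2))"
      by (rule ext) (rule complex_norm_square[symmetric])
    ultimately show ?thesis by (simp only: integral_unique)
  qed
  have "V b * cnj (U b) - U b * cnj (V b) = V a * cnj (U a) - U a * cnj (V a) + (cnj z - z) * integral {a..b} (\<lambda>x. U x * cnj (U x))"
    by (rule wronskian_diff[OF sol is_sol_cnj[OF sol] ab])
  hence "Im (V b * cnj (U b) - U b * cnj (V b)) = Im (V a * cnj (U a) - U a * cnj (V a) + (cnj z - z) * integral {a..b} (\<lambda>x. U x * cnj (U x)))"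
    by simp
  thus ?thesis unfolding e by (simp add: algebra_simps)
qed

lemma is_sol_growth:
  assumes sol: "is_sol z a b V U" and a: "0 \<le> a" and ab: "a \<le> b" and r: "cmod z \<le> r"
  shows "(cmod (V b))\<^sup>2 + (cmod (U b))\<^sup>2 \<le> ((cmod (V a))\<^sup>2 + (cmod (U a))\<^sup>2) * exp (integral {a..b} (growth r))"
    and "(cmod (V a))\<^sup>2 + (cmod (U a))\<^sup>2 \<le> ((cmod (V b))\<^sup>2 + (cmod (U b))\<^sup>2) * exp (integral {a..b} (growth r))"
proof -
  let ?dV = "\<lambda>x. - of_real (s x) * V x + (of_real (q x) - z) * U x"
  let ?dU = "\<lambda>x. V x + of_real (s x) * U x"
  have n: "ac_deriv a b (\<lambda>x. V x \<bullet> V x + U x \<bullet> U x) (\<lambda>x. (V x \<bullet> ?dV x + ?dV x \<bullet> V x) + (U x \<bullet> ?dU x + ?dU x \<bullet> U x))"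
    using sol unfolding is_sol_def by (intro ac_deriv_add ac_deriv_inner) auto
  have b: "\<bar>(V x \<bullet> ?dV x + ?dV x \<bullet> V x) + (U x \<bullet> ?dU x + ?dU x \<bullet> U x)\<bar> \<le> growth r x * (V x \<bullet> V x + U x \<bullet> U x)" for x
  proof -
    define A B where "A = cmod (V x)" and "B = cmod (U x)"
    have AB: "0 \<le> A" "0 \<le> B" by (auto simp: A_def B_def)
    have 1: "cmod (?dV x) \<le> \<bar>s x\<bar> * A + (\<bar>q x\<bar> + r) * B"
    proof -
      have "cmod (?dV x) \<le> \<bar>s x\<bar> * A + cmod (of_real (q x) - z) * B"
        by (rule order_trans[OF norm_triangle_ineq]) (simp add: norm_mult A_def B_def)
      also have "cmod (of_real (q x) - z) \<le> \<bar>q x\<bar> + r"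
        by (rule order_trans[OF norm_triangle_ineq4]) (use r in simp)
      finally show ?thesis using AB by (simp add: mult_right_mono)
    qed
    have 2: "cmod (?dU x) \<le> A + \<bar>s x\<bar> * B"
      by (rule order_trans[OF norm_triangle_ineq]) (simp add: norm_mult A_def B_def)
    have "\<bar>(V x \<bullet> ?dV x + ?dV x \<bullet> V x) + (U x \<bullet> ?dU x + ?dU x \<bullet> U x)\<bar> \<le> 2 * (\<bar>V x \<bullet> ?dV x\<bar> + \<bar>U x \<bullet> ?dU x\<bar>)"
      by (simp add: inner_commute)
    also have "\<dots> \<le> 2 * (A * (\<bar>s x\<bar> * A + (\<bar>q x\<bar> + r) * B) + B * (A + \<bar>s x\<bar> * B))"
    proof -
      have "\<bar>V x \<bullet> ?dV x\<bar> \<le> A * cmod (?dV x)" unfolding A_def by (rule Cauchy_Schwarz_ineq2)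
      also have "\<dots> \<le> A * (\<bar>s x\<bar> * A + (\<bar>q x\<bar> + r) * B)" using 1 AB by (intro mult_left_mono) auto
      finally have 3: "\<bar>V x \<bullet> ?dV x\<bar> \<le> A * (\<bar>s x\<bar> * A + (\<bar>q x\<bar> + r) * B)" .
      have "\<bar>U x \<bullet> ?dU x\<bar> \<le> B * cmod (?dU x)" unfolding B_def by (rule Cauchy_Schwarz_ineq2)
      also have "\<dots> \<le> B * (A + \<bar>s x\<bar> * B)" using 2 AB by (intro mult_left_mono) auto
      finally show ?thesis using 3 by (intro mult_left_mono add_mono) auto
    qed
    also have "\<dots> = 2 * \<bar>s x\<bar> * (A\<^sup>2 + B\<^sup>2) + (\<bar>q x\<bar> + r + 1) * (2 * A * B)"
      by (simp add: algebra_simps power2_eq_square)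
    also have "\<dots> \<le> 2 * \<bar>s x\<bar> * (A\<^sup>2 + B\<^sup>2) + (\<bar>q x\<bar> + r + 1) * (A\<^sup>2 + B\<^sup>2)"
    proof -
      have "0 \<le> r" using r norm_ge_zero order_trans by blast
      thus ?thesis using sum_squares_bound[of A B] by (intro add_left_mono mult_left_mono) auto
    qed
    also have "\<dots> = growth r x * (V x \<bullet> V x + U x \<bullet> U x)"
      by (simp add: growth_def A_def B_def power2_norm_eq_inner algebra_simps)
    finally show ?thesis .
  qed
  from gronwall[OF n growth_int[OF a] ab b]
  show "(cmod (V b))\<^sup>2 + (cmod (U b))\<^sup>2 \<le> ((cmod (V a))\<^sup>2 + (cmod (U a))\<^sup>2) * exp (integral {a..b} (growth r))"
    "(cmod (V a))\<^sup>2 + (cmod (U a))\<^sup>2 \<le> ((cmod (V b))\<^sup>2 + (cmod (U b))\<^sup>2) * exp (integral {a..b} (growth r))"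
    by (auto simp: power2_norm_eq_inner)
qed

text \<open>The difference is a solution vanishing at \<open>c\<close>; the growth bounds in both
  directions keep it 0 on the whole interval.\<close>

lemma is_sol_unique:
  assumes "is_sol z a b V U" "is_sol z a b v u" and c: "0 \<le> a" "c \<in> {a..b}" and "V c = v c" "U c = u c"
    and x: "x \<in> {a..b}"
  shows "V x = v x \<and> U x = u x"
proof -
  have d: "is_sol z a b (\<lambda>x. 1 * V x + (-1) * v x) (\<lambda>x. 1 * U x + (-1) * u x)"
    by (rule is_sol_combine) fact+
  have "(cmod (V x - v x))\<^sup>2 + (cmod (U x - u x))\<^sup>2 \<le> 0"
  proof (cases "c \<le> x")
    case True
    from is_sol_growth(1)[OF is_sol_subinterval[OF d, of c x], of "cmod z"] show ?thesis using True c x assms by simp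
  next
    case False
    from is_sol_growth(2)[OF is_sol_subinterval[OF d, of x c], of "cmod z"] show ?thesis using False c x assms by simp
  qed
  thus ?thesis by (smt (verit) norm_eq_zero right_minus_eq zero_le_power2 power_eq_0_iff)
qed

lemma is_sol_exists: "\<exists>V U. V 0 = v0 \<and> U 0 = u0 \<and> (\<forall>b. is_sol z 0 b V U)"
proof -
  define A :: "real \<Rightarrow> complex \<times> complex \<Rightarrow> complex \<times> complex" where
    \<comment> \<open>Written as \<open>s\<close> and \<open>q\<close> times linear functions of
      \<open>p\<close>, plus a constant linear map: in this form absolute integrability along a
      continuous curve is immediate.\<close>
    "A t p = s t *\<^sub>R (- fst p, snd p) + (q t *\<^sub>R (snd p, 0) + (- z * snd p, fst p))" for t p
  have A: "A t p = (- of_real (s t) * fst p + (of_real (q t) - z) * snd p, fst p + of_real (s t) * snd p)" for t p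
    by (simp add: A_def scaleR_conv_of_real algebra_simps)
  have "\<exists>Z. Z 0 = (v0, u0) \<and> (\<forall>b. ac_deriv 0 b Z (\<lambda>t. A t (Z t)))"
  proof (rule linear_ode_solution[where \<alpha>="\<lambda>x. growth (cmod z) x"])
    show "linear (A t)" for t
      by (rule linearI) (auto simp: A_def algebra_simps)
    show "norm (A t p) \<le> growth (cmod z) t * norm p" for t p
    proof -
      have f: "norm (fst p) \<le> norm p" "norm (snd p) \<le> norm p" by (metis norm_fst_le norm_snd_le prod.collapse)+
      have m: "norm (- fst p, snd p) = norm p" by (simp add: norm_Pair norm_prod_def)
      have "norm (A t p) \<le> \<bar>s t\<bar> * norm p + (\<bar>q t\<bar> * norm p + (cmod z * norm p + norm p))"
        unfolding A_def
      proof (intro norm_triangle_le add_mono)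
        show "norm (s t *\<^sub>R (- fst p, snd p)) \<le> \<bar>s t\<bar> * norm p" by (simp only: norm_scaleR m order_refl)
        have "norm (snd p, 0::complex) = norm (snd p)" by (simp add: norm_Pair)
        thus "norm (q t *\<^sub>R (snd p, 0::complex)) \<le> \<bar>q t\<bar> * norm p"
          unfolding norm_scaleR using f(2) by (simp add: mult_left_mono)
        show "norm (- z * snd p, fst p) \<le> cmod z * norm p + norm p"
          by (rule order_trans[OF norm_Pair_le]) (use f in \<open>simp add: norm_mult add_mono mult_left_mono\<close>)
      qed
      also have "\<dots> \<le> growth (cmod z) t * norm p" unfolding growth_def
        by (simp add: algebra_simps)
      finally show ?thesis .
    qed
    show "0 \<le> growth (cmod z) t" for t by (simp add: growth_def)
    show "growth (cmod z) absolutely_integrable_on {0..b}" for b by (rule growth_int) simp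
    fix b :: real and Y :: "real \<Rightarrow> complex \<times> complex" assume Y: "continuous_on {0..b} Y"
    show "(\<lambda>t. A t (Y t)) absolutely_integrable_on {0..b}"
      unfolding A_def
      by (intro set_integral_add absolutely_integrable_scaleR_continuous s_int q_int continuous_intros Y
          absolutely_integrable_continuous_real)
  qed
  then obtain Z where Z: "Z 0 = (v0, u0)" "\<And>b. ac_deriv 0 b Z (\<lambda>t. A t (Z t))" by blast
  have "is_sol z 0 b (\<lambda>x. fst (Z x)) (\<lambda>x. snd (Z x))" for b
    using ac_deriv_linear[OF bounded_linear_fst Z(2)[of b]] ac_deriv_linear[OF bounded_linear_snd Z(2)[of b]]
    unfolding is_sol_def A by simp
  thus ?thesis using Z(1) by (intro exI[of _ "\<lambda>x. fst (Z x)"] exI[of _ "\<lambda>x. snd (Z x)"]) auto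
qed

definition sol :: "complex \<Rightarrow> complex \<Rightarrow> complex \<Rightarrow> (real \<Rightarrow> complex) \<times> (real \<Rightarrow> complex)" where
  "sol z v0 u0 = (SOME p. fst p 0 = v0 \<and> snd p 0 = u0 \<and> (\<forall>b. is_sol z 0 b (fst p) (snd p)))"

definition solV :: "complex \<Rightarrow> complex \<Rightarrow> complex \<Rightarrow> real \<Rightarrow> complex" where "solV z v0 u0 = fst (sol z v0 u0)"
definition solU :: "complex \<Rightarrow> complex \<Rightarrow> complex \<Rightarrow> real \<Rightarrow> complex" where "solU z v0 u0 = snd (sol z v0 u0)"

lemma sol_props: "solV z v0 u0 0 = v0" "solU z v0 u0 0 = u0" "is_sol z 0 b (solV z v0 u0) (solU z v0 u0)"
proof -
  have "\<exists>p. fst p 0 = v0 \<and> snd p 0 = u0 \<and> (\<forall>b. is_sol z 0 b (fst p) (snd p))"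
    using is_sol_exists[of v0 u0 z] by auto
  from someI_ex[OF this] show "solV z v0 u0 0 = v0" "solU z v0 u0 0 = u0" "is_sol z 0 b (solV z v0 u0) (solU z v0 u0)"
    unfolding solV_def solU_def sol_def by auto
qed


section \<open>Holomorphic dependence of solutions on the spectral parameter\<close>

lemma sol_cont:
  assumes "0 \<le> a"
  shows "continuous_on {a..b} (solV z v0 u0)" "continuous_on {a..b} (solU z v0 u0)"
  by (rule is_sol_continuous[OF is_sol_subinterval[OF sol_props(3) assms order_refl]])+

lemma sol_bound:
  assumes "0 \<le> x" "x \<le> b" "cmod z \<le> r"
  shows "cmod (solU z v0 u0 x) \<le> sqrt (((cmod v0)\<^sup>2 + (cmod u0)\<^sup>2) * exp (integral {0..b} (growth r)))"
proof (rule real_le_rsqrt)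
  have i: "growth r integrable_on {0..b}" for b
    by (rule set_lebesgue_integral_eq_integral(1)[OF growth_int]) simp
  have r: "0 \<le> r" using assms(3) norm_ge_zero order_trans by blast
  have "(cmod (solU z v0 u0 x))\<^sup>2 \<le> (cmod (solV z v0 u0 x))\<^sup>2 + (cmod (solU z v0 u0 x))\<^sup>2" by simp
  also have "\<dots> \<le> ((cmod v0)\<^sup>2 + (cmod u0)\<^sup>2) * exp (integral {0..x} (growth r))"
    using is_sol_growth(1)[OF sol_props(3)[of z x v0 u0] order_refl assms(1,3)] by (simp add: sol_props(1,2))
  also have "\<dots> \<le> ((cmod v0)\<^sup>2 + (cmod u0)\<^sup>2) * exp (integral {0..b} (growth r))"
  proof (intro mult_left_mono)
    have "integral {0..x} (growth r) \<le> integral {0..b} (growth r)"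
      by (rule integral_subset_le) (use assms i r in \<open>auto simp: growth_def\<close>)
    thus "exp (integral {0..x} (growth r)) \<le> exp (integral {0..b} (growth r))" by simp
  qed auto
  finally show "(cmod (solU z v0 u0 x))\<^sup>2 \<le> ((cmod v0)\<^sup>2 + (cmod u0)\<^sup>2) * exp (integral {0..b} (growth r))" .
qed

text \<open>Cramer's rule: a solution for \<open>z\<close> is determined by its Wronskians with two
  basis solutions for \<open>w\<close>, whose mutual Wronskian is 1. By Lagrange's identity each of
  these Wronskians moves by w - z times an overlap integral, which isolates the factor w -
  z.\<close>

lemma variation_of_parameters:
  fixes z w v0 u0 :: complex and x :: real
  assumes x: "0 \<le> x"
  defines "Ic \<equiv> integral {0..x} (\<lambda>t. solU z v0 u0 t * solU w 1 0 t)"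
    and "Is \<equiv> integral {0..x} (\<lambda>t. solU z v0 u0 t * solU w 0 1 t)"
  shows "solV z v0 u0 x = solV w v0 u0 x + (w - z) * (solV w 1 0 x * Is - solV w 0 1 x * Ic)"
    and "solU z v0 u0 x = solU w v0 u0 x + (w - z) * (solU w 1 0 x * Is - solU w 0 1 x * Ic)"
proof -
  let ?Vc = "solV w 1 0" and ?Uc = "solU w 1 0" and ?Vs = "solV w 0 1" and ?Us = "solU w 0 1"
  have c: "is_sol w 0 x ?Vc ?Uc" and s: "is_sol w 0 x ?Vs ?Us" by (rule sol_props)+
  have W: "?Vc x * ?Us x - ?Uc x * ?Vs x = 1"
    using wronskian_const[OF c s x] by (simp add: sol_props(1,2))
  have Wc: "solV z v0 u0 x * ?Uc x - solU z v0 u0 x * ?Vc x = - u0 + (w - z) * Ic"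
    using wronskian_diff[OF sol_props(3)[of z x v0 u0] c x] by (simp add: sol_props(1,2) Ic_def)
  have Ws: "solV z v0 u0 x * ?Us x - solU z v0 u0 x * ?Vs x = v0 + (w - z) * Is"
    using wronskian_diff[OF sol_props(3)[of z x v0 u0] s x] by (simp add: sol_props(1,2) Is_def)
  have "solV z v0 u0 x * (?Vc x * ?Us x - ?Uc x * ?Vs x) =
      ?Vc x * (solV z v0 u0 x * ?Us x - solU z v0 u0 x * ?Vs x) - ?Vs x * (solV z v0 u0 x * ?Uc x - solU z v0 u0 x * ?Vc x)"
    by (simp add: algebra_simps)
  hence "solV z v0 u0 x = ?Vc x * (v0 + (w - z) * Is) - ?Vs x * (- u0 + (w - z) * Ic)"
    by (simp only: W Wc Ws mult_1_right)
  moreover have "solU z v0 u0 x * (?Vc x * ?Us x - ?Uc x * ?Vs x) =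
      ?Uc x * (solV z v0 u0 x * ?Us x - solU z v0 u0 x * ?Vs x) - ?Us x * (solV z v0 u0 x * ?Uc x - solU z v0 u0 x * ?Vc x)"
    by (simp add: algebra_simps)
  hence "solU z v0 u0 x = ?Uc x * (v0 + (w - z) * Is) - ?Us x * (- u0 + (w - z) * Ic)"
    by (simp only: W Wc Ws mult_1_right)
  moreover have "solV w v0 u0 x = ?Vc x * v0 + ?Vs x * u0 \<and> solU w v0 u0 x = ?Uc x * v0 + ?Us x * u0"
    using is_sol_unique[OF sol_props(3)[of w x v0 u0] is_sol_combine[OF c s, of v0 u0], of 0 x] x
    by (simp add: sol_props(1,2) mult.commute)
  ultimately show "solV z v0 u0 x = solV w v0 u0 x + (w - z) * (?Vc x * Is - ?Vs x * Ic)"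
    "solU z v0 u0 x = solU w v0 u0 x + (w - z) * (?Uc x * Is - ?Us x * Ic)"
    by (simp_all add: algebra_simps)
qed

lemma overlap_bound:
  assumes x: "0 \<le> x"
  shows "\<exists>C. \<forall>z t. t \<in> {0..x} \<longrightarrow> cmod z \<le> r \<longrightarrow>
    cmod (integral {0..t} (\<lambda>t. solU z v0 u0 t * solU w v1 u1 t)) \<le> C"
proof -
  define B1 where "B1 = sqrt (((cmod v0)\<^sup>2 + (cmod u0)\<^sup>2) * exp (integral {0..x} (growth r)))"
  define B2 where "B2 = sqrt (((cmod v1)\<^sup>2 + (cmod u1)\<^sup>2) * exp (integral {0..x} (growth (cmod w))))"
  have B: "0 \<le> B1" "0 \<le> B2" by (auto simp: B1_def B2_def)
  have "cmod (integral {0..t} (\<lambda>t. solU z v0 u0 t * solU w v1 u1 t)) \<le> B1 * B2 * x"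
    if t: "t \<in> {0..x}" and z: "cmod z \<le> r" for z t
  proof -
    have "cmod (integral {0..t} (\<lambda>t. solU z v0 u0 t * solU w v1 u1 t)) \<le> B1 * B2 * (t - 0)"
    proof (rule integral_bound)
      fix y assume y: "y \<in> {0..t}"
      have "cmod (solU z v0 u0 y) \<le> B1" "cmod (solU w v1 u1 y) \<le> B2"
        unfolding B1_def B2_def using y t z by (auto intro!: sol_bound)
      thus "cmod (solU z v0 u0 y * solU w v1 u1 y) \<le> B1 * B2" using B by (simp add: norm_mult mult_mono)
    qed (use t in \<open>auto intro!: continuous_intros sol_cont\<close>)
    also have "\<dots> \<le> B1 * B2 * x" using B t by (intro mult_left_mono) auto
    finally show ?thesis .
  qed
  thus ?thesis by blast
qed

text \<open>A first-order bound read off from variation of parameters. Being uniform in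
  \<open>t\<close>, it allows \<open>z\<close> to tend to \<open>w\<close> inside the overlap
  integrals.\<close>

lemma solU_lipschitz:
  assumes x: "0 \<le> x"
  shows "\<exists>C. \<forall>z t. t \<in> {0..x} \<longrightarrow> cmod (z - w) \<le> 1 \<longrightarrow> cmod (solU z v0 u0 t - solU w v0 u0 t) \<le> C * cmod (z - w)"
proof -
  obtain C1 where C1: "\<And>z t. t \<in> {0..x} \<Longrightarrow> cmod z \<le> cmod w + 1 \<Longrightarrow>
    cmod (integral {0..t} (\<lambda>t. solU z v0 u0 t * solU w 1 0 t)) \<le> C1"
    using overlap_bound[OF x, of "cmod w + 1" v0 u0 w 1 0] by blast
  obtain C2 where C2: "\<And>z t. t \<in> {0..x} \<Longrightarrow> cmod z \<le> cmod w + 1 \<Longrightarrow>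
    cmod (integral {0..t} (\<lambda>t. solU z v0 u0 t * solU w 0 1 t)) \<le> C2"
    using overlap_bound[OF x, of "cmod w + 1" v0 u0 w 0 1] by blast
  define B where "B = sqrt (((cmod 1)\<^sup>2 + (cmod 0)\<^sup>2) * exp (integral {0..x} (growth (cmod w))))"
  have B0: "0 \<le> B" by (simp add: B_def)
  have "cmod (solU z v0 u0 t - solU w v0 u0 t) \<le> (B * C2 + B * C1) * cmod (z - w)"
    if t: "t \<in> {0..x}" and z: "cmod (z - w) \<le> 1" for z t
  proof -
    have z': "cmod z \<le> cmod w + 1" using z norm_triangle_ineq2[of z w] by linarith
    have t0: "0 \<le> t" using t by simp
    have b: "cmod (solU w 1 0 t) \<le> B" "cmod (solU w 0 1 t) \<le> B"
      using sol_bound[of t x w "cmod w" 1 0] sol_bound[of t x w "cmod w" 0 1] t by (auto simp: B_def)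
    let ?Ic = "integral {0..t} (\<lambda>t. solU z v0 u0 t * solU w 1 0 t)"
    let ?Is = "integral {0..t} (\<lambda>t. solU z v0 u0 t * solU w 0 1 t)"
    have "solU z v0 u0 t - solU w v0 u0 t = (w - z) * (solU w 1 0 t * ?Is - solU w 0 1 t * ?Ic)"
      using variation_of_parameters(2)[OF t0, of z v0 u0 w] by simp
    also have "cmod \<dots> \<le> cmod (w - z) * (B * C2 + B * C1)"
      unfolding norm_mult
    proof (intro mult_left_mono norm_triangle_le_diff add_mono)
      show "cmod (solU w 1 0 t * ?Is) \<le> B * C2" "cmod (solU w 0 1 t * ?Ic) \<le> B * C1"
        unfolding norm_mult using b C1[OF t z'] C2[OF t z'] B0 by (auto intro!: mult_mono)
    qed simp
    finally show ?thesis by (simp add: norm_minus_commute mult.commute)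
  qed
  thus ?thesis by blast
qed

lemma overlap_tendsto:
  assumes x: "0 \<le> x"
  shows "((\<lambda>z. integral {0..x} (\<lambda>t. solU z v0 u0 t * solU w v1 u1 t)) \<longlongrightarrow>
    integral {0..x} (\<lambda>t. solU w v0 u0 t * solU w v1 u1 t)) (at w)"
proof -
  obtain C where C: "\<And>z t. t \<in> {0..x} \<Longrightarrow> cmod (z - w) \<le> 1 \<Longrightarrow> cmod (solU z v0 u0 t - solU w v0 u0 t) \<le> C * cmod (z - w)"
    using solU_lipschitz[OF x, of w v0 u0] by blast
  define B where "B = sqrt (((cmod v1)\<^sup>2 + (cmod u1)\<^sup>2) * exp (integral {0..x} (growth (cmod w))))"
  have B0: "0 \<le> B" by (simp add: B_def)
  show ?thesis
  proof -
    have ev: "\<forall>\<^sub>F z in at w. cmod (z - w) \<le> 1"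
      unfolding eventually_at by (intro exI[of _ 1]) (auto simp: dist_norm)
    have "((\<lambda>z. integral {0..x} (\<lambda>t. solU z v0 u0 t * solU w v1 u1 t) - integral {0..x} (\<lambda>t. solU w v0 u0 t * solU w v1 u1 t)) \<longlongrightarrow> 0) (at w)"
    proof (rule Lim_null_comparison)
      show "\<forall>\<^sub>F z in at w. norm (integral {0..x} (\<lambda>t. solU z v0 u0 t * solU w v1 u1 t) - integral {0..x} (\<lambda>t. solU w v0 u0 t * solU w v1 u1 t))
          \<le> (C * cmod (z - w)) * B * (x - 0)"
        using ev
      proof eventually_elim
        case (elim z)
        have "integral {0..x} (\<lambda>t. solU z v0 u0 t * solU w v1 u1 t) - integral {0..x} (\<lambda>t. solU w v0 u0 t * solU w v1 u1 t)
           = integral {0..x} (\<lambda>t. (solU z v0 u0 t - solU w v0 u0 t) * solU w v1 u1 t)"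
          unfolding left_diff_distrib
          by (rule integral_diff[symmetric]) (auto intro!: integrable_continuous_interval continuous_intros sol_cont)
        also have "norm \<dots> \<le> (C * cmod (z - w)) * B * (x - 0)"
        proof (rule integral_bound)
          fix t assume t: "t \<in> {0..x}"
          have "cmod (solU w v1 u1 t) \<le> B" using sol_bound[of t x w "cmod w" v1 u1] t by (auto simp: B_def)
          moreover have "cmod (solU z v0 u0 t - solU w v0 u0 t) \<le> C * cmod (z - w)" by (rule C[OF t elim])
          ultimately show "norm ((solU z v0 u0 t - solU w v0 u0 t) * solU w v1 u1 t) \<le> C * cmod (z - w) * B"
            unfolding norm_mult by (intro mult_mono) (auto intro: order_trans[OF norm_ge_zero])
        qed (use x in \<open>auto intro!: continuous_intros sol_cont\<close>)
        finally show ?case .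
      qed
      have "((\<lambda>z. (C * cmod (z - w)) * B * (x - 0)) \<longlongrightarrow> (C * cmod (w - w)) * B * (x - 0)) (at w)"
        by (intro tendsto_intros)
      thus "((\<lambda>z. (C * cmod (z - w)) * B * (x - 0)) \<longlongrightarrow> 0) (at w)" by simp
    qed
    thus ?thesis by (rule LIM_zero_cancel)
  qed
qed

text \<open>Variation of parameters gives the difference quotient in closed form, so the complex
  derivative is a limit of overlap integrals.\<close>

lemma sol_entire:
  assumes x: "0 \<le> x"
  shows "(\<lambda>z. solV z v0 u0 x) holomorphic_on A" "(\<lambda>z. solU z v0 u0 x) holomorphic_on A"
proof -
  let ?I = "\<lambda>z w v1 u1. integral {0..x} (\<lambda>t. solU z v0 u0 t * solU w v1 u1 t)"
  \<comment> \<open>One computation for both components: \<open>a\<close> and \<open>b\<close> stand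
    for the values at \<open>x\<close> of the two basis solutions.\<close>
  have q: "((\<lambda>z. F z) has_field_derivative - (a * ?I w w 0 1 - b * ?I w w 1 0)) (at w)"
    if F: "\<And>z. F z = F w + (w - z) * (a * ?I z w 0 1 - b * ?I z w 1 0)" for F a b w
    unfolding has_field_derivative_iff
  proof (rule Lim_transform_eventually)
    show "((\<lambda>z. - (a * ?I z w 0 1 - b * ?I z w 1 0)) \<longlongrightarrow> - (a * ?I w w 0 1 - b * ?I w w 1 0)) (at w)"
      by (intro tendsto_intros overlap_tendsto x)
    show "\<forall>\<^sub>F z in at w. - (a * ?I z w 0 1 - b * ?I z w 1 0) = (F z - F w) / (z - w)"
      unfolding eventually_at
    proof (intro exI[of _ 1] conjI ballI impI)
      fix z assume "z \<noteq> w \<and> dist z w < 1"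
      moreover have "F z - F w = (z - w) * - (a * ?I z w 0 1 - b * ?I z w 1 0)" 
        using F[of z] by (simp add: algebra_simps)
      ultimately show "- (a * ?I z w 0 1 - b * ?I z w 1 0) = (F z - F w) / (z - w)" by simp
    qed simp
  qed
  have "(\<lambda>z. solV z v0 u0 x) field_differentiable at w" for w
    using q[OF variation_of_parameters(1)[OF x, of _ v0 u0 w]] field_differentiable_def by blast
  thus "(\<lambda>z. solV z v0 u0 x) holomorphic_on A"
    unfolding holomorphic_on_def by (blast intro: field_differentiable_at_within)
  have "(\<lambda>z. solU z v0 u0 x) field_differentiable at w" for w
    using q[OF variation_of_parameters(2)[OF x, of _ v0 u0 w]] field_differentiable_def by blast
  thus "(\<lambda>z. solU z v0 u0 x) holomorphic_on A"
    unfolding holomorphic_on_def by (blast intro: field_differentiable_at_within)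
qed

end

section \<open>Weyl functions of the truncated problems\<close>

context sturm
begin

abbreviation phV :: "real \<Rightarrow> complex \<Rightarrow> real \<Rightarrow> complex" where "phV \<alpha> z \<equiv> solV z (of_real (cos \<alpha>)) (- of_real (sin \<alpha>))"
abbreviation phU :: "real \<Rightarrow> complex \<Rightarrow> real \<Rightarrow> complex" where "phU \<alpha> z \<equiv> solU z (of_real (cos \<alpha>)) (- of_real (sin \<alpha>))"
abbreviation thV :: "real \<Rightarrow> complex \<Rightarrow> real \<Rightarrow> complex" where "thV \<alpha> z \<equiv> solV z (of_real (sin \<alpha>)) (of_real (cos \<alpha>))"
abbreviation thU :: "real \<Rightarrow> complex \<Rightarrow> real \<Rightarrow> complex" where "thU \<alpha> z \<equiv> solU z (of_real (sin \<alpha>)) (of_real (cos \<alpha>))"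

text \<open>The solution \<open>\<psi> = \<theta> + m \<phi>\<close>, where \<open>\<phi>\<close> satisfies the boundary condition at \<open>0\<close> and \<open>\<theta>\<close> the
  orthogonal one.\<close>

definition psV :: "real \<Rightarrow> complex \<Rightarrow> complex \<Rightarrow> real \<Rightarrow> complex" where "psV \<alpha> z m x = 1 * thV \<alpha> z x + m * phV \<alpha> z x"
definition psU :: "real \<Rightarrow> complex \<Rightarrow> complex \<Rightarrow> real \<Rightarrow> complex" where "psU \<alpha> z m x = 1 * thU \<alpha> z x + m * phU \<alpha> z x"

text \<open>The value of \<open>m\<close> for which \<open>\<psi>\<close> satisfies \<open>V L = \<i> * U L\<close>.\<close>

definition mL :: "real \<Rightarrow> real \<Rightarrow> complex \<Rightarrow> complex" where
  "mL \<alpha> L z = - (thV \<alpha> z L - \<i> * thU \<alpha> z L) / (phV \<alpha> z L - \<i> * phU \<alpha> z L)"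

lemma ps_sol: "is_sol z 0 b (psV \<alpha> z m) (psU \<alpha> z m)"
  unfolding psV_def psU_def by (rule is_sol_combine[OF sol_props(3) sol_props(3)])

lemma ps_0: "psV \<alpha> z m 0 = of_real (sin \<alpha>) + m * of_real (cos \<alpha>)" "psU \<alpha> z m 0 = of_real (cos \<alpha>) - m * of_real (sin \<alpha>)"
  by (simp_all add: psV_def psU_def sol_props(1,2))

lemma cs_sq: "complex_of_real (cos \<alpha>) * of_real (cos \<alpha>) + of_real (sin \<alpha>) * of_real (sin \<alpha>) = 1"
  by (metis of_real_1 of_real_add of_real_mult power2_eq_square sin_cos_squared_add2)

lemma th_ph_wronskian:
  assumes "0 \<le> x" shows "thV \<alpha> z x * phU \<alpha> z x - thU \<alpha> z x * phV \<alpha> z x = -1"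
proof -
  have "thV \<alpha> z x * phU \<alpha> z x - thU \<alpha> z x * phV \<alpha> z x =
      - (of_real (cos \<alpha>) * of_real (cos \<alpha>) + of_real (sin \<alpha>) * of_real (sin \<alpha>))"
    using wronskian_const[OF sol_props(3) sol_props(3) assms, of z "of_real (sin \<alpha>)" "of_real (cos \<alpha>)" "of_real (cos \<alpha>)" "- of_real (sin \<alpha>)"]
    by (simp add: sol_props(1,2))
  thus ?thesis unfolding cs_sq .
qed

lemma ps_ph_wronskian:
  assumes "0 \<le> x" shows "psV \<alpha> z m x * phU \<alpha> z x - psU \<alpha> z m x * phV \<alpha> z x = -1"
  using th_ph_wronskian[OF assms, of z \<alpha>] by (simp add: psV_def psU_def algebra_simps)

lemma ph_green:
  assumes "0 \<le> x"
  shows "Im (phV \<alpha> z x * cnj (phU \<alpha> z x)) = - Im z * integral {0..x} (\<lambda>x. (cmod (phU \<alpha> z x))\<^sup>2)"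
  using green[OF sol_props(3)[of z x "of_real (cos \<alpha>)" "- of_real (sin \<alpha>)"] assms] by (simp add: sol_props(1,2))

text \<open>The data at 0 are those of the pair (m, 1) rotated by \<alpha>. A real rotation
  preserves Im (V cnj U), so the boundary term at 0 is Im m for every \<alpha>.\<close>

lemma ps_green:
  assumes "0 \<le> x"
  shows "Im (psV \<alpha> z m x * cnj (psU \<alpha> z m x)) = Im m - Im z * integral {0..x} (\<lambda>x. (cmod (psU \<alpha> z m x))\<^sup>2)"
proof -
  have "Im (psV \<alpha> z m 0 * cnj (psU \<alpha> z m 0)) = Im m * (cos \<alpha> * cos \<alpha>) + Im m * (sin \<alpha> * sin \<alpha>)"
    unfolding ps_0 by (simp add: algebra_simps)
  also have "\<dots> = Im m" by (metis distrib_left mult_1_right power2_eq_square sin_cos_squared_add2)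
  finally show ?thesis using green[OF ps_sol[of z x \<alpha> m] assms] by simp
qed

lemma sq_integral_nonneg:
  "0 \<le> integral S (\<lambda>x. (cmod (f x))\<^sup>2)"
  by (cases "(\<lambda>x. (cmod (f x))\<^sup>2) integrable_on S") (auto intro: integral_nonneg simp: not_integrable_integral)

lemma Im_i_mult_cnj: "Im (\<i> * w * cnj w) = (cmod w)\<^sup>2"
  unfolding cmod_power2 by (simp add: power2_eq_square)

text \<open>The condition V = \<i> U makes Im (V cnj U) = |U|^2 nonnegative, while Green's identity
  makes it nonpositive for Im z >= 0. Both components would vanish at \<open>L\<close>, against the
  Wronskian. Real \<open>z\<close> are covered as well, which a real boundary condition could not
  achieve.\<close>

lemma ph_boundary_nonzero:
  assumes "0 \<le> Im z" "0 \<le> L" shows "phV \<alpha> z L - \<i> * phU \<alpha> z L \<noteq> 0"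
proof
  assume "phV \<alpha> z L - \<i> * phU \<alpha> z L = 0"
  hence e: "phV \<alpha> z L = \<i> * phU \<alpha> z L" by simp
  have "Im (phV \<alpha> z L * cnj (phU \<alpha> z L)) = (cmod (phU \<alpha> z L))\<^sup>2"
    unfolding e by (rule Im_i_mult_cnj)
  moreover have "Im (phV \<alpha> z L * cnj (phU \<alpha> z L)) \<le> 0"
    unfolding ph_green[OF assms(2)] using assms(1) sq_integral_nonneg[of "{0..L}" "phU \<alpha> z"] by (simp add: mult_nonneg_nonneg)
  ultimately have "(cmod (phU \<alpha> z L))\<^sup>2 \<le> 0" by simp
  hence "phU \<alpha> z L = 0" by simp
  thus False using th_ph_wronskian[OF assms(2), of z \<alpha>] e by simp
qed

lemma ps_mL_boundary:
  assumes "0 \<le> Im z" "0 \<le> L"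
  shows "psV \<alpha> z (mL \<alpha> L z) L = \<i> * psU \<alpha> z (mL \<alpha> L z) L"
proof -
  define D where "D = phV \<alpha> z L - \<i> * phU \<alpha> z L"
  have "D \<noteq> 0" using ph_boundary_nonzero[OF assms] by (simp add: D_def)
  hence "mL \<alpha> L z * D = - (thV \<alpha> z L - \<i> * thU \<alpha> z L)" by (simp add: mL_def D_def)
  thus ?thesis unfolding psV_def psU_def D_def by (simp add: algebra_simps)
qed

lemma Im_mL:
  assumes "0 \<le> Im z" "0 \<le> L"
  shows "Im (mL \<alpha> L z) = (cmod (psU \<alpha> z (mL \<alpha> L z) L))\<^sup>2 + Im z * integral {0..L} (\<lambda>x. (cmod (psU \<alpha> z (mL \<alpha> L z) x))\<^sup>2)"
proof -
  have "Im (psV \<alpha> z (mL \<alpha> L z) L * cnj (psU \<alpha> z (mL \<alpha> L z) L)) = (cmod (psU \<alpha> z (mL \<alpha> L z) L))\<^sup>2"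
    unfolding ps_mL_boundary[OF assms] by (rule Im_i_mult_cnj)
  thus ?thesis using ps_green[OF assms(2), of \<alpha> z "mL \<alpha> L z"] by simp
qed

text \<open>The Wronskian of psi and phi at \<open>L\<close> with the boundary condition inserted;
  it expresses the value of psi at \<open>L\<close> through phi alone.\<close>

lemma psU_mL:
  assumes "0 \<le> Im z" "0 \<le> L"
  shows "psU \<alpha> z (mL \<alpha> L z) L * (phV \<alpha> z L - \<i> * phU \<alpha> z L) = 1"
  using ps_ph_wronskian[OF assms(2), of \<alpha> z "mL \<alpha> L z"] unfolding ps_mL_boundary[OF assms]
  by (simp add: algebra_simps)

lemma Im_mL_pos:
  assumes "0 \<le> Im z" "0 \<le> L" shows "0 < Im (mL \<alpha> L z)"
proof -
  have "psU \<alpha> z (mL \<alpha> L z) L \<noteq> 0" using psU_mL[OF assms, of \<alpha>] by auto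
  moreover have "0 \<le> Im z * integral {0..L} (\<lambda>x. (cmod (psU \<alpha> z (mL \<alpha> L z) x))\<^sup>2)"
    using assms sq_integral_nonneg by (intro mult_nonneg_nonneg)
  ultimately show ?thesis unfolding Im_mL[OF assms] by (intro add_pos_nonneg) auto
qed

text \<open>For real spectral parameter Im (c cnj d) = 0, hence |c - \<i> d|^2 = |c|^2 + |d|^2, and
  Im of \<open>mL\<close> is the reciprocal of this. As a d - b c = -1, Cauchy-Schwarz bounds the
  reciprocal by |a|^2 + |b|^2.\<close>

lemma Im_mL_real_le:
  assumes L: "0 \<le> L" shows "Im (mL \<alpha> L (of_real E)) \<le> (cmod (thV \<alpha> (of_real E) L))\<^sup>2 + (cmod (thU \<alpha> (of_real E) L))\<^sup>2"
proof -
  let ?z = "complex_of_real E"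
  define a b c d where "a = thV \<alpha> ?z L" and "b = thU \<alpha> ?z L" and "c = phV \<alpha> ?z L" and "d = phU \<alpha> ?z L"
  have W: "a * d - b * c = -1" using th_ph_wronskian[OF L] by (simp add: a_def b_def c_def d_def)
  have I: "Im (c * cnj d) = 0" using ph_green[OF L, of ?z \<alpha>] by (simp add: c_def d_def)
  have D: "(cmod (c - \<i> * d))\<^sup>2 = (cmod c)\<^sup>2 + (cmod d)\<^sup>2"
    using I unfolding cmod_power2 by (simp add: power2_eq_square algebra_simps)
  define u where "u = psU \<alpha> ?z (mL \<alpha> L ?z) L"
  have "u * (c - \<i> * d) = 1" using psU_mL[of ?z L \<alpha>] L by (simp add: u_def c_def d_def)
  hence "(cmod u)\<^sup>2 * (cmod (c - \<i> * d))\<^sup>2 = 1" by (metis norm_mult norm_one power_mult_distrib power_one)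
  hence 1: "(cmod u)\<^sup>2 * ((cmod c)\<^sup>2 + (cmod d)\<^sup>2) = 1" unfolding D .
  have "1 = cmod (a * d - b * c)" using W by simp
  also have "\<dots> \<le> cmod a * cmod d + cmod b * cmod c" using norm_triangle_ineq4[of "a * d" "b * c"] by (simp add: norm_mult)
  finally have "1\<^sup>2 \<le> (cmod a * cmod d + cmod b * cmod c)\<^sup>2" by (intro power_mono) auto
  also have "\<dots> \<le> ((cmod a)\<^sup>2 + (cmod b)\<^sup>2) * ((cmod c)\<^sup>2 + (cmod d)\<^sup>2)"
  proof -
    have "((cmod a)\<^sup>2 + (cmod b)\<^sup>2) * ((cmod c)\<^sup>2 + (cmod d)\<^sup>2) - (cmod a * cmod d + cmod b * cmod c)\<^sup>2 = (cmod a * cmod c - cmod b * cmod d)\<^sup>2"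
      by (simp add: power2_eq_square algebra_simps)
    moreover have "0 \<le> (cmod a * cmod c - cmod b * cmod d)\<^sup>2" by simp
    ultimately show ?thesis by linarith
  qed
  finally have 2: "1 \<le> ((cmod a)\<^sup>2 + (cmod b)\<^sup>2) * ((cmod c)\<^sup>2 + (cmod d)\<^sup>2)" by simp
  have "(cmod u)\<^sup>2 * 1 \<le> (cmod u)\<^sup>2 * (((cmod a)\<^sup>2 + (cmod b)\<^sup>2) * ((cmod c)\<^sup>2 + (cmod d)\<^sup>2))"
    using 2 by (intro mult_left_mono) auto
  also have "\<dots> = ((cmod a)\<^sup>2 + (cmod b)\<^sup>2) * ((cmod u)\<^sup>2 * ((cmod c)\<^sup>2 + (cmod d)\<^sup>2))" by (simp add: mult_ac)
  also have "\<dots> = (cmod a)\<^sup>2 + (cmod b)\<^sup>2" unfolding 1 by simp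
  finally have "(cmod u)\<^sup>2 \<le> (cmod a)\<^sup>2 + (cmod b)\<^sup>2" by simp
  moreover have "Im (mL \<alpha> L ?z) = (cmod u)\<^sup>2" using Im_mL[of ?z L \<alpha>] L by (simp add: u_def)
  ultimately show ?thesis by (simp add: a_def b_def)
qed

lemma mL_holomorphic:
  assumes L: "0 \<le> L"
  shows "\<exists>S. open S \<and> {z. 0 \<le> Im z} \<subseteq> S \<and> mL \<alpha> L holomorphic_on S"
proof -
  define D where "D z = phV \<alpha> z L - \<i> * phU \<alpha> z L" for z
  have D: "D holomorphic_on A" for A unfolding D_def by (intro holomorphic_intros sol_entire L)
  have "open {z. D z \<noteq> 0}"
    using open_Collect_neq[OF holomorphic_on_imp_continuous_on[OF D] continuous_on_const] .
  moreover have "{z. 0 \<le> Im z} \<subseteq> {z. D z \<noteq> 0}" using ph_boundary_nonzero L by (auto simp: D_def)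
  moreover have "mL \<alpha> L holomorphic_on {z. D z \<noteq> 0}"
    unfolding mL_def D_def by (intro holomorphic_intros sol_entire L) auto
  ultimately show ?thesis by blast
qed

section \<open>Boundedness and convergence of the truncated Weyl functions\<close>

lemma sq_integrable:
  fixes f :: "real \<Rightarrow> complex"
  shows "continuous_on {a..b} f \<Longrightarrow> (\<lambda>x. (cmod (f x))\<^sup>2) integrable_on {a..b}"
  by (rule integrable_continuous_interval[OF continuous_on_power[OF continuous_on_norm]])

lemma is_sol_zero:
  assumes sol: "is_sol z 0 b V U" and b: "0 < b" and U: "\<And>x. x \<in> {0..b} \<Longrightarrow> U x = 0"
  shows "V 0 = 0"
proof -
  have Vc: "continuous_on {0..b} V" by (rule is_sol_continuous(1)[OF sol])
  have z: "integral {0..x} V = 0" if x: "x \<in> {0..b}" for x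
  proof -
    have "ac_deriv 0 x U (\<lambda>x. V x + of_real (s x) * U x)"
      using is_sol_subinterval[OF sol, of 0 x] x unfolding is_sol_def by auto
    hence "ac_deriv 0 x U V" by (rule ac_deriv_cong) (use U x in auto)
    from ac_deriv_eq_integral[OF this] show ?thesis using x U by simp
  qed
  have "((\<lambda>x. integral {0..x} V) has_vector_derivative V 0) (at 0 within {0..b})"
    by (rule integral_has_vector_derivative[OF Vc]) (use b in auto)
  moreover have "((\<lambda>x. integral {0..x} V) has_vector_derivative 0) (at 0 within {0..b})"
    by (rule has_vector_derivative_transform[of 0 "{0..b}" _ "\<lambda>_. 0"]) (use b z in auto)
  ultimately show "V 0 = 0"
    using vector_derivative_unique_within_closed_interval[of 0 b 0] b by auto
qed

lemma sol_not_null: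
  assumes sol: "is_sol z 0 1 V U" and nz: "V 0 \<noteq> 0 \<or> U 0 \<noteq> 0"
  shows "0 < integral {0..1} (\<lambda>x. (cmod (U x))\<^sup>2)"
proof (rule ccontr)
  assume "\<not> ?thesis"
  hence "integral {0..1} (\<lambda>x. (cmod (U x))\<^sup>2) = 0" using sq_integral_nonneg[of "{0..1}" U] by simp
  moreover have "continuous_on {0..1} (\<lambda>x. (cmod (U x))\<^sup>2)" by (intro continuous_intros is_sol_continuous(2)[OF sol])
  ultimately have "\<forall>x\<in>{0..1}. (cmod (U x))\<^sup>2 = 0" by (subst (asm) integral_eq_0_iff) auto
  hence U: "\<And>x. x \<in> {0..1} \<Longrightarrow> U x = 0" by simp
  have "V 0 = 0" by (rule is_sol_zero[OF sol zero_less_one U])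
  moreover have "U 0 = 0" using U by simp
  ultimately show False using nz by simp
qed

lemma phU_not_null: "0 < integral {0..1} (\<lambda>x. (cmod (phU \<alpha> z x))\<^sup>2)"
proof (rule sol_not_null[OF sol_props(3)])
  show "phV \<alpha> z 0 \<noteq> 0 \<or> phU \<alpha> z 0 \<noteq> 0" using th_ph_wronskian[of 0 z \<alpha>] by auto
qed

lemma psU_not_null: "0 < integral {0..1} (\<lambda>x. (cmod (psU \<alpha> z m x))\<^sup>2)"
proof (rule sol_not_null[OF ps_sol])
  show "psV \<alpha> z m 0 \<noteq> 0 \<or> psU \<alpha> z m 0 \<noteq> 0" using ps_ph_wronskian[of 0 \<alpha> z m] by auto
qed

text \<open>Im z times the mass of psi on {0..1} is at most Im m <= |m|, whereas this mass grows
  like |m|^2 times the positive mass \<open>P\<close> of phi. So |m| cannot be large, whatever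
  \<open>L\<close> is.\<close>

lemma mL_bounded:
  assumes z: "0 < Im z" shows "\<exists>B. \<forall>L\<ge>1. cmod (mL \<alpha> L z) \<le> B"
proof -
  define P Q where "P = integral {0..1} (\<lambda>x. (cmod (phU \<alpha> z x))\<^sup>2)" and "Q = integral {0..1} (\<lambda>x. (cmod (thU \<alpha> z x))\<^sup>2)"
  have P: "0 < P" unfolding P_def by (rule phU_not_null)
  have Q: "0 \<le> Q" unfolding Q_def by (rule sq_integral_nonneg)
  have "cmod (mL \<alpha> L z) \<le> max 1 (2 / P * (1 / Im z + Q))" if L: "1 \<le> L" for L
  proof (cases "cmod (mL \<alpha> L z) \<le> 1")
    case False
    define m where "m = mL \<alpha> L z"
    have m1: "1 < cmod m" using False by (simp add: m_def)
    have c: "continuous_on {0..b} (psU \<alpha> z m)" for b by (rule is_sol_continuous(2)[OF ps_sol])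
    have tc: "continuous_on {0..1} (thU \<alpha> z)" "continuous_on {0..1} (phU \<alpha> z)" by (auto intro: sol_cont)
    have "(cmod m)\<^sup>2 / 2 * P - Q = integral {0..1} (\<lambda>x. (cmod m)\<^sup>2 / 2 * (cmod (phU \<alpha> z x))\<^sup>2 - (cmod (thU \<alpha> z x))\<^sup>2)"
      unfolding P_def Q_def using sq_integrable[OF tc(1)] sq_integrable[OF tc(2)]
      by (subst integral_diff) (auto intro: integrable_on_mult_right)
    also have "\<dots> \<le> integral {0..1} (\<lambda>x. (cmod (psU \<alpha> z m x))\<^sup>2)"
    proof (rule integral_le)
      show "(\<lambda>x. (cmod m)\<^sup>2 / 2 * (cmod (phU \<alpha> z x))\<^sup>2 - (cmod (thU \<alpha> z x))\<^sup>2) integrable_on {0..1}"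
        by (intro integrable_diff integrable_on_mult_right sq_integrable tc)
      show "(\<lambda>x. (cmod (psU \<alpha> z m x))\<^sup>2) integrable_on {0..1}" by (rule sq_integrable[OF c])
      fix x
      define A B where "A = cmod (thU \<alpha> z x)" and "B = cmod m * cmod (phU \<alpha> z x)"
      have "B - A \<le> cmod (psU \<alpha> z m x)"
        using norm_triangle_ineq2[of "m * phU \<alpha> z x" "- thU \<alpha> z x"]
        by (simp add: psU_def norm_mult A_def B_def add.commute)
      hence "B \<le> A + cmod (psU \<alpha> z m x)" by simp
      hence "B\<^sup>2 \<le> (A + cmod (psU \<alpha> z m x))\<^sup>2" by (intro power_mono) (auto simp: B_def)
      also have "\<dots> \<le> 2 * A\<^sup>2 + 2 * (cmod (psU \<alpha> z m x))\<^sup>2"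
        using sum_squares_bound[of A "cmod (psU \<alpha> z m x)"] by (simp add: power2_sum)
      finally show "(cmod m)\<^sup>2 / 2 * (cmod (phU \<alpha> z x))\<^sup>2 - (cmod (thU \<alpha> z x))\<^sup>2 \<le> (cmod (psU \<alpha> z m x))\<^sup>2"
        by (simp add: A_def B_def power_mult_distrib)
    qed
    also have "\<dots> \<le> integral {0..L} (\<lambda>x. (cmod (psU \<alpha> z m x))\<^sup>2)"
      by (rule integral_subset_le) (use L sq_integrable[OF c] in auto)
    finally have "(cmod m)\<^sup>2 / 2 * P - Q \<le> integral {0..L} (\<lambda>x. (cmod (psU \<alpha> z m x))\<^sup>2)" .
    hence "Im z * ((cmod m)\<^sup>2 / 2 * P - Q) \<le> Im z * integral {0..L} (\<lambda>x. (cmod (psU \<alpha> z m x))\<^sup>2)"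
      using z by (intro mult_left_mono) auto
    also have "\<dots> \<le> Im m" using Im_mL[of z L \<alpha>] z L by (simp add: m_def)
    also have "\<dots> \<le> cmod m" using abs_Im_le_cmod[of m] by simp
    finally have "(cmod m)\<^sup>2 / 2 * P - Q \<le> cmod m / Im z" using z by (simp add: field_simps)
    hence "(cmod m)\<^sup>2 / 2 * P \<le> cmod m * (1 / Im z) + Q * 1"
      by (simp only: diff_le_eq mult_1_right times_divide_eq_right)
    \<comment> \<open>Here |m| > 1 is used: after enlarging \<open>Q\<close> to Q |m|, one factor
      |m| cancels.\<close>
    also have "\<dots> \<le> cmod m * (1 / Im z) + Q * cmod m" using Q m1 by (intro add_left_mono mult_left_mono) auto
    also have "\<dots> = cmod m * (1 / Im z + Q)" by (simp add: algebra_simps)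
    finally have "cmod m * (cmod m * (P / 2)) \<le> cmod m * (1 / Im z + Q)" by (simp add: power2_eq_square)
    hence "cmod m * (P / 2) \<le> 1 / Im z + Q" using m1 by (subst (asm) mult_le_cancel_left_pos) auto
    hence "cmod m \<le> 2 / P * (1 / Im z + Q)" using P by (simp add: field_simps)
    thus ?thesis by (simp add: m_def)
  qed simp
  thus ?thesis by blast
qed

text \<open>\<open>m\<close> is a limit point of the truncated values. On a fixed {0..b} the masses
  are at most Im mL / Im z once L >= b, and this bound passes to the limit. Convergence of the whole
  family is obtained later, from decay.\<close>

lemma weyl_solution_exists:
  assumes z: "0 < Im z"
  shows "\<exists>m B. \<forall>b\<ge>0. integral {0..b} (\<lambda>x. (cmod (psU \<alpha> z m x))\<^sup>2) \<le> B"
proof -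
  obtain B where B: "\<And>L. 1 \<le> L \<Longrightarrow> cmod (mL \<alpha> L z) \<le> B" using mL_bounded[OF z] by blast
  define M where "M n = mL \<alpha> (real (Suc n)) z" for n
  have MB: "cmod (M n) \<le> B" for n unfolding M_def by (rule B) simp
  hence "bounded (range M)" by (auto simp: bounded_iff)
  then obtain m r where r: "strict_mono (r :: nat \<Rightarrow> nat)" and m: "(M \<circ> r) \<longlonglongrightarrow> m"
    using bounded_imp_convergent_subsequence by blast
  have "integral {0..b} (\<lambda>x. (cmod (psU \<alpha> z m x))\<^sup>2) \<le> B / Im z" if b: "0 \<le> b" for b
  proof (rule LIMSEQ_le_const2)
    have c: "continuous_on {0..b} (psU \<alpha> z m)" for m by (rule is_sol_continuous(2)[OF ps_sol])
    have tc: "continuous_on {0..b} (thU \<alpha> z)" "continuous_on {0..b} (phU \<alpha> z)" by (auto intro: sol_cont)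
    show "(\<lambda>n. integral {0..b} (\<lambda>x. (cmod (psU \<alpha> z (M (r n)) x))\<^sup>2)) \<longlonglongrightarrow> integral {0..b} (\<lambda>x. (cmod (psU \<alpha> z m x))\<^sup>2)"
    proof (rule dominated_convergence(2))
      show "(\<lambda>x. (cmod (psU \<alpha> z (M (r n)) x))\<^sup>2) integrable_on {0..b}" for n by (rule sq_integrable[OF c])
      show "(\<lambda>x. (cmod (thU \<alpha> z x) + B * cmod (phU \<alpha> z x))\<^sup>2) integrable_on {0..b}"
        by (intro integrable_continuous_interval continuous_intros tc)
      fix x
      show "norm ((cmod (psU \<alpha> z (M (r n)) x))\<^sup>2) \<le> (cmod (thU \<alpha> z x) + B * cmod (phU \<alpha> z x))\<^sup>2" for n
      proof -
        have "cmod (psU \<alpha> z (M (r n)) x) \<le> cmod (thU \<alpha> z x) + cmod (M (r n)) * cmod (phU \<alpha> z x)"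
          unfolding psU_def by (rule order_trans[OF norm_triangle_ineq]) (simp add: norm_mult)
        also have "\<dots> \<le> cmod (thU \<alpha> z x) + B * cmod (phU \<alpha> z x)" using MB by (intro add_left_mono mult_right_mono) auto
        finally show ?thesis by (simp add: power_mono)
      qed
      show "(\<lambda>n. (cmod (psU \<alpha> z (M (r n)) x))\<^sup>2) \<longlonglongrightarrow> (cmod (psU \<alpha> z m x))\<^sup>2"
        using m unfolding psU_def comp_def by (intro tendsto_intros)
    qed
    obtain N where N: "b \<le> real N" using real_arch_simple by blast
    show "\<exists>N. \<forall>n\<ge>N. integral {0..b} (\<lambda>x. (cmod (psU \<alpha> z (M (r n)) x))\<^sup>2) \<le> B / Im z"
    proof (intro exI[of _ N] allI impI)
      fix n assume n: "N \<le> n"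
      define L where "L = real (Suc (r n))"
      have "n \<le> r n" using r by (rule seq_suble)
      hence bL: "b \<le> L" using N n by (simp add: L_def)
      have Meq: "M (r n) = mL \<alpha> L z" by (simp add: M_def L_def)
      have "integral {0..b} (\<lambda>x. (cmod (psU \<alpha> z (M (r n)) x))\<^sup>2) \<le> integral {0..L} (\<lambda>x. (cmod (psU \<alpha> z (M (r n)) x))\<^sup>2)"
        by (rule integral_subset_le) (use bL sq_integrable[OF is_sol_continuous(2)[OF ps_sol]] in auto)
      hence "Im z * integral {0..b} (\<lambda>x. (cmod (psU \<alpha> z (M (r n)) x))\<^sup>2) \<le> Im z * integral {0..L} (\<lambda>x. (cmod (psU \<alpha> z (M (r n)) x))\<^sup>2)"
        using z by (intro mult_left_mono) auto
      also have "\<dots> \<le> Im (M (r n))" using Im_mL[of z L \<alpha>] z b bL by (simp add: Meq)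
      also have "\<dots> \<le> B" using MB[of "r n"] abs_Im_le_cmod[of "M (r n)"] by linarith
      finally show "integral {0..b} (\<lambda>x. (cmod (psU \<alpha> z (M (r n)) x))\<^sup>2) \<le> B / Im z"
        using z by (simp add: pos_le_divide_eq mult.commute)
    qed
  qed
  thus ?thesis by blast
qed

text \<open>The Wronskian of two solutions \<open>\<psi>\<close>, evaluated at \<open>0\<close> and at \<open>L\<close>. Together with \<open>\<bar>U L\<bar>\<^sup>2 \<le> Im m\<^sub>L\<close> it
  makes \<open>m\<^sub>L\<close> converge to \<open>m\<close> as soon as the solution for \<open>m\<close> decays.\<close>

lemma ps_distance:
  assumes z: "0 \<le> Im z" and L: "0 \<le> L"
  shows "m - mL \<alpha> L z = psU \<alpha> z (mL \<alpha> L z) L * (psV \<alpha> z m L - \<i> * psU \<alpha> z m L)"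
proof -
  define l where "l = mL \<alpha> L z"
  have "psV \<alpha> z m L * psU \<alpha> z l L - psU \<alpha> z m L * psV \<alpha> z l L = psV \<alpha> z m 0 * psU \<alpha> z l 0 - psU \<alpha> z m 0 * psV \<alpha> z l 0"
    by (rule wronskian_const[OF ps_sol ps_sol L])
  also have "\<dots> = (m - l) * (of_real (cos \<alpha>) * of_real (cos \<alpha>) + of_real (sin \<alpha>) * of_real (sin \<alpha>))"
    unfolding ps_0 by (simp add: algebra_simps)
  finally have "psV \<alpha> z m L * psU \<alpha> z l L - psU \<alpha> z m L * psV \<alpha> z l L = m - l" unfolding cs_sq by simp
  thus ?thesis using ps_mL_boundary[OF z L, of \<alpha>] by (simp add: l_def algebra_simps)
qed

text \<open>With e = |m - mL| the distance formula gives e^2 <= (Im mL) \<delta> <= (|m| + e)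
  \<delta>. Absorbing e \<delta> <= (e^2 + \<delta>^2) / 2 into the left side bounds
  \<open>e\<close> by \<open>m\<close> and \<delta> alone.\<close>

lemma mL_tendsto:
  assumes z: "0 < Im z" and V0: "(psV \<alpha> z m \<longlongrightarrow> 0) at_top" and U0: "(psU \<alpha> z m \<longlongrightarrow> 0) at_top"
  shows "((\<lambda>L. mL \<alpha> L z) \<longlongrightarrow> m) at_top"
proof -
  define \<delta> where "\<delta> L = (cmod (psV \<alpha> z m L - \<i> * psU \<alpha> z m L))\<^sup>2" for L
  have "((\<lambda>L. (cmod (psV \<alpha> z m L - \<i> * psU \<alpha> z m L))\<^sup>2) \<longlongrightarrow> (cmod (0 - \<i> * 0))\<^sup>2) at_top"
    by (intro tendsto_intros V0 U0)
  hence d0: "(\<delta> \<longlongrightarrow> 0) at_top" by (simp add: \<delta>_def[abs_def])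
  have bd: "(cmod (m - mL \<alpha> L z))\<^sup>2 \<le> 2 * cmod m * \<delta> L + (\<delta> L)\<^sup>2" if L: "0 \<le> L" for L
  proof -
    define e where "e = cmod (m - mL \<alpha> L z)"
    have d: "0 \<le> \<delta> L" by (simp add: \<delta>_def)
    have "e = cmod (psU \<alpha> z (mL \<alpha> L z) L) * cmod (psV \<alpha> z m L - \<i> * psU \<alpha> z m L)"
      unfolding e_def by (subst ps_distance[OF less_imp_le[OF z] L]) (rule norm_mult)
    hence "e\<^sup>2 = (cmod (psU \<alpha> z (mL \<alpha> L z) L))\<^sup>2 * \<delta> L"
      unfolding \<delta>_def by (simp only: power_mult_distrib)
    also have "\<dots> \<le> Im (mL \<alpha> L z) * \<delta> L"
    proof (rule mult_right_mono[OF _ d])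
      have "0 \<le> Im z * integral {0..L} (\<lambda>x. (cmod (psU \<alpha> z (mL \<alpha> L z) x))\<^sup>2)"
        using z sq_integral_nonneg by (intro mult_nonneg_nonneg) auto
      thus "(cmod (psU \<alpha> z (mL \<alpha> L z) L))\<^sup>2 \<le> Im (mL \<alpha> L z)" using Im_mL[OF less_imp_le[OF z] L, of \<alpha>] by simp
    qed
    also have "\<dots> \<le> (cmod m + e) * \<delta> L"
    proof (rule mult_right_mono[OF _ d])
      have "Im (mL \<alpha> L z) \<le> cmod (mL \<alpha> L z)" using abs_Im_le_cmod[of "mL \<alpha> L z"] by simp
      also have "\<dots> \<le> cmod m + e" unfolding e_def using norm_triangle_ineq4[of m "m - mL \<alpha> L z"] by simp
      finally show "Im (mL \<alpha> L z) \<le> cmod m + e" .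
    qed
    also have "\<dots> \<le> cmod m * \<delta> L + (e\<^sup>2 + (\<delta> L)\<^sup>2) / 2"
      unfolding distrib_right using sum_squares_bound[of e "\<delta> L"] by simp
    finally have "e\<^sup>2 \<le> cmod m * \<delta> L + (e\<^sup>2 + (\<delta> L)\<^sup>2) / 2" .
    hence "e\<^sup>2 \<le> 2 * (cmod m * \<delta> L) + (\<delta> L)\<^sup>2" by (simp add: field_simps)
    thus ?thesis by (simp add: e_def mult.assoc)
  qed
  have ev: "\<forall>\<^sub>F L in at_top. norm ((cmod (m - mL \<alpha> L z))\<^sup>2) \<le> 2 * cmod m * \<delta> L + (\<delta> L)\<^sup>2"
    using eventually_ge_at_top[of 0] by eventually_elim (use bd in simp)
  have "((\<lambda>L. 2 * cmod m * \<delta> L + (\<delta> L)\<^sup>2) \<longlongrightarrow> 2 * cmod m * 0 + 0\<^sup>2) at_top"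
    by (intro tendsto_intros d0)
  hence "((\<lambda>L. 2 * cmod m * \<delta> L + (\<delta> L)\<^sup>2) \<longlongrightarrow> 0) at_top" by simp
  from Lim_null_comparison[OF ev this]
  have "((\<lambda>L. (cmod (m - mL \<alpha> L z))\<^sup>2) \<longlongrightarrow> 0) at_top" .
  hence "((\<lambda>L. sqrt ((cmod (m - mL \<alpha> L z))\<^sup>2)) \<longlongrightarrow> sqrt 0) at_top" by (rule tendsto_real_sqrt)
  hence "((\<lambda>L. cmod (mL \<alpha> L z - m)) \<longlongrightarrow> 0) at_top" by (simp add: norm_minus_commute)
  hence "((\<lambda>L. mL \<alpha> L z - m) \<longlongrightarrow> 0) at_top" by (rule tendsto_norm_zero_cancel)
  thus ?thesis by (rule LIM_zero_cancel)
qed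

text \<open>In Green's identity the boundary term vanishes at infinity, so Im m is at least Im z
  times the mass on {0..1}, which is positive because psi is nontrivial.\<close>

lemma Im_weyl_pos:
  assumes z: "0 < Im z" and V0: "(psV \<alpha> z m \<longlongrightarrow> 0) at_top" and U0: "(psU \<alpha> z m \<longlongrightarrow> 0) at_top"
  shows "0 < Im m"
proof -
  let ?P = "integral {0..1} (\<lambda>x. (cmod (psU \<alpha> z m x))\<^sup>2)"
  have "((\<lambda>x. Im (psV \<alpha> z m x * cnj (psU \<alpha> z m x))) \<longlongrightarrow> Im (0 * cnj 0)) at_top" by (intro tendsto_intros V0 U0)
  hence "((\<lambda>x. Im (psV \<alpha> z m x * cnj (psU \<alpha> z m x))) \<longlongrightarrow> 0) at_top" by simp
  moreover have "\<forall>\<^sub>F x in at_top. Im (psV \<alpha> z m x * cnj (psU \<alpha> z m x)) \<le> Im m - Im z * ?P"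
    using eventually_ge_at_top[of 1]
  proof eventually_elim
    case (elim x)
    have "?P \<le> integral {0..x} (\<lambda>x. (cmod (psU \<alpha> z m x))\<^sup>2)"
      by (rule integral_subset_le) (use elim sq_integrable[OF is_sol_continuous(2)[OF ps_sol]] in auto)
    hence "Im z * ?P \<le> Im z * integral {0..x} (\<lambda>x. (cmod (psU \<alpha> z m x))\<^sup>2)"
      using z by (intro mult_left_mono) auto
    moreover have "0 \<le> x" using elim by simp
    ultimately show ?case using ps_green[of x \<alpha> z m] by simp
  qed
  ultimately have "0 \<le> Im m - Im z * ?P" by (rule tendsto_upperbound) simp
  moreover have "0 < Im z * ?P" using z psU_not_null by (rule mult_pos_pos)
  ultimately show ?thesis by linarith
qed

end

section \<open>Decay of square-integrable solutions\<close>

locale sturm_unif = sturm +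
  fixes K :: real
  assumes s_unif: "\<And>x. 0 \<le> x \<Longrightarrow> integral {x..x+1} (\<lambda>t. \<bar>s t\<bar>) \<le> K"
    and q_unif: "\<And>x. 0 \<le> x \<Longrightarrow> integral {x..x+1} (\<lambda>t. \<bar>q t\<bar>) \<le> K"
begin

lemma abs_integrable:
  assumes "0 \<le> a"
  shows "(\<lambda>t. \<bar>s t\<bar>) integrable_on {a..b}" "(\<lambda>t. \<bar>q t\<bar>) integrable_on {a..b}" 
proof -
  have "(\<lambda>x. \<bar>s x\<bar>) absolutely_integrable_on {a..b}" "(\<lambda>x. \<bar>q x\<bar>) absolutely_integrable_on {a..b}"
    using absolutely_integrable_norm[OF abs_int_sub[OF s_int assms]] absolutely_integrable_norm[OF abs_int_sub[OF q_int assms]]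
    by (simp_all add: comp_def)
  thus "(\<lambda>t. \<bar>s t\<bar>) integrable_on {a..b}" "(\<lambda>t. \<bar>q t\<bar>) integrable_on {a..b}"
    by (auto intro: set_lebesgue_integral_eq_integral(1))
qed

lemma K_nonneg: "0 \<le> K"
  using integral_nonneg[OF abs_integrable(1), of 0 1] s_unif[of 0] by simp

text \<open>The functions \<open>P = e\<^sup>-\<^sup>S U\<close> and \<open>Q = e\<^sup>S V\<close> with \<open>S' = s\<close> satisfy \<open>P' = e\<^sup>-\<^sup>2\<^sup>S Q\<close> and
  \<open>Q' = e\<^sup>2\<^sup>S (q - z) P\<close>, so a small \<open>P\<close> makes \<open>Q\<close> nearly constant and then small as well,
  while \<open>P\<close> is Lipschitz, so that its maximum is controlled by its mean square.\<close>

lemma local_estimate: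
  "\<exists>C. \<forall>x V U. 0 \<le> x \<longrightarrow> is_sol z x (x + 1) V U \<longrightarrow>
     (cmod (V x))\<^sup>2 + (cmod (U x))\<^sup>2 \<le> C * integral {x..x+1} (\<lambda>t. (cmod (U t))\<^sup>2)"
proof -
  \<comment> \<open>Relative to the maximum \<open>M\<close> of |P| on the unit interval:
    \<open>e\<close> bounds exp S and exp (-S), \<open>G\<close> the growth of |V|^2 + |U|^2,
    \<open>c1\<close> the variation of \<open>Q\<close>, \<open>c2\<close> the value
    \<open>Q x\<close>, and \<open>c3\<close> the derivative of \<open>P\<close>. The length
    \<open>l\<close> is at most 1/2 and so short that \<open>P\<close> loses at most half of its
    maximum over it.\<close>
  define e where "e = exp K"
  define G where "G = exp (2 * K + K + (cmod z + 1))"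
  define c1 where "c1 = e * e * (K + cmod z)"
  define c2 where "c2 = e * e * (2 + e * e * c1)"
  define c3 where "c3 = e * sqrt ((c2\<^sup>2 + 1) * G) + 1"
  define l where "l = min (1/2) (1 / (2 * c3))"
  have e1: "1 \<le> e" using K_nonneg by (simp add: e_def)
  have c1: "0 \<le> c1" using e1 K_nonneg by (simp add: c1_def)
  have c3: "1 \<le> c3" using e1 by (simp add: c3_def G_def)
  have l: "0 < l" "l \<le> 1/2" "c3 * l \<le> 1/2" using c3 by (auto simp: l_def min_def field_simps)
  have main: "(cmod (V x))\<^sup>2 + (cmod (U x))\<^sup>2 \<le> ((c2\<^sup>2 + 1) * (4 * (e * e)) / l) * integral {x..x+1} (\<lambda>t. (cmod (U t))\<^sup>2)"
    if x: "0 \<le> x" and sol: "is_sol z x (x + 1) V U" for x V U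
  proof -
    let ?J = "{x..x+1}"
    define S where "S t = integral {x..t} s" for t
    have S: "ac_deriv x (x+1) S s" using ac_deriv_integral[OF abs_int_sub[OF s_int x], where c=0] by (simp add: S_def[abs_def])
    have Sb: "\<bar>S t\<bar> \<le> K" if t: "t \<in> ?J" for t
    proof -
      have si: "s integrable_on {x..t}" using abs_int_sub[OF s_int x] by (rule set_lebesgue_integral_eq_integral(1))
      have "norm (integral {x..t} s) \<le> integral {x..t} (\<lambda>t. \<bar>s t\<bar>)"
        by (rule integral_norm_bound_integral[OF si abs_integrable(1)[OF x]]) simp
      also have "\<dots> \<le> integral ?J (\<lambda>t. \<bar>s t\<bar>)"
        by (rule integral_subset_le) (use t abs_integrable(1)[OF x] in auto)
      also have "\<dots> \<le> K" by (rule s_unif[OF x])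
      finally show ?thesis by (simp add: S_def)
    qed
    have Se: "exp (S t) \<le> e" "exp (- S t) \<le> e" "1 / e \<le> exp (- S t)" "1 / e \<le> exp (S t)" if "t \<in> ?J" for t
      using Sb[OF that] unfolding e_def by (auto simp: exp_minus divide_inverse simp flip: exp_minus)
    define P where "P t = exp (- S t) *\<^sub>R U t" for t
    define Q where "Q t = exp (S t) *\<^sub>R V t" for t
    have mS: "ac_deriv x (x+1) (\<lambda>t. - S t) (\<lambda>t. - s t)" using ac_deriv_cmult[OF S, of "-1"] by simp
    have P: "ac_deriv x (x+1) P (\<lambda>t. exp (- S t) *\<^sub>R V t)"
    proof (rule ac_deriv_cong)
      show "ac_deriv x (x+1) (\<lambda>t. exp (- S t) *\<^sub>R U t) (\<lambda>t. exp (- S t) *\<^sub>R (V t + of_real (s t) * U t) + (exp (- S t) * - s t) *\<^sub>R U t)"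
        using sol unfolding is_sol_def by (intro ac_deriv_bilinear[OF bounded_bilinear_scaleR] ac_deriv_exp mS) auto
    qed (auto simp: P_def scaleR_conv_of_real algebra_simps)
    have Q: "ac_deriv x (x+1) Q (\<lambda>t. exp (S t) *\<^sub>R ((of_real (q t) - z) * U t))"
    proof (rule ac_deriv_cong)
      show "ac_deriv x (x+1) (\<lambda>t. exp (S t) *\<^sub>R V t) (\<lambda>t. exp (S t) *\<^sub>R (- of_real (s t) * V t + (of_real (q t) - z) * U t) + (exp (S t) * s t) *\<^sub>R V t)"
        using sol unfolding is_sol_def by (intro ac_deriv_bilinear[OF bounded_bilinear_scaleR] ac_deriv_exp S) auto
    qed (auto simp: Q_def scaleR_conv_of_real algebra_simps)
    have Pc: "continuous_on ?J P" and Qc: "continuous_on ?J Q" and Sc: "continuous_on ?J S"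
      using ac_deriv_continuous[OF P] ac_deriv_continuous[OF Q] ac_deriv_continuous[OF S] by auto
    have Vc: "continuous_on ?J V" and Uc: "continuous_on ?J U" using is_sol_continuous[OF sol] by auto
    obtain t0 where t0: "t0 \<in> ?J" and sup: "\<And>t. t \<in> ?J \<Longrightarrow> cmod (P t) \<le> cmod (P t0)"
      using continuous_attains_sup[of ?J "\<lambda>t. cmod (P t)"] continuous_on_norm[OF Pc] by auto
    define M where "M = cmod (P t0)"
    have M: "0 \<le> M" by (simp add: M_def)
    have Ub: "cmod (U t) \<le> e * M" if t: "t \<in> ?J" for t
    proof -
      have "U t = exp (S t) *\<^sub>R P t" by (simp add: P_def exp_minus)
      hence "cmod (U t) = exp (S t) * cmod (P t)" by simp
      also have "\<dots> \<le> e * M" using Se(1)[OF t] sup[OF t] e1 unfolding M_def by (intro mult_mono) auto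
      finally show ?thesis .
    qed
    have Qd: "cmod (Q t - Q x) \<le> c1 * M" if t: "t \<in> ?J" for t
    proof -
      have Qt: "ac_deriv x t Q (\<lambda>t. exp (S t) *\<^sub>R ((of_real (q t) - z) * U t))"
        by (rule ac_deriv_subinterval[OF Q]) (use t in auto)
      have I: "((\<lambda>t. exp (S t) *\<^sub>R ((of_real (q t) - z) * U t)) has_integral (Q t - Q x)) {x..t}"
        by (rule ac_deriv_imp_has_integral[OF Qt]) (use t in auto)
      have qz: "(\<lambda>t. e * ((\<bar>q t\<bar> + cmod z) * (e * M))) integrable_on {x..b}" for b
        by (intro integrable_on_mult_right integrable_on_mult_left integrable_add abs_integrable x) auto
      have "norm (integral {x..t} (\<lambda>t. exp (S t) *\<^sub>R ((of_real (q t) - z) * U t))) \<le> integral {x..t} (\<lambda>t. e * ((\<bar>q t\<bar> + cmod z) * (e * M)))"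
      proof (rule integral_norm_bound_integral[OF _ qz])
        show "(\<lambda>t. exp (S t) *\<^sub>R ((of_real (q t) - z) * U t)) integrable_on {x..t}" using I by blast
        fix y assume "y \<in> {x..t}"
        hence y: "y \<in> ?J" using t by auto
        have "cmod (of_real (q y) - z) \<le> \<bar>q y\<bar> + cmod z" by (rule order_trans[OF norm_triangle_ineq4]) simp
        thus "norm (exp (S y) *\<^sub>R ((of_real (q y) - z) * U y)) \<le> e * ((\<bar>q y\<bar> + cmod z) * (e * M))"
          using Se(1)[OF y] Ub[OF y] e1 M by (auto simp: norm_mult intro!: mult_mono)
      qed
      also have "\<dots> \<le> integral ?J (\<lambda>t. e * ((\<bar>q t\<bar> + cmod z) * (e * M)))"
        by (rule integral_subset_le) (use t qz e1 M in auto)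
      also have "\<dots> = e * ((integral ?J (\<lambda>t. \<bar>q t\<bar>) + cmod z) * (e * M))"
        using abs_integrable(2)[OF x, of "x+1"]
        by (simp add: Henstock_Kurzweil_Integration.integral_add[OF _ integrable_const_ivl])
      also have "\<dots> \<le> e * ((K + cmod z) * (e * M))"
        using q_unif[OF x] e1 M by (intro mult_left_mono mult_right_mono) auto
      also have "\<dots> = c1 * M" by (simp add: c1_def mult_ac)
      finally show ?thesis using integral_unique[OF I] by simp
    qed
    \<comment> \<open>The increment P (x + 1) - P x is the integral of w Q with w = exp (-2 S) at
      least 1 / e^2. Since \<open>Q\<close> stays close to \<open>Q x\<close>, a large
      \<open>Q x\<close> would push this increment beyond 2 M.\<close>
    have Qx: "cmod (Q x) \<le> c2 * M"
    proof -
      define w where "w t = exp (- S t) * exp (- S t)" for t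
      have wc: "continuous_on ?J w" unfolding w_def by (intro continuous_intros Sc)
      have w: "w t \<le> e * e" "1 / (e * e) \<le> w t" "0 \<le> w t" if t: "t \<in> ?J" for t
      proof -
        show "w t \<le> e * e" unfolding w_def using Se(2)[OF t] by (intro mult_mono) (auto simp: e_def)
        have "(1 / e) * (1 / e) \<le> w t" unfolding w_def using Se(3)[OF t] e1 by (intro mult_mono) auto
        thus "1 / (e * e) \<le> w t" by simp
        show "0 \<le> w t" by (simp add: w_def)
      qed
      have I: "((\<lambda>t. exp (- S t) *\<^sub>R V t) has_integral (P (x+1) - P x)) ?J"
        by (rule ac_deriv_imp_has_integral[OF P]) simp
      have I': "((\<lambda>t. w t *\<^sub>R Q t) has_integral (P (x+1) - P x)) ?J"
        by (rule has_integral_cong[THEN iffD1, OF _ I]) (simp add: w_def Q_def flip: exp_add)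
      have wi: "(w has_integral integral ?J w) ?J" by (intro integrable_integral integrable_continuous_interval wc)
      have I2: "((\<lambda>t. w t *\<^sub>R Q x) has_integral integral ?J w *\<^sub>R Q x) ?J"
        using has_integral_scaleR_left[OF wi] .
      have D: "((\<lambda>t. w t *\<^sub>R Q t - w t *\<^sub>R Q x) has_integral (P (x+1) - P x - integral ?J w *\<^sub>R Q x)) ?J"
        by (rule has_integral_diff[OF I' I2])
      have "norm (P (x+1) - P x - integral ?J w *\<^sub>R Q x) \<le> e * e * (c1 * M) * measure lborel (cbox x (x+1))"
      proof (rule has_integral_bound)
        show "((\<lambda>t. w t *\<^sub>R Q t - w t *\<^sub>R Q x) has_integral (P (x+1) - P x - integral ?J w *\<^sub>R Q x)) (cbox x (x+1))" using D by simp
        fix t assume "t \<in> cbox x (x+1)"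
        hence t: "t \<in> ?J" by simp
        have "norm (w t *\<^sub>R Q t - w t *\<^sub>R Q x) = w t * cmod (Q t - Q x)" using w(3)[OF t] by (simp flip: scaleR_diff_right)
        also have "\<dots> \<le> e * e * (c1 * M)" using w[OF t] Qd[OF t] e1 by (intro mult_mono) auto
        finally show "norm (w t *\<^sub>R Q t - w t *\<^sub>R Q x) \<le> e * e * (c1 * M)" .
      qed (use e1 c1 M in auto)
      hence 1: "norm (P (x+1) - P x - integral ?J w *\<^sub>R Q x) \<le> e * e * (c1 * M)" by simp
      have "cmod (P (x+1)) \<le> M" "cmod (P x) \<le> M" unfolding M_def by (auto intro!: sup)
      hence 2: "cmod (P (x+1) - P x) \<le> 2 * M" using norm_triangle_ineq4[of "P (x+1)" "P x"] by linarith
      have "1 / (e * e) \<le> integral ?J w"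
        using integral_le[OF integrable_const_ivl[of "1 / (e * e)" x "x+1"] integrable_continuous_interval[OF wc] w(2)] by simp
      hence "1 / (e * e) * cmod (Q x) \<le> integral ?J w * cmod (Q x)" by (intro mult_right_mono) auto
      also have "\<dots> = cmod (integral ?J w *\<^sub>R Q x)"
        using integral_nonneg[OF integrable_continuous_interval[OF wc] w(3)] by simp
      also have "\<dots> \<le> cmod (P (x+1) - P x) + norm (P (x+1) - P x - integral ?J w *\<^sub>R Q x)"
        using norm_triangle_ineq4[of "P (x+1) - P x" "P (x+1) - P x - integral ?J w *\<^sub>R Q x"] by simp
      also have "\<dots> \<le> 2 * M + e * e * (c1 * M)" using 1 2 by linarith
      finally have "(e * e) * (1 / (e * e) * cmod (Q x)) \<le> (e * e) * (2 * M + e * e * (c1 * M))"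
        using e1 by (intro mult_left_mono) auto
      thus ?thesis using e1 by (simp add: c2_def algebra_simps)
    qed
    have Sx: "S x = 0" by (simp add: S_def)
    have N: "(cmod (V x))\<^sup>2 + (cmod (U x))\<^sup>2 \<le> (c2\<^sup>2 + 1) * M\<^sup>2"
    proof -
      have "(cmod (V x))\<^sup>2 \<le> (c2 * M)\<^sup>2" using Qx Sx by (intro power_mono) (auto simp: Q_def)
      moreover have "(cmod (U x))\<^sup>2 \<le> M\<^sup>2" using sup[of x] Sx by (intro power_mono) (auto simp: P_def M_def)
      ultimately show ?thesis by (simp add: power_mult_distrib distrib_right)
    qed
    have gi: "integral {x..t} (growth (cmod z)) \<le> 2 * K + K + (cmod z + 1)" if t: "t \<in> ?J" for t
    proof -
      have "integral {x..t} (growth (cmod z)) \<le> integral ?J (growth (cmod z))"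
        by (rule integral_subset_le) (use t growth_int[OF x] in \<open>auto simp: growth_def dest: set_lebesgue_integral_eq_integral(1)\<close>)
      also have "\<dots> = integral ?J (\<lambda>t. 2 * \<bar>s t\<bar> + \<bar>q t\<bar> + (cmod z + 1))" by (rule integral_cong) (simp add: growth_def)
      also have "\<dots> = 2 * integral ?J (\<lambda>t. \<bar>s t\<bar>) + integral ?J (\<lambda>t. \<bar>q t\<bar>) + (cmod z + 1)"
      proof -
        have i2: "(\<lambda>t. 2 * \<bar>s t\<bar>) integrable_on ?J" by (intro integrable_on_mult_right abs_integrable x)
        show ?thesis
          by (simp add: Henstock_Kurzweil_Integration.integral_add integrable_add i2 abs_integrable[OF x] integrable_const_ivl)
      qed
      also have "\<dots> \<le> 2 * K + K + (cmod z + 1)" using s_unif[OF x] q_unif[OF x] by simp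
      finally show ?thesis .
    qed
    have Vb: "cmod (exp (- S t) *\<^sub>R V t) \<le> c3 * M" if t: "t \<in> ?J" for t
    proof -
      have "(cmod (V t))\<^sup>2 \<le> (cmod (V t))\<^sup>2 + (cmod (U t))\<^sup>2" by simp
      also have "\<dots> \<le> ((cmod (V x))\<^sup>2 + (cmod (U x))\<^sup>2) * exp (integral {x..t} (growth (cmod z)))"
        by (rule is_sol_growth(1)[OF is_sol_subinterval[OF sol]]) (use x t in auto)
      also have "\<dots> \<le> (c2\<^sup>2 + 1) * M\<^sup>2 * G"
        unfolding G_def using N gi[OF t] by (intro mult_mono) auto
      also have "\<dots> = (c2\<^sup>2 + 1) * G * M\<^sup>2" by (simp add: mult_ac)
      finally have "cmod (V t) \<le> sqrt ((c2\<^sup>2 + 1) * G * M\<^sup>2)" by (rule real_le_rsqrt)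
      also have "\<dots> = sqrt ((c2\<^sup>2 + 1) * G) * M" using M by (simp add: real_sqrt_mult)
      finally have 1: "cmod (V t) \<le> sqrt ((c2\<^sup>2 + 1) * G) * M" .
      have "cmod (exp (- S t) *\<^sub>R V t) = exp (- S t) * cmod (V t)" by simp
      also have "\<dots> \<le> e * (sqrt ((c2\<^sup>2 + 1) * G) * M)" using 1 Se(2)[OF t] e1 by (intro mult_mono) auto
      also have "\<dots> \<le> c3 * M" using M by (simp add: c3_def distrib_right mult.assoc)
      finally show ?thesis .
    qed
    have Plip: "cmod (P t - P r) \<le> c3 * M * (t - r)" if "r \<in> ?J" "t \<in> ?J" "r \<le> t" for r t
    proof -
      have "ac_deriv r t P (\<lambda>t. exp (- S t) *\<^sub>R V t)" by (rule ac_deriv_subinterval[OF P]) (use that in auto)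
      from ac_deriv_imp_has_integral[OF this that(3)]
      have "norm (P t - P r) \<le> c3 * M * measure lborel (cbox r t)"
        by (intro has_integral_bound[where f="\<lambda>t. exp (- S t) *\<^sub>R V t"]) (use c3 M Vb that in auto)
      thus ?thesis using that by simp
    qed
    \<comment> \<open>As l <= 1/2, an interval of length \<open>l\<close> starting or ending at the
      maximum point fits into the unit interval.\<close>
    have "\<exists>c. c \<in> ?J \<and> c + l \<in> ?J \<and> t0 \<in> {c..c+l}"
    proof (cases "t0 \<le> x + 1/2")
      case True thus ?thesis using t0 l by (intro exI[of _ t0]) auto
    next
      case False thus ?thesis using t0 l by (intro exI[of _ "t0 - l"]) auto
    qed
    then obtain c where c: "c \<in> ?J" "c + l \<in> ?J" "t0 \<in> {c..c+l}" by blast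
    \<comment> \<open>There |P| is at least M / 2, so |U| is at least M / (2 e).\<close>
    have low: "M\<^sup>2 / (4 * (e * e)) \<le> (cmod (U t))\<^sup>2" if t: "t \<in> {c..c+l}" for t
    proof -
      have tJ: "t \<in> ?J" using t c by auto
      have "cmod (P t0 - P t) \<le> c3 * M * l"
      proof (cases "t \<le> t0")
        case True
        have "cmod (P t0 - P t) \<le> c3 * M * (t0 - t)" by (rule Plip[OF tJ t0 True])
        also have "\<dots> \<le> c3 * M * l" using t c c3 M by (intro mult_left_mono) auto
        finally show ?thesis .
      next
        case False
        hence "cmod (P t - P t0) \<le> c3 * M * (t - t0)" by (intro Plip[OF t0 tJ]) simp
        also have "\<dots> \<le> c3 * M * l" using t c c3 M by (intro mult_left_mono) auto
        finally show ?thesis by (simp add: norm_minus_commute)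
      qed
      also have "\<dots> = M * (c3 * l)" by (simp add: mult_ac)
      also have "\<dots> \<le> M * (1/2)" using l(3) M by (intro mult_left_mono) auto
      finally have "M / 2 \<le> cmod (P t)" using norm_triangle_ineq2[of "P t0" "P t"] by (simp add: M_def)
      also have "cmod (P t) = exp (- S t) * cmod (U t)" by (simp add: P_def)
      also have "\<dots> \<le> e * cmod (U t)" using Se(2)[OF tJ] by (intro mult_right_mono) auto
      finally have "(M / 2)\<^sup>2 \<le> (e * cmod (U t))\<^sup>2" using M by (intro power_mono) auto
      thus ?thesis using e1 by (simp add: power_mult_distrib power_divide field_simps power2_eq_square[of e])
    qed
    have ui: "(\<lambda>t. (cmod (U t))\<^sup>2) integrable_on ?J" by (rule sq_integrable[OF Uc])
    have ui2: "(\<lambda>t. (cmod (U t))\<^sup>2) integrable_on {c..c+l}"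
      by (rule integrable_subinterval_real[OF ui]) (use c in auto)
    have "M\<^sup>2 / (4 * (e * e)) * l = integral {c..c+l} (\<lambda>t. M\<^sup>2 / (4 * (e * e)))" using l by simp
    also have "\<dots> \<le> integral {c..c+l} (\<lambda>t. (cmod (U t))\<^sup>2)"
      by (rule integral_le[OF integrable_const_ivl ui2 low])
    also have "\<dots> \<le> integral ?J (\<lambda>t. (cmod (U t))\<^sup>2)"
      by (rule integral_subset_le[OF _ ui2 ui]) (use c in auto)
    finally have "M\<^sup>2 \<le> 4 * (e * e) / l * integral ?J (\<lambda>t. (cmod (U t))\<^sup>2)"
      using l(1) e1 by (simp add: field_simps)
    hence "(c2\<^sup>2 + 1) * M\<^sup>2 \<le> (c2\<^sup>2 + 1) * (4 * (e * e) / l * integral ?J (\<lambda>t. (cmod (U t))\<^sup>2))"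
      by (intro mult_left_mono) auto
    thus ?thesis using N by simp
  qed
  thus ?thesis by blast
qed

text \<open>The mass over {x..x+1} is an increment of a bounded increasing function, so it tends to
  0; \<open>local_estimate\<close> bounds both components by it.\<close>

lemma sq_integrable_solution_decays:
  assumes sol: "\<And>b. is_sol z 0 b V U" and B: "\<And>b. 0 \<le> b \<Longrightarrow> integral {0..b} (\<lambda>t. (cmod (U t))\<^sup>2) \<le> B"
  shows "(V \<longlongrightarrow> 0) at_top" "(U \<longlongrightarrow> 0) at_top"
proof -
  obtain C where C: "\<And>x. 0 \<le> x \<Longrightarrow> (cmod (V x))\<^sup>2 + (cmod (U x))\<^sup>2 \<le> C * integral {x..x+1} (\<lambda>t. (cmod (U t))\<^sup>2)"
  proof -
    obtain C where "\<forall>x V U. 0 \<le> x \<longrightarrow> is_sol z x (x + 1) V U \<longrightarrow>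
     (cmod (V x))\<^sup>2 + (cmod (U x))\<^sup>2 \<le> C * integral {x..x+1} (\<lambda>t. (cmod (U t))\<^sup>2)" using local_estimate by blast
    moreover have "is_sol z x (x+1) V U" if "0 \<le> x" for x by (rule is_sol_subinterval[OF sol that order_refl])
    ultimately show ?thesis using that by blast
  qed
  define F where "F b = integral {0..b} (\<lambda>t. (cmod (U t))\<^sup>2)" for b
  have ui: "(\<lambda>t. (cmod (U t))\<^sup>2) integrable_on {0..b}" for b by (rule sq_integrable[OF is_sol_continuous(2)[OF sol]])
  have mono: "F a \<le> F b" if "a \<le> b" for a b unfolding F_def by (rule integral_subset_le) (use that ui in auto)
  have diff: "integral {x..x+1} (\<lambda>t. (cmod (U t))\<^sup>2) = F (x+1) - F x" if "0 \<le> x" for x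
    using Henstock_Kurzweil_Integration.integral_combine[of 0 x "x+1" "\<lambda>t. (cmod (U t))\<^sup>2"] that ui by (simp add: F_def)
  have bdd: "bdd_above (F ` {0..})" unfolding F_def using B by (intro bdd_aboveI2) auto
  define l where "l = Sup (F ` {0..})"
  have Fl: "F b \<le> l" if "0 \<le> b" for b unfolding l_def using bdd that by (intro cSup_upper) auto
  have F1: "(F \<longlongrightarrow> l) at_top"
  proof (rule order_tendstoI)
    fix a assume "a < l"
    then obtain b where b: "0 \<le> b" "a < F b" unfolding l_def using less_cSup_iff[OF _ bdd] by auto
    show "\<forall>\<^sub>F x in at_top. a < F x" using eventually_ge_at_top[of b] by eventually_elim (use b mono in \<open>meson less_le_trans\<close>)
  next
    fix a assume "l < a"
    show "\<forall>\<^sub>F x in at_top. F x < a" using eventually_ge_at_top[of 0] by eventually_elim (use Fl \<open>l < a\<close> in \<open>meson le_less_trans\<close>)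
  qed
  have "((\<lambda>x. F (x + 1)) \<longlongrightarrow> l) at_top"
  proof (rule filterlim_compose[OF F1])
    have "filterlim (\<lambda>x::real. 1 + x) at_top at_top"
      by (rule filterlim_tendsto_add_at_top[OF tendsto_const filterlim_ident])
    thus "filterlim (\<lambda>x::real. x + 1) at_top at_top" by (simp add: add.commute)
  qed
  from tendsto_mult[OF tendsto_const[of C] tendsto_diff[OF this F1]]
  have lim: "((\<lambda>x. C * (F (x + 1) - F x)) \<longlongrightarrow> 0) at_top" by simp
  have gen: "(W \<longlongrightarrow> 0) at_top" if W: "\<And>x. (cmod (W x))\<^sup>2 \<le> (cmod (V x))\<^sup>2 + (cmod (U x))\<^sup>2" for W
  proof -
    have "\<forall>\<^sub>F x in at_top. norm ((cmod (W x))\<^sup>2) \<le> C * (F (x + 1) - F x)"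
      using eventually_ge_at_top[of 0]
    proof eventually_elim
      case (elim x)
      show ?case using order_trans[OF W C[OF elim]] diff[OF elim] by simp
    qed
    from Lim_null_comparison[OF this lim] have "((\<lambda>x. (cmod (W x))\<^sup>2) \<longlongrightarrow> 0) at_top" .
    hence "((\<lambda>x. sqrt ((cmod (W x))\<^sup>2)) \<longlongrightarrow> sqrt 0) at_top" by (rule tendsto_real_sqrt)
    hence "((\<lambda>x. cmod (W x)) \<longlongrightarrow> 0) at_top" by simp
    thus ?thesis by (rule tendsto_norm_zero_cancel)
  qed
  show "(V \<longlongrightarrow> 0) at_top" "(U \<longlongrightarrow> 0) at_top" by (rule gen, simp)+
qed

text \<open>With \<open>c\<close> and \<open>d\<close> the coordinates of the initial data in the
  rotated basis, m = d / c and U / c is psi. If \<open>c\<close> were 0, the boundary terms of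
  Green's identity would vanish at 0 and at infinity and the solution would have mass 0: a nonreal
  \<open>z\<close> is not an eigenvalue.\<close>

lemma weyl_quotient:
  fixes \<alpha> :: real and z :: complex
  assumes z: "0 < Im z" and sol: "\<And>b. is_sol z 0 b V U"
    and B: "\<And>b. 0 \<le> b \<Longrightarrow> integral {0..b} (\<lambda>t. (cmod (U t))\<^sup>2) \<le> B" and nz: "0 < x" "U x \<noteq> 0"
  defines "m \<equiv> (of_real (cos \<alpha>) * V 0 - of_real (sin \<alpha>) * U 0) / (of_real (sin \<alpha>) * V 0 + of_real (cos \<alpha>) * U 0)"
  shows "((\<lambda>L. mL \<alpha> L z) \<longlongrightarrow> m) at_top" "0 < Im m"
proof -
  define c where "c = of_real (sin \<alpha>) * V 0 + of_real (cos \<alpha>) * U 0"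
  define d where "d = of_real (cos \<alpha>) * V 0 - of_real (sin \<alpha>) * U 0"
  note lims = sq_integrable_solution_decays[OF sol B]
  have V0: "V 0 = c * of_real (sin \<alpha>) + d * of_real (cos \<alpha>)"
  proof -
    have "c * of_real (sin \<alpha>) + d * of_real (cos \<alpha>) = V 0 * (of_real (cos \<alpha>) * of_real (cos \<alpha>) + of_real (sin \<alpha>) * of_real (sin \<alpha>))"
      by (simp add: c_def d_def algebra_simps)
    thus ?thesis unfolding cs_sq by simp
  qed
  have U0: "U 0 = c * of_real (cos \<alpha>) - d * of_real (sin \<alpha>)"
  proof -
    have "c * of_real (cos \<alpha>) - d * of_real (sin \<alpha>) = U 0 * (of_real (cos \<alpha>) * of_real (cos \<alpha>) + of_real (sin \<alpha>) * of_real (sin \<alpha>))"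
      by (simp add: c_def d_def algebra_simps)
    thus ?thesis unfolding cs_sq by simp
  qed
  have ui: "(\<lambda>t. (cmod (U t))\<^sup>2) integrable_on {0..b}" for b by (rule sq_integrable[OF is_sol_continuous(2)[OF sol]])
  have c: "c \<noteq> 0"
  proof
    assume "c = 0"
    hence "V 0 * cnj (U 0) = - (of_real (cos \<alpha> * sin \<alpha>) * (d * cnj d))" unfolding V0 U0 by (simp add: mult_ac)
    hence im0: "Im (V 0 * cnj (U 0)) = 0" unfolding complex_norm_square[symmetric] by simp
    have "((\<lambda>b. Im (V b * cnj (U b))) \<longlongrightarrow> Im (0 * cnj 0)) at_top" by (intro tendsto_intros lims)
    hence "((\<lambda>b. Im (V b * cnj (U b))) \<longlongrightarrow> 0) at_top" by simp
    moreover have "\<forall>\<^sub>F b in at_top. Im (V b * cnj (U b)) \<le> - (Im z * integral {0..x} (\<lambda>t. (cmod (U t))\<^sup>2))"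
      using eventually_ge_at_top[of x]
    proof eventually_elim
      case (elim b)
      have "integral {0..x} (\<lambda>t. (cmod (U t))\<^sup>2) \<le> integral {0..b} (\<lambda>t. (cmod (U t))\<^sup>2)"
        by (rule integral_subset_le) (use elim ui in auto)
      hence "Im z * integral {0..x} (\<lambda>t. (cmod (U t))\<^sup>2) \<le> Im z * integral {0..b} (\<lambda>t. (cmod (U t))\<^sup>2)"
        using z by (intro mult_left_mono) auto
      moreover have "Im (V b * cnj (U b)) = Im (V 0 * cnj (U 0)) - Im z * integral {0..b} (\<lambda>t. (cmod (U t))\<^sup>2)"
        by (rule green[OF sol]) (use elim nz in auto)
      ultimately show ?case using im0 by simp
    qed
    ultimately have "0 \<le> - (Im z * integral {0..x} (\<lambda>t. (cmod (U t))\<^sup>2))"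
      by (rule tendsto_upperbound) simp
    hence "integral {0..x} (\<lambda>t. (cmod (U t))\<^sup>2) \<le> 0" using z by (simp add: mult_le_0_iff)
    hence "integral {0..x} (\<lambda>t. (cmod (U t))\<^sup>2) = 0" using sq_integral_nonneg[of "{0..x}" U] by simp
    moreover have "continuous_on {0..x} (\<lambda>t. (cmod (U t))\<^sup>2)" by (intro continuous_intros is_sol_continuous(2)[OF sol])
    ultimately have "\<forall>t\<in>{0..x}. (cmod (U t))\<^sup>2 = 0" using nz by (subst (asm) integral_eq_0_iff) auto
    thus False using nz by auto
  qed
  have eq: "psV \<alpha> z (d / c) t = V t / c \<and> psU \<alpha> z (d / c) t = U t / c" if t: "0 \<le> t" for t
  proof -
    have "is_sol z 0 t (\<lambda>x. (1 / c) * V x + 0 * V x) (\<lambda>x. (1 / c) * U x + 0 * U x)" by (rule is_sol_combine[OF sol sol])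
    hence s2: "is_sol z 0 t (\<lambda>x. V x / c) (\<lambda>x. U x / c)" by simp
    show ?thesis by (rule is_sol_unique[OF ps_sol s2, of 0]) (use t c in \<open>auto simp: ps_0 V0 U0 field_simps\<close>)
  qed
  have div: "((\<lambda>t. V t / c) \<longlongrightarrow> 0) at_top" "((\<lambda>t. U t / c) \<longlongrightarrow> 0) at_top"
    using tendsto_divide[OF lims(1) tendsto_const c] tendsto_divide[OF lims(2) tendsto_const c] by auto
  have "(psV \<alpha> z (d / c) \<longlongrightarrow> 0) at_top"
    by (rule Lim_transform_eventually[OF div(1)]) (use eventually_ge_at_top[of 0] in eventually_elim, simp add: eq)
  moreover have "(psU \<alpha> z (d / c) \<longlongrightarrow> 0) at_top"
    by (rule Lim_transform_eventually[OF div(2)]) (use eventually_ge_at_top[of 0] in eventually_elim, simp add: eq)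
  ultimately show "((\<lambda>L. mL \<alpha> L z) \<longlongrightarrow> m) at_top" "0 < Im m"
    using mL_tendsto[OF z] Im_weyl_pos[OF z] by (auto simp: m_def c_def d_def)
qed

end

section \<open>Transfer matrices and the Weyl function on the half-line\<close>

lemma uniformly_locally_integrable:
  fixes f :: "real \<Rightarrow> real"
  assumes fm: "f \<in> borel_measurable (lebesgue_on {0<..})"
    and fin: "(SUP x\<in>{0<..}. \<integral>\<^sup>+t\<in>{x..x+1}. ennreal \<bar>f t\<bar> \<partial>lebesgue) < \<infinity>"
  defines "g \<equiv> (\<lambda>t. if 0 < t then f t else 0)"
  shows "g \<in> borel_measurable lebesgue" "\<And>b. g absolutely_integrable_on {0..b}"
    "\<exists>C. \<forall>x\<ge>0. integral {x..x+1} (\<lambda>t. \<bar>g t\<bar>) \<le> C"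
proof -
  show gm[measurable]: "g \<in> borel_measurable lebesgue"
  proof -
    have "(\<lambda>x. if x \<in> {0<..} then f x else 0) \<in> borel_measurable lebesgue"
      using fm by (subst borel_measurable_if) auto
    thus ?thesis by (simp add: g_def)
  qed
  have [measurable]: "{a..b} \<in> sets lebesgue" for a b :: real by simp
  have [measurable]: "indicator {a..b} \<in> borel_measurable lebesgue" for a b :: real by (rule borel_measurable_indicator) simp
  have [measurable]: "(indicator {a..b} :: real \<Rightarrow> ennreal) \<in> borel_measurable lebesgue" for a b :: real by (rule borel_measurable_indicator) simp
  obtain C where C0: "0 \<le> C" and C: "(SUP x\<in>{0<..}. \<integral>\<^sup>+t\<in>{x..x+1}. ennreal \<bar>f t\<bar> \<partial>lebesgue) = ennreal C"
    using fin by (cases "SUP x\<in>{0<..}. \<integral>\<^sup>+t\<in>{x..x+1}. ennreal \<bar>f t\<bar> \<partial>lebesgue" rule: ennreal_cases) auto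
  have pos: "(\<integral>\<^sup>+t\<in>{x..x+1}. ennreal \<bar>g t\<bar> \<partial>lebesgue) \<le> ennreal C" if "0 < x" for x
  proof -
    have "(\<integral>\<^sup>+t\<in>{x..x+1}. ennreal \<bar>g t\<bar> \<partial>lebesgue) = (\<integral>\<^sup>+t\<in>{x..x+1}. ennreal \<bar>f t\<bar> \<partial>lebesgue)"
      using that by (intro nn_integral_cong) (auto simp: g_def indicator_def)
    also have "\<dots> \<le> ennreal C" unfolding C[symmetric] using that by (intro SUP_upper) auto
    finally show ?thesis .
  qed
  \<comment> \<open>The hypothesis covers x > 0 only; Fatou's lemma along the windows {e n..e n + 1}
    adds the window at 0.\<close>
  have zero: "(\<integral>\<^sup>+t\<in>{0..1}. ennreal \<bar>g t\<bar> \<partial>lebesgue) \<le> ennreal C"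
  proof -
    define e where "e n = 1 / real (Suc n)" for n
    have e: "0 < e n" "e \<longlonglongrightarrow> 0" for n
      unfolding e_def by (simp, rule LIMSEQ_Suc[OF lim_1_over_n])
    have "(\<integral>\<^sup>+t\<in>{0..1}. ennreal \<bar>g t\<bar> \<partial>lebesgue) \<le>
       (\<integral>\<^sup>+t. liminf (\<lambda>n. ennreal \<bar>g t\<bar> * indicator {e n..e n + 1} t) \<partial>lebesgue)"
    proof (rule nn_integral_mono)
      fix t
      show "ennreal \<bar>g t\<bar> * indicator {0..1} t \<le> liminf (\<lambda>n. ennreal \<bar>g t\<bar> * indicator {e n..e n + 1} t)"
      proof (cases "0 < t \<and> t \<le> 1")
        case True
        have "\<forall>\<^sub>F n in sequentially. e n < t" using e(2) True by (intro order_tendstoD(2)) auto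
        hence "\<forall>\<^sub>F n in sequentially. ennreal \<bar>g t\<bar> \<le> ennreal \<bar>g t\<bar> * indicator {e n..e n + 1} t"
        proof eventually_elim
          case (elim n)
          hence "t \<in> {e n..e n + 1}" using True e(1)[of n] by simp
          thus ?case by simp
        qed
        hence "ennreal \<bar>g t\<bar> \<le> liminf (\<lambda>n. ennreal \<bar>g t\<bar> * indicator {e n..e n + 1} t)" by (rule Liminf_bounded)
        thus ?thesis by (auto simp: indicator_def)
      next
        case False
        hence z: "ennreal \<bar>g t\<bar> * indicator {0..1} t = 0" by (auto simp: g_def indicator_def)
        show ?thesis unfolding z by simp
      qed
    qed
    also have "\<dots> \<le> liminf (\<lambda>n. \<integral>\<^sup>+t\<in>{e n..e n + 1}. ennreal \<bar>g t\<bar> \<partial>lebesgue)"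
      by (rule nn_integral_liminf) auto
    also have "\<dots> \<le> limsup (\<lambda>n. \<integral>\<^sup>+t\<in>{e n..e n + 1}. ennreal \<bar>g t\<bar> \<partial>lebesgue)"
      by (rule Liminf_le_Limsup) simp
    also have "\<dots> \<le> ennreal C" by (rule Limsup_bounded) (use pos e(1) in auto)
    finally show ?thesis .
  qed
  have unit: "(\<integral>\<^sup>+t\<in>{x..x+1}. ennreal \<bar>g t\<bar> \<partial>lebesgue) \<le> ennreal C" if "0 \<le> x" for x
  proof (cases "x = 0")
    case True thus ?thesis using zero by simp
  next
    case False thus ?thesis using pos that by simp
  qed
  have upto: "(\<integral>\<^sup>+t\<in>{0..real n}. ennreal \<bar>g t\<bar> \<partial>lebesgue) \<le> ennreal (real n * C)" for n
  proof (induction n)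
    case 0
    have "(\<integral>\<^sup>+t\<in>{0..real 0}. ennreal \<bar>g t\<bar> \<partial>lebesgue) = (\<integral>\<^sup>+t. 0 \<partial>(lebesgue :: real measure))"
      by (intro nn_integral_cong) (auto simp: g_def indicator_def)
    thus ?case by simp
  next
    case (Suc n)
    have "(\<integral>\<^sup>+t\<in>{0..real (Suc n)}. ennreal \<bar>g t\<bar> \<partial>lebesgue) \<le>
       (\<integral>\<^sup>+t. ennreal \<bar>g t\<bar> * indicator {0..real n} t + ennreal \<bar>g t\<bar> * indicator {real n..real n + 1} t \<partial>lebesgue)"
      by (intro nn_integral_mono) (auto simp: indicator_def)
    also have "\<dots> = (\<integral>\<^sup>+t\<in>{0..real n}. ennreal \<bar>g t\<bar> \<partial>lebesgue) + (\<integral>\<^sup>+t\<in>{real n..real n + 1}. ennreal \<bar>g t\<bar> \<partial>lebesgue)"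
      by (rule nn_integral_add) auto
    also have "\<dots> \<le> ennreal (real n * C) + ennreal C" by (intro add_mono Suc unit) auto
    also have "\<dots> = ennreal (real (Suc n) * C)" using C0 by (simp add: algebra_simps flip: ennreal_plus)
    finally show ?case .
  qed
  show gi: "g absolutely_integrable_on {0..b}" for b
  proof -
    obtain n where n: "b \<le> real n" using real_arch_simple by blast
    have "g absolutely_integrable_on {0..real n}"
      unfolding set_integrable_def
    proof (rule integrableI_bounded)
      have "(\<integral>\<^sup>+t. ennreal (norm (indicator {0..real n} t *\<^sub>R g t)) \<partial>lebesgue) = (\<integral>\<^sup>+t\<in>{0..real n}. ennreal \<bar>g t\<bar> \<partial>lebesgue)"
        by (intro nn_integral_cong) (auto simp: indicator_def)
      also have "\<dots> < \<infinity>" by (rule le_less_trans[OF upto]) simp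
      finally show "(\<integral>\<^sup>+t. ennreal (norm (indicator {0..real n} t *\<^sub>R g t)) \<partial>lebesgue) < \<infinity>" .
    qed simp
    thus ?thesis by (rule absolutely_integrable_on_subinterval) (use n in auto)
  qed
  have "integral {x..x+1} (\<lambda>t. \<bar>g t\<bar>) \<le> C" if x: "0 \<le> x" for x
  proof -
    have gx: "g absolutely_integrable_on {x..x+1}"
      by (rule absolutely_integrable_on_subinterval[OF gi[of "x+1"]]) (use x in auto)
    hence gx': "(\<lambda>t. \<bar>g t\<bar>) absolutely_integrable_on {x..x+1}"
      using absolutely_integrable_norm[OF gx] by (simp add: comp_def)
    have "ennreal (LINT t:{x..x+1}|lebesgue. \<bar>g t\<bar>) = (\<integral>\<^sup>+t. ennreal (indicator {x..x+1} t *\<^sub>R \<bar>g t\<bar>) \<partial>lebesgue)"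
      unfolding set_lebesgue_integral_def
      by (rule nn_integral_eq_integral[symmetric]) (use gx' in \<open>auto simp: set_integrable_def\<close>)
    also have "\<dots> = (\<integral>\<^sup>+t\<in>{x..x+1}. ennreal \<bar>g t\<bar> \<partial>lebesgue)"
      by (intro nn_integral_cong) (auto simp: indicator_def)
    also have "\<dots> \<le> ennreal C" by (rule unit[OF x])
    finally have "(LINT t:{x..x+1}|lebesgue. \<bar>g t\<bar>) \<le> C" using C0 by simp
    thus ?thesis using set_lebesgue_integral_eq_integral(2)[OF gx'] by simp
  qed
  thus "\<exists>C. \<forall>x\<ge>0. integral {x..x+1} (\<lambda>t. \<bar>g t\<bar>) \<le> C" by blast
qed

text \<open>The locale \<open>sturm\<close> speaks of {0..b}, whereas the given coefficients are
  arbitrary at x <= 0; their values there are fixed once and for all.\<close>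

definition zero_ext :: "(real \<Rightarrow> real) \<Rightarrow> real \<Rightarrow> real" where
  "zero_ext f x = (if 0 < x then f x else 0)"

text \<open>The bound on \<sigma>^2 controls both \<sigma>, through |\<sigma>| <= 1 + \<sigma>^2,
  and the coefficient \<tau> - \<sigma>^2.\<close>

lemma sturm_unif_zero_ext:
  fixes \<sigma> \<tau> :: "real \<Rightarrow> real"
  assumes sm: "\<sigma> \<in> borel_measurable (lebesgue_on {0<..})" and tm: "\<tau> \<in> borel_measurable (lebesgue_on {0<..})"
    and s: "(SUP x\<in>{0<..}. \<integral>\<^sup>+t\<in>{x..x+1}. ennreal ((\<sigma> t)\<^sup>2) \<partial>lebesgue) < \<infinity>"
    and t: "(SUP x\<in>{0<..}. \<integral>\<^sup>+t\<in>{x..x+1}. ennreal \<bar>\<tau> t\<bar> \<partial>lebesgue) < \<infinity>"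
  shows "\<exists>K. sturm_unif (zero_ext \<sigma>) (zero_ext (\<lambda>x. \<tau> x - (\<sigma> x)\<^sup>2)) K"
proof -
  have s2m: "(\<lambda>x. (\<sigma> x)\<^sup>2) \<in> borel_measurable (lebesgue_on {0<..})" using sm by measurable
  have s': "(SUP x\<in>{0<..}. \<integral>\<^sup>+t\<in>{x..x+1}. ennreal \<bar>(\<sigma> t)\<^sup>2\<bar> \<partial>lebesgue) < \<infinity>" using s by simp
  note T = uniformly_locally_integrable[OF tm t, folded zero_ext_def[of \<tau>]]
  note S2 = uniformly_locally_integrable[OF s2m s', folded zero_ext_def[of "\<lambda>x. (\<sigma> x)\<^sup>2"]]
  have eT: "(\<lambda>t. if 0 < t then \<tau> t else 0) = zero_ext \<tau>" and eS: "(\<lambda>t. if 0 < t then (\<sigma> t)\<^sup>2 else 0) = zero_ext (\<lambda>x. (\<sigma> x)\<^sup>2)"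
    by (auto simp: zero_ext_def)
  obtain C1 where C1: "\<And>x. 0 \<le> x \<Longrightarrow> integral {x..x+1} (\<lambda>t. \<bar>zero_ext (\<lambda>x. (\<sigma> x)\<^sup>2) t\<bar>) \<le> C1"
    using S2(3) unfolding zero_ext_def by blast
  obtain C2 where C2: "\<And>x. 0 \<le> x \<Longrightarrow> integral {x..x+1} (\<lambda>t. \<bar>zero_ext \<tau> t\<bar>) \<le> C2"
    using T(3) unfolding zero_ext_def by blast
  have Ti: "zero_ext \<tau> absolutely_integrable_on {0..b}" and Si: "zero_ext (\<lambda>x. (\<sigma> x)\<^sup>2) absolutely_integrable_on {0..b}" for b
    using T(2)[of b] S2(2)[of b] unfolding eT eS by auto
  have qe: "zero_ext (\<lambda>x. \<tau> x - (\<sigma> x)\<^sup>2) = (\<lambda>x. zero_ext \<tau> x - zero_ext (\<lambda>x. (\<sigma> x)\<^sup>2) x)" by (auto simp: zero_ext_def)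
  have qi: "zero_ext (\<lambda>x. \<tau> x - (\<sigma> x)\<^sup>2) absolutely_integrable_on {0..b}" for b
    unfolding qe by (rule set_integral_diff(1)[OF Ti Si])
  have Tn: "(\<lambda>t. \<bar>zero_ext \<tau> t\<bar>) integrable_on {0..b}" and Sn: "(\<lambda>t. \<bar>zero_ext (\<lambda>x. (\<sigma> x)\<^sup>2) t\<bar>) integrable_on {0..b}" for b
    using absolutely_integrable_norm[OF Ti[of b]] absolutely_integrable_norm[OF Si[of b]]
    by (auto simp: comp_def dest: set_lebesgue_integral_eq_integral(1))
  have sub: "f integrable_on {x..y}" if "f integrable_on {0..y}" "0 \<le> x" for f :: "real \<Rightarrow> real" and x y
    by (rule integrable_subinterval_real[OF that(1)]) (use that(2) in auto)
  have le: "\<bar>zero_ext \<sigma> t\<bar> \<le> 1 + \<bar>zero_ext (\<lambda>x. (\<sigma> x)\<^sup>2) t\<bar>" for t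
  proof -
    have "2 * \<bar>\<sigma> t\<bar> \<le> 1 + (\<sigma> t)\<^sup>2" using sum_squares_bound[of 1 "\<bar>\<sigma> t\<bar>"] by simp
    moreover have "0 \<le> \<bar>\<sigma> t\<bar>" by simp
    ultimately have "\<bar>\<sigma> t\<bar> \<le> 1 + (\<sigma> t)\<^sup>2" by linarith
    thus ?thesis by (simp add: zero_ext_def)
  qed
  have em: "zero_ext \<sigma> \<in> borel_measurable lebesgue"
  proof -
    have "(\<lambda>x. if x \<in> {0<..} then \<sigma> x else 0) \<in> borel_measurable lebesgue"
      using sm by (subst borel_measurable_if) auto
    thus ?thesis by (simp add: zero_ext_def[abs_def])
  qed
  have si: "zero_ext \<sigma> absolutely_integrable_on {0..b}" for b
  proof (rule measurable_bounded_by_integrable_imp_absolutely_integrable)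
    show "zero_ext \<sigma> \<in> borel_measurable (lebesgue_on {0..b})" using em by (rule measurable_restrict_space1)
    show "(\<lambda>t. 1 + \<bar>zero_ext (\<lambda>x. (\<sigma> x)\<^sup>2) t\<bar>) integrable_on {0..b}"
      by (intro integrable_add integrable_const_ivl Sn)
  qed (use le in auto)
  have sn: "(\<lambda>t. \<bar>zero_ext \<sigma> t\<bar>) integrable_on {0..b}" and qn: "(\<lambda>t. \<bar>zero_ext (\<lambda>x. \<tau> x - (\<sigma> x)\<^sup>2) t\<bar>) integrable_on {0..b}" for b
    using absolutely_integrable_norm[OF si[of b]] absolutely_integrable_norm[OF qi[of b]]
    by (auto simp: comp_def dest: set_lebesgue_integral_eq_integral(1))
  have sb: "integral {x..x+1} (\<lambda>t. \<bar>zero_ext \<sigma> t\<bar>) \<le> 1 + \<bar>C1\<bar> + \<bar>C2\<bar>" if x: "0 \<le> x" for x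
  proof -
    have i: "(\<lambda>t. 1 + \<bar>zero_ext (\<lambda>x. (\<sigma> x)\<^sup>2) t\<bar>) integrable_on {x..x+1}"
      by (rule integrable_add[OF integrable_const_ivl sub[OF Sn x]])
    have "integral {x..x+1} (\<lambda>t. \<bar>zero_ext \<sigma> t\<bar>) \<le> integral {x..x+1} (\<lambda>t. 1 + \<bar>zero_ext (\<lambda>x. (\<sigma> x)\<^sup>2) t\<bar>)"
      by (rule integral_le[OF sub[OF sn x] i le])
    also have "\<dots> = 1 + integral {x..x+1} (\<lambda>t. \<bar>zero_ext (\<lambda>x. (\<sigma> x)\<^sup>2) t\<bar>)"
      by (subst Henstock_Kurzweil_Integration.integral_add[OF integrable_const_ivl sub[OF Sn x]]) simp
    finally show ?thesis using C1[OF x] by linarith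
  qed
  have qb: "integral {x..x+1} (\<lambda>t. \<bar>zero_ext (\<lambda>x. \<tau> x - (\<sigma> x)\<^sup>2) t\<bar>) \<le> 1 + \<bar>C1\<bar> + \<bar>C2\<bar>" if x: "0 \<le> x" for x
  proof -
    have l: "\<bar>zero_ext (\<lambda>x. \<tau> x - (\<sigma> x)\<^sup>2) t\<bar> \<le> \<bar>zero_ext \<tau> t\<bar> + \<bar>zero_ext (\<lambda>x. (\<sigma> x)\<^sup>2) t\<bar>" for t
      unfolding qe by (rule abs_triangle_ineq4)
    have "integral {x..x+1} (\<lambda>t. \<bar>zero_ext (\<lambda>x. \<tau> x - (\<sigma> x)\<^sup>2) t\<bar>) \<le> integral {x..x+1} (\<lambda>t. \<bar>zero_ext \<tau> t\<bar> + \<bar>zero_ext (\<lambda>x. (\<sigma> x)\<^sup>2) t\<bar>)"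
      by (rule integral_le[OF sub[OF qn x] integrable_add[OF sub[OF Tn x] sub[OF Sn x]] l])
    also have "\<dots> = integral {x..x+1} (\<lambda>t. \<bar>zero_ext \<tau> t\<bar>) + integral {x..x+1} (\<lambda>t. \<bar>zero_ext (\<lambda>x. (\<sigma> x)\<^sup>2) t\<bar>)"
      by (rule Henstock_Kurzweil_Integration.integral_add[OF sub[OF Tn x] sub[OF Sn x]])
    finally show ?thesis using C1[OF x] C2[OF x] by linarith
  qed
  have "sturm_unif (zero_ext \<sigma>) (zero_ext (\<lambda>x. \<tau> x - (\<sigma> x)\<^sup>2)) (1 + \<bar>C1\<bar> + \<bar>C2\<bar>)"
    by unfold_locales (fact si qi sb qb)+
  thus ?thesis by blast
qed

section \<open>Transfer matrices, quasi-derivatives and the Weyl function in terms of solution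
  pairs\<close>

lemma AE_halfline:
  "(AE x in lebesgue_on {0<..}. P x) \<longleftrightarrow> (\<exists>N. negligible N \<and> (\<forall>x. 0 < x \<longrightarrow> x \<notin> N \<longrightarrow> P (x::real)))"
proof -
  have "(AE x in lebesgue_on {0<..}. P x) \<longleftrightarrow> (AE x in lebesgue. x \<in> {0<..} \<longrightarrow> P x)"
    by (rule AE_restrict_space_iff) simp
  also have "\<dots> \<longleftrightarrow> (\<exists>N. negligible N \<and> (\<forall>x. 0 < x \<longrightarrow> x \<notin> N \<longrightarrow> P x))"
    unfolding eventually_ae_filter negligible_iff_null_sets by (auto simp: subset_iff)
  finally show ?thesis .
qed

lemma ac_deriv_halfline:
  assumes "\<And>b. ac_deriv 0 b u f"
  shows "AC_loc {0..} u" "AC_loc {0<..} u" "AE x in lebesgue_on {0<..}. (u has_vector_derivative f x) (at x)"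
proof -
  have ac: "abs_cont_on {a..b} u" if "{a..b} \<subseteq> {0..}" for a b
  proof (rule abs_cont_on_subset)
    show "abs_cont_on {0..b} u" using assms[of b] by (simp add: ac_deriv_def)
    show "{a..b} \<subseteq> {0..b}" using that by auto
  qed
  show "AC_loc {0..} u" unfolding AC_loc_def using ac by blast
  show "AC_loc {0<..} u" unfolding AC_loc_def
  proof (intro allI impI)
    fix a b :: real assume "{a..b} \<subseteq> {0<..}"
    thus "abs_cont_on {a..b} u" by (intro ac) auto
  qed
  have "\<forall>n. \<exists>N. negligible N \<and> (\<forall>x\<in>{0<..<real n} - N. (u has_vector_derivative f x) (at x))"
    using assms by (simp add: ac_deriv_def)
  then obtain N where N: "\<And>n. negligible (N n)" "\<And>n x. x \<in> {0<..<real n} - N n \<Longrightarrow> (u has_vector_derivative f x) (at x)"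
    by metis
  show "AE x in lebesgue_on {0<..}. (u has_vector_derivative f x) (at x)"
    unfolding AE_halfline
  proof (intro exI[of _ "\<Union>(range N)"] conjI allI impI)
    show "negligible (\<Union>(range N))" by (rule negligible_Union_nat) (rule N(1))
    fix x :: real assume x: "0 < x" "x \<notin> \<Union>(range N)"
    obtain n where "x < real n" using reals_Archimedean2 by blast
    thus "(u has_vector_derivative f x) (at x)" using N(2)[of x n] x by auto
  qed
qed

lemma halfline_ac_deriv:
  assumes ac: "AC_loc S u" and S: "{a..b} \<subseteq> S" and a: "0 \<le> a"
    and d: "AE x in lebesgue_on {0<..}. (u has_vector_derivative f x) (at x)"
  shows "ac_deriv a b u f"
proof -
  obtain N where N: "negligible N" "\<And>x. 0 < x \<Longrightarrow> x \<notin> N \<Longrightarrow> (u has_vector_derivative f x) (at x)"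
    using d unfolding AE_halfline by blast
  have "\<forall>x\<in>{a<..<b} - N. (u has_vector_derivative f x) (at x)" using N(2) a by auto
  thus ?thesis unfolding ac_deriv_def using N(1) ac S unfolding AC_loc_def by blast
qed

text \<open>Being linear in the entry, it builds a matrix function as a sum of linear images of
  scalar ones, to which \<open>ac_deriv_add\<close> and \<open>ac_deriv_linear\<close>
  apply.\<close>

definition unit_entry :: "2 \<Rightarrow> 2 \<Rightarrow> complex \<Rightarrow> complex^2^2" where
  "unit_entry i j c = (\<chi> k l. if k = i \<and> l = j then c else 0)"

lemma bounded_linear_unit_entry: "bounded_linear (unit_entry i j)"
  unfolding linear_conv_bounded_linear[symmetric]
  by (rule linearI) (auto simp: unit_entry_def vec_eq_iff)

lemma bounded_linear_entry: "bounded_linear (\<lambda>A :: complex^2^2. A $ i $ j)"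
  using bounded_linear_compose[OF bounded_linear_vec_nth bounded_linear_vec_nth] .

lemma norm_vector_2: "(norm (vector [a, b] :: complex^2))\<^sup>2 = (cmod a)\<^sup>2 + (cmod b)\<^sup>2"
  by (simp add: norm_vec_def L2_set_def sum_2)

lemma norm_matrix_vector_le: "norm (A *v v) \<le> mat_norm A * norm v" for A :: "complex^2^2"
proof -
  have "linear (\<lambda>v. A *v v)"
  proof (rule linearI)
    show "A *v (v + w) = A *v v + A *v w" for v w by (rule matrix_vector_right_distrib)
    show "A *v (c *\<^sub>R v) = c *\<^sub>R (A *v v)" for c v
      by (simp add: vec_eq_iff matrix_vector_mult_def scaleR_right.sum)
  qed
  hence "bounded_linear (\<lambda>v. A *v v)" by (simp add: linear_conv_bounded_linear)
  thus ?thesis unfolding mat_norm_def by (rule onorm)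
qed

locale sturm_pair = sturm_unif "zero_ext \<sigma>" "zero_ext (\<lambda>x. \<tau> x - (\<sigma> x)\<^sup>2)" K
  for \<sigma> \<tau> :: "real \<Rightarrow> real" and K :: real
begin

text \<open>For a >= 0 the open interval contains only positive points, where the extension by 0
  changes nothing.\<close>

lemma is_sol_iff_on_positive:
  assumes "0 \<le> a"
  shows "is_sol z a b V U \<longleftrightarrow>
     ac_deriv a b V (\<lambda>x. - of_real (\<sigma> x) * V x + (of_real (\<tau> x - (\<sigma> x)\<^sup>2) - z) * U x) \<and>
     ac_deriv a b U (\<lambda>x. V x + of_real (\<sigma> x) * U x)"
proof -
  have c: "ac_deriv a b u f \<longleftrightarrow> ac_deriv a b u g" if "\<And>x. 0 < x \<Longrightarrow> f x = g x" for u f g :: "real \<Rightarrow> complex"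
    by (rule iffI; erule ac_deriv_cong) (use that assms in auto)
  show ?thesis unfolding is_sol_def
    by (rule conj_cong; rule c) (simp_all add: zero_ext_def)
qed

definition sol_matrix :: "complex \<Rightarrow> real \<Rightarrow> complex^2^2" where
  "sol_matrix z x = unit_entry 1 1 (solV z 1 0 x) + unit_entry 1 2 (solV z 0 1 x) +
     (unit_entry 2 1 (solU z 1 0 x) + unit_entry 2 2 (solU z 0 1 x))"

lemma sol_matrix_transfer:
  "AC_loc {0..} (sol_matrix z)" "sol_matrix z 0 = mat 1"
  "AE x in lebesgue_on {0<..}. (sol_matrix z has_vector_derivative (coeff_matrix \<sigma> \<tau> z x ** sol_matrix z x)) (at x)"
proof -
  have "ac_deriv 0 b (sol_matrix z) (\<lambda>x. coeff_matrix \<sigma> \<tau> z x ** sol_matrix z x)" for b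
  proof -
    note sols = sol_props(3)[of z b 1 0, unfolded is_sol_iff_on_positive[OF order_refl]]
      sol_props(3)[of z b 0 1, unfolded is_sol_iff_on_positive[OF order_refl]]
    show ?thesis unfolding sol_matrix_def[abs_def]
    proof (rule ac_deriv_cong)
      show "ac_deriv 0 b (\<lambda>x. unit_entry 1 1 (solV z 1 0 x) + unit_entry 1 2 (solV z 0 1 x) +
           (unit_entry 2 1 (solU z 1 0 x) + unit_entry 2 2 (solU z 0 1 x)))
         (\<lambda>x. unit_entry 1 1 (- of_real (\<sigma> x) * solV z 1 0 x + (of_real (\<tau> x - (\<sigma> x)\<^sup>2) - z) * solU z 1 0 x)
            + unit_entry 1 2 (- of_real (\<sigma> x) * solV z 0 1 x + (of_real (\<tau> x - (\<sigma> x)\<^sup>2) - z) * solU z 0 1 x)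
            + (unit_entry 2 1 (solV z 1 0 x + of_real (\<sigma> x) * solU z 1 0 x)
            + unit_entry 2 2 (solV z 0 1 x + of_real (\<sigma> x) * solU z 0 1 x)))"
        using sols by (intro ac_deriv_add ac_deriv_linear[OF bounded_linear_unit_entry]) auto
    qed (simp_all add: vec_eq_iff forall_2 unit_entry_def coeff_matrix_def matrix_matrix_mult_def sum_2)
  qed
  from ac_deriv_halfline[OF this] show "AC_loc {0..} (sol_matrix z)"
    "AE x in lebesgue_on {0<..}. (sol_matrix z has_vector_derivative (coeff_matrix \<sigma> \<tau> z x ** sol_matrix z x)) (at x)" by auto
  show "sol_matrix z 0 = mat 1"
    by (simp add: sol_matrix_def vec_eq_iff forall_2 unit_entry_def mat_def sol_props(1,2))
qed

text \<open>\<open>sol_matrix\<close> shows that the choice in \<open>transfer_matrix\<close> is not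
  void. The columns of the chosen matrix solve the system and are identified by uniqueness.\<close>

lemma transfer_matrix_mult:
  assumes x: "0 \<le> x"
  shows "transfer_matrix \<sigma> \<tau> z x *v vector [v0, u0] = vector [solV z v0 u0 x, solU z v0 u0 x]"
proof -
  define T where "T = transfer_matrix \<sigma> \<tau> z"
  have "\<exists>T. AC_loc {0..} T \<and> T 0 = mat 1 \<and>
     (AE x in lebesgue_on {0<..}. (T has_vector_derivative (coeff_matrix \<sigma> \<tau> z x ** T x)) (at x))"
    using sol_matrix_transfer[of z] by blast
  from someI_ex[OF this] have T: "AC_loc {0..} T" "T 0 = mat 1"
    "AE x in lebesgue_on {0<..}. (T has_vector_derivative (coeff_matrix \<sigma> \<tau> z x ** T x)) (at x)"
    unfolding T_def transfer_matrix_def by blast+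
  have ac: "ac_deriv 0 x T (\<lambda>x. coeff_matrix \<sigma> \<tau> z x ** T x)"
    by (rule halfline_ac_deriv[OF T(1) _ _ T(3)]) auto
  have col: "is_sol z 0 x (\<lambda>x. T x $ 1 $ j) (\<lambda>x. T x $ 2 $ j)" for j
    unfolding is_sol_iff_on_positive[OF order_refl]
    using ac_deriv_linear[OF bounded_linear_entry[of 1 j] ac] ac_deriv_linear[OF bounded_linear_entry[of 2 j] ac]
    by (simp add: coeff_matrix_def matrix_matrix_mult_def sum_2)
  have "v0 * T x $ 1 $ 1 + u0 * T x $ 1 $ 2 = solV z v0 u0 x \<and> v0 * T x $ 2 $ 1 + u0 * T x $ 2 $ 2 = solU z v0 u0 x"
    by (rule is_sol_unique[OF is_sol_combine[OF col[of 1] col[of 2], of v0 u0] sol_props(3), of 0])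
      (use x T(2) in \<open>auto simp: mat_def sol_props(1,2)\<close>)
  thus ?thesis unfolding T_def[symmetric]
    by (simp add: vec_eq_iff forall_2 matrix_vector_mult_def sum_2 mult.commute)
qed

text \<open>The pair for theta at \<open>L\<close> is the image of its data at 0, the unit vector
  (sin \<alpha>, cos \<alpha>).\<close>

lemma Im_mL_le_transfer_matrix:
  assumes L: "0 \<le> L"
  shows "Im (mL \<alpha> L (of_real E)) \<le> (mat_norm (transfer_matrix \<sigma> \<tau> (of_real E) L))\<^sup>2"
proof -
  let ?z = "complex_of_real E" and ?v = "vector [of_real (sin \<alpha>), of_real (cos \<alpha>)] :: complex^2"
  have "(norm ?v)\<^sup>2 = 1" unfolding norm_vector_2 by simp
  hence v: "norm ?v = 1" by (metis norm_ge_zero one_power2 power2_eq_iff_nonneg zero_le_one)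
  have "Im (mL \<alpha> L ?z) \<le> (cmod (thV \<alpha> ?z L))\<^sup>2 + (cmod (thU \<alpha> ?z L))\<^sup>2" by (rule Im_mL_real_le[OF L])
  also have "\<dots> = (norm (transfer_matrix \<sigma> \<tau> ?z L *v ?v))\<^sup>2"
    unfolding transfer_matrix_mult[OF L] norm_vector_2 ..
  also have "\<dots> \<le> (mat_norm (transfer_matrix \<sigma> \<tau> ?z L))\<^sup>2"
    using norm_matrix_vector_le[of "transfer_matrix \<sigma> \<tau> ?z L" ?v] v by (intro power_mono) auto
  finally show ?thesis .
qed

end

text \<open>Two candidates agree almost everywhere and are continuous; if they differed at a point,
  they would differ on a nonempty open set, which is not negligible.\<close>

lemma has_quasi_deriv_unique:
  assumes v: "has_quasi_deriv \<sigma> u v" and w: "has_quasi_deriv \<sigma> u w" and x: "0 < x"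
  shows "v x = w x"
proof (rule ccontr)
  assume ne: "v x \<noteq> w x"
  obtain N where N: "negligible N" "\<And>x. 0 < x \<Longrightarrow> x \<notin> N \<Longrightarrow> \<exists>d. (u has_vector_derivative d) (at x) \<and> v x = d - \<sigma> x * u x"
    using v unfolding has_quasi_deriv_def AE_halfline by blast
  obtain M where M: "negligible M" "\<And>x. 0 < x \<Longrightarrow> x \<notin> M \<Longrightarrow> \<exists>d. (u has_vector_derivative d) (at x) \<and> w x = d - \<sigma> x * u x"
    using w unfolding has_quasi_deriv_def AE_halfline by blast
  have eq: "v y = w y" if y: "0 < y" "y \<notin> N \<union> M" for y
  proof -
    obtain d where d: "(u has_vector_derivative d) (at y)" "v y = d - \<sigma> y * u y" using N(2)[of y] y by blast
    obtain d' where d': "(u has_vector_derivative d') (at y)" "w y = d' - \<sigma> y * u y" using M(2)[of y] y by blast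
    have "d = d'" by (rule vector_derivative_unique_at[OF d(1) d'(1)])
    thus ?thesis using d d' by simp
  qed
  have "{x/2..2*x} \<subseteq> {0<..}" using x by auto
  hence "abs_cont_on {x/2..2*x} v" "abs_cont_on {x/2..2*x} w"
    using v w unfolding has_quasi_deriv_def AC_loc_def by blast+
  hence c: "continuous_on {x/2..2*x} v" "continuous_on {x/2..2*x} w" by (auto intro: abs_cont_on_imp_continuous_on)
  have io: "{x/2<..<2*x} \<subseteq> {x/2..2*x}" by auto
  have "continuous_on {x/2<..<2*x} (\<lambda>y. v y - w y)"
    by (rule continuous_on_diff[OF continuous_on_subset[OF c(1) io] continuous_on_subset[OF c(2) io]])
  from continuous_open_preimage[OF this, of "- {0}"]
  have "open ({x/2<..<2*x} \<inter> (\<lambda>y. v y - w y) -` (- {0}))" by auto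
  moreover have "x \<in> {x/2<..<2*x} \<inter> (\<lambda>y. v y - w y) -` (- {0})" using ne x by auto
  ultimately have "\<not> negligible ({x/2<..<2*x} \<inter> (\<lambda>y. v y - w y) -` (- {0}))"
    using open_not_negligible by blast
  moreover have sub: "{x/2<..<2*x} \<inter> (\<lambda>y. v y - w y) -` (- {0}) \<subseteq> N \<union> M"
  proof
    fix y assume y: "y \<in> {x/2<..<2*x} \<inter> (\<lambda>y. v y - w y) -` (- {0})"
    hence "0 < y" using x by auto
    moreover have "v y \<noteq> w y" using y by simp
    ultimately show "y \<in> N \<union> M" using eq by metis
  qed
  hence "negligible ({x/2<..<2*x} \<inter> (\<lambda>y. v y - w y) -` (- {0}))"
    by (rule negligible_subset[OF negligible_Un[OF N(1) M(1)]])
  ultimately show False by contradiction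
qed

lemma has_quasi_deriv_quasi_deriv:
  assumes "u \<in> \<DD> \<sigma>" shows "has_quasi_deriv \<sigma> u (quasi_deriv \<sigma> u)"
  using assms unfolding \<DD>_def quasi_deriv_def mem_Collect_eq by (rule someI_ex)

context sturm_pair
begin

lemma is_sol_has_ell:
  assumes sol: "\<And>b. is_sol z 0 b V U"
  shows "has_ell \<sigma> \<tau> U (\<lambda>x. z * U x)"
proof -
  note s = sol[unfolded is_sol_iff_on_positive[OF order_refl]]
  note V = ac_deriv_halfline[OF conjunct1[OF s]] and U = ac_deriv_halfline[OF conjunct2[OF s]]
  have q: "has_quasi_deriv \<sigma> U V"
    unfolding has_quasi_deriv_def
  proof (intro conjI U(2) V(2))
    show "AE x in lebesgue_on {0<..}. \<exists>d. (U has_vector_derivative d) (at x) \<and> V x = d - \<sigma> x * U x"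
      using U(3) by eventually_elim auto
  qed
  hence D: "U \<in> \<DD> \<sigma>" unfolding \<DD>_def by blast
  have eq: "quasi_deriv \<sigma> U x = V x" if "0 < x" for x
    by (rule has_quasi_deriv_unique[OF has_quasi_deriv_quasi_deriv[OF D] q that])
  obtain N where N: "negligible N" "\<And>x. 0 < x \<Longrightarrow> x \<notin> N \<Longrightarrow>
      (V has_vector_derivative - of_real (\<sigma> x) * V x + (of_real (\<tau> x - (\<sigma> x)\<^sup>2) - z) * U x) (at x)"
    using V(3) unfolding AE_halfline by blast
  have "AE x in lebesgue_on {0<..}. \<exists>d. (quasi_deriv \<sigma> U has_vector_derivative d) (at x) \<and>
            z * U x = - d - \<sigma> x * quasi_deriv \<sigma> U x + (of_real (\<tau> x) - (of_real (\<sigma> x))\<^sup>2) * U x"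
    unfolding AE_halfline
  proof (intro exI[of _ N] conjI N(1) allI impI)
    fix x :: real assume x: "0 < x" "x \<notin> N"
    have r: "c = - (- a + (b - c)) - a + b" for a b c :: complex by simp
    show "\<exists>d. (quasi_deriv \<sigma> U has_vector_derivative d) (at x) \<and>
            z * U x = - d - \<sigma> x * quasi_deriv \<sigma> U x + (of_real (\<tau> x) - (of_real (\<sigma> x))\<^sup>2) * U x"
    proof (intro exI conjI)
      show "(quasi_deriv \<sigma> U has_vector_derivative - of_real (\<sigma> x) * V x + (of_real (\<tau> x - (\<sigma> x)\<^sup>2) - z) * U x) (at x)"
        by (rule has_vector_derivative_transform_within_open[OF N(2)[OF x], of "{0<..}"]) (use x eq in auto)
      show "z * U x = - (- of_real (\<sigma> x) * V x + (of_real (\<tau> x - (\<sigma> x)\<^sup>2) - z) * U x)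
          - \<sigma> x * quasi_deriv \<sigma> U x + (of_real (\<tau> x) - (of_real (\<sigma> x))\<^sup>2) * U x"
        unfolding of_real_diff of_real_power left_diff_distrib[of _ z] mult_minus_left eq[OF x(1)] by (rule r)
    qed
  qed
  thus ?thesis unfolding has_ell_def using D by blast
qed

text \<open>This is regularity at 0. The differential expression sees only x > 0, so the given
  solution is matched at x = 1 with one that starts at 0, and uniqueness identifies the two on all x
  > 0. The limits at 0 then exist by continuity of the latter.\<close>

lemma has_ell_is_sol:
  assumes ell: "has_ell \<sigma> \<tau> u (\<lambda>x. z * u x)"
  shows "\<exists>V U. (\<forall>b. is_sol z 0 b V U) \<and> (\<forall>x>0. u x = U x \<and> quasi_deriv \<sigma> u x = V x)"
proof -
  define v where "v = quasi_deriv \<sigma> u"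
  have q: "has_quasi_deriv \<sigma> u v" using ell unfolding has_ell_def v_def by (blast intro: has_quasi_deriv_quasi_deriv)
  have u': "AE x in lebesgue_on {0<..}. (u has_vector_derivative v x + of_real (\<sigma> x) * u x) (at x)"
    using conjunct2[OF conjunct2[OF q[unfolded has_quasi_deriv_def]]] 
  proof eventually_elim
    case (elim x)
    then obtain d where d: "(u has_vector_derivative d) (at x)" "v x = d - \<sigma> x * u x" by blast
    hence "d = v x + of_real (\<sigma> x) * u x" by simp
    thus ?case using d(1) by simp
  qed
  have v': "AE x in lebesgue_on {0<..}. (v has_vector_derivative - of_real (\<sigma> x) * v x + (of_real (\<tau> x - (\<sigma> x)\<^sup>2) - z) * u x) (at x)"
    using conjunct2[OF ell[unfolded has_ell_def]] unfolding v_def[symmetric]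
  proof eventually_elim
    case (elim x)
    then obtain d where d: "(v has_vector_derivative d) (at x)" "z * u x = - d - \<sigma> x * v x + (of_real (\<tau> x) - (of_real (\<sigma> x))\<^sup>2) * u x"
      by (elim exE conjE)
    have r: "c = - d - a + b \<Longrightarrow> d = - a + (b - c)" for a b c d :: complex by simp
    have "d = - of_real (\<sigma> x) * v x + (of_real (\<tau> x - (\<sigma> x)\<^sup>2) - z) * u x"
      unfolding of_real_diff of_real_power left_diff_distrib[of _ z] mult_minus_left by (rule r[OF d(2)])
    thus ?case using d(1) by simp
  qed
  have sol: "is_sol z a b v u" if a: "0 < a" for a b
  proof -
    have ac: "AC_loc {0<..} u" "AC_loc {0<..} v" using q unfolding has_quasi_deriv_def by blast+
    have S: "{a..b} \<subseteq> {0<..}" using a by auto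
    show ?thesis unfolding is_sol_iff_on_positive[OF less_imp_le[OF a]]
      using halfline_ac_deriv[OF ac(2) S less_imp_le[OF a] v'] halfline_ac_deriv[OF ac(1) S less_imp_le[OF a] u'] by (rule conjI)
  qed
  \<comment> \<open>Cramer's rule for the data at 0 that produce the prescribed data at 1; the
    determinant is the Wronskian 1.\<close>
  define V0 where "V0 = v 1 * solU z 0 1 1 - u 1 * solV z 0 1 1"
  define U0 where "U0 = u 1 * solV z 1 0 1 - v 1 * solU z 1 0 1"
  define V where "V x = V0 * solV z 1 0 x + U0 * solV z 0 1 x" for x
  define U where "U x = V0 * solU z 1 0 x + U0 * solU z 0 1 x" for x
  have VU: "is_sol z 0 b V U" for b
    unfolding V_def U_def by (rule is_sol_combine[OF sol_props(3) sol_props(3)])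
  have W: "solV z 1 0 1 * solU z 0 1 1 - solU z 1 0 1 * solV z 0 1 1 = 1"
    using wronskian_const[OF sol_props(3)[of z 1 1 0] sol_props(3)[of z 1 0 1]] by (simp add: sol_props(1,2))
  have "V 1 = v 1 * (solV z 1 0 1 * solU z 0 1 1 - solU z 1 0 1 * solV z 0 1 1)"
    unfolding V_def V0_def U0_def by (simp add: algebra_simps)
  hence V1: "V 1 = v 1" by (simp add: W)
  have "U 1 = u 1 * (solV z 1 0 1 * solU z 0 1 1 - solU z 1 0 1 * solV z 0 1 1)"
    unfolding U_def V0_def U0_def by (simp add: algebra_simps)
  hence U1: "U 1 = u 1" by (simp add: W)
  have "u x = U x \<and> v x = V x" if x: "0 < x" for x
  proof -
    have a: "0 < min x 1" using x by simp
    have "v x = V x \<and> u x = U x"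
      by (rule is_sol_unique[OF sol[OF a, of "max x 1"] is_sol_subinterval[OF VU[of "max x 1"]], of 1])
        (use x V1 U1 in auto)
    thus ?thesis by simp
  qed
  thus ?thesis using VU unfolding v_def by blast
qed

lemma val0_eq:
  assumes c: "continuous_on {0..1} U" and eq: "\<And>x. 0 < x \<Longrightarrow> u x = U x"
  shows "val0 u = U 0"
proof -
  have "(U \<longlongrightarrow> U 0) (at 0 within {0..1})" using c by (simp add: continuous_on_def)
  hence "(U \<longlongrightarrow> U 0) (at_right 0)" by (simp add: at_within_Icc_at_right)
  hence "(u \<longlongrightarrow> U 0) (at_right 0)"
    by (rule Lim_transform_eventually) (use eq in \<open>auto simp: eventually_at_filter\<close>)
  thus ?thesis unfolding val0_def by (rule tendsto_Lim[rotated]) simp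
qed

lemma L2_halfline_bound:
  assumes u: "L2_halfline u" and c: "\<And>b. continuous_on {0..b} U" and eq: "\<And>x. 0 < x \<Longrightarrow> u x = U x" and b: "0 \<le> b"
  shows "integral {0..b} (\<lambda>x. (cmod (U x))\<^sup>2) \<le> integral {0<..} (\<lambda>x. (cmod (u x))\<^sup>2)"
proof -
  have "(\<lambda>x. (cmod (u x))\<^sup>2) absolutely_integrable_on {0<..}"
    using u unfolding L2_halfline_def set_integrable_def by (subst (asm) integrable_restrict_space) auto
  hence i: "(\<lambda>x. (cmod (u x))\<^sup>2) integrable_on {0<..}" by (rule set_lebesgue_integral_eq_integral(1))
  have j: "(\<lambda>x. (cmod (U x))\<^sup>2) integrable_on {0..b}" by (rule sq_integrable[OF c])
  have n0: "negligible T" if "T \<subseteq> {0}" for T :: "real set"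
    by (rule negligible_subset[OF negligible_sing that])
  have e: "integral {0..b} (\<lambda>x. (cmod (U x))\<^sup>2) = integral {0<..b} (\<lambda>x. (cmod (u x))\<^sup>2)"
  proof -
    have "integral {0..b} (\<lambda>x. (cmod (U x))\<^sup>2) = integral {0<..b} (\<lambda>x. (cmod (U x))\<^sup>2)"
      by (rule integral_subset_negligible[symmetric]) (auto intro!: n0)
    also have "\<dots> = integral {0<..b} (\<lambda>x. (cmod (u x))\<^sup>2)" by (rule integral_cong) (simp add: eq)
    finally show ?thesis .
  qed
  have j2: "(\<lambda>x. (cmod (u x))\<^sup>2) integrable_on {0<..b}"
  proof -
    have "(\<lambda>x. (cmod (U x))\<^sup>2) integrable_on {0<..b}"
      by (rule integrable_spike_set[OF j]; rule n0) auto
    thus ?thesis by (rule integrable_eq) (simp add: eq)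
  qed
  show ?thesis unfolding e by (rule integral_subset_le[OF _ j2 i]) auto
qed

lemma L2_halflineI:
  assumes c: "\<And>b. continuous_on {0..b} U" and B: "\<And>b. 0 \<le> b \<Longrightarrow> integral {0..b} (\<lambda>x. (cmod (U x))\<^sup>2) \<le> B"
  shows "L2_halfline U"
proof -
  have c0: "continuous_on {0<..} U"
  proof (rule continuous_at_imp_continuous_on, intro ballI)
    fix x :: real assume x: "x \<in> {0<..}"
    have "continuous_on {0<..<x+1} U" by (rule continuous_on_subset[OF c[of "x+1"]]) auto
    thus "isCont U x" using x by (simp add: continuous_on_eq_continuous_at)
  qed
  have m: "U \<in> borel_measurable (lebesgue_on {0<..})"
    by (rule continuous_imp_measurable_on_sets_lebesgue[OF c0]) simp
  have j: "(\<lambda>x. (cmod (U x))\<^sup>2) integrable_on {0..b}" for b by (rule sq_integrable[OF c])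
  define f where "f k x = (if x \<in> {0..real k} then (cmod (U x))\<^sup>2 else 0)" for k x
  have fi: "(f k has_integral integral {0..real k} (\<lambda>x. (cmod (U x))\<^sup>2)) {0..}" for k
    unfolding f_def using has_integral_on_superset[OF _ _ ] j[of "real k"]
    by (subst has_integral_restrict) (auto intro: integrable_integral)
  have "(\<lambda>x. (cmod (U x))\<^sup>2) integrable_on {0..}"
  proof (rule monotone_convergence_increasing[THEN conjunct1])
    show "f k integrable_on {0..}" for k using fi by blast
    show "f k x \<le> f (Suc k) x" for k x by (auto simp: f_def)
    show "(\<lambda>k. f k x) \<longlonglongrightarrow> (cmod (U x))\<^sup>2" if "x \<in> {0..}" for x
    proof (rule tendsto_eventually)
      obtain n where "x \<le> real n" using real_arch_simple by blast
      thus "\<forall>\<^sub>F k in sequentially. f k x = (cmod (U x))\<^sup>2"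
        unfolding eventually_sequentially using that by (intro exI[of _ n]) (auto simp: f_def)
    qed
    have "\<bar>integral {0..} (f k)\<bar> \<le> B" for k
      using integral_unique[OF fi[of k]] B[of "real k"] sq_integral_nonneg[of "{0..real k}" U] by simp
    thus "bounded (range (\<lambda>k. integral {0..} (f k)))" unfolding bounded_iff by auto
  qed
  hence "(\<lambda>x. (cmod (U x))\<^sup>2) integrable_on {0<..}"
    by (rule integrable_spike_set; intro negligible_subset[OF negligible_sing[of "0::real"]]) auto
  hence "(\<lambda>x. (cmod (U x))\<^sup>2) absolutely_integrable_on {0<..}"
    by (rule nonnegative_absolutely_integrable_1) simp
  hence "integrable (lebesgue_on {0<..}) (\<lambda>x. (cmod (U x))\<^sup>2)"
    unfolding set_integrable_def by (subst integrable_restrict_space) auto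
  thus ?thesis unfolding L2_halfline_def using m by blast
qed

text \<open>\<open>weyl_sol\<close> is an arbitrary choice, so existence of a square-integrable
  solution comes first. \<open>weyl_quotient\<close> then applies to whichever solution was chosen;
  uniqueness up to multiples is never invoked.\<close>

lemma mL_tendsto_m_fun:
  assumes z: "0 < Im z"
  shows "((\<lambda>L. mL \<alpha> L z) \<longlongrightarrow> m_fun \<sigma> \<tau> \<alpha> z) at_top" "0 < Im (m_fun \<sigma> \<tau> \<alpha> z)"
proof -
  define \<psi> where "\<psi> = weyl_sol \<sigma> \<tau> z"
  have "\<exists>\<psi>. L2_halfline \<psi> \<and> (\<exists>x>0. \<psi> x \<noteq> 0) \<and> has_ell \<sigma> \<tau> \<psi> (\<lambda>x. z * \<psi> x)"
  proof -
    \<comment> \<open>The angle is arbitrary here, since square integrability does not involve the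
      boundary condition at 0; 0 is chosen.\<close>
    obtain m B where B: "\<And>b. 0 \<le> b \<Longrightarrow> integral {0..b} (\<lambda>x. (cmod (psU 0 z m x))\<^sup>2) \<le> B"
      using weyl_solution_exists[OF z] by blast
    have c: "continuous_on {0..b} (psU 0 z m)" for b by (rule is_sol_continuous(2)[OF ps_sol])
    \<comment> \<open>Nontriviality is demanded at some x > 0; otherwise continuity would give zero
      data at 0, against the Wronskian.\<close>
    have "\<exists>x>0. psU 0 z m x \<noteq> 0"
    proof (rule ccontr)
      assume "\<not> ?thesis"
      hence n: "\<And>x. 0 < x \<Longrightarrow> psU 0 z m x = 0" by blast
      have "val0 (\<lambda>x. 0) = psU 0 z m 0" by (rule val0_eq[OF c]) (use n in auto)
      moreover have "val0 (\<lambda>x. 0) = 0" using val0_eq[of "\<lambda>x. 0" "\<lambda>x. 0"] by simp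
      ultimately have n0: "psU 0 z m 0 = 0" by simp
      hence "psU 0 z m x = 0" if "x \<in> {0..1}" for x using n[of x] that by (cases "x = 0") auto
      hence "psV 0 z m 0 = 0" by (rule is_sol_zero[OF ps_sol zero_less_one])
      thus False using ps_ph_wronskian[of 0 0 z m] n0 by simp
    qed
    thus ?thesis using L2_halflineI[OF c B] is_sol_has_ell[OF ps_sol] by blast
  qed
  from someI_ex[OF this]
  have psi: "L2_halfline \<psi>" "\<exists>x>0. \<psi> x \<noteq> 0" "has_ell \<sigma> \<tau> \<psi> (\<lambda>x. z * \<psi> x)"
    unfolding \<psi>_def weyl_sol_def by blast+
  obtain V U where sol: "\<And>b. is_sol z 0 b V U" and eq: "\<And>x. 0 < x \<Longrightarrow> \<psi> x = U x" "\<And>x. 0 < x \<Longrightarrow> quasi_deriv \<sigma> \<psi> x = V x"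
    using has_ell_is_sol[OF psi(3)] by blast
  have Vc: "continuous_on {0..b} V" and Uc: "continuous_on {0..b} U" for b using is_sol_continuous[OF sol] by auto
  obtain x where x: "0 < x" "U x \<noteq> 0" using psi(2) eq(1) by fastforce
  note W = weyl_quotient[OF z sol L2_halfline_bound[OF psi(1) Uc eq(1)] x, of \<alpha>]
  have "val0 \<psi> = U 0" by (rule val0_eq[OF Uc eq(1)])
  moreover have "val0 (quasi_deriv \<sigma> \<psi>) = V 0" by (rule val0_eq[OF Vc eq(2)])
  ultimately have "m_fun \<sigma> \<tau> \<alpha> z = (of_real (cos \<alpha>) * V 0 - of_real (sin \<alpha>) * U 0) / (of_real (sin \<alpha>) * V 0 + of_real (cos \<alpha>) * U 0)"
    unfolding m_fun_def Let_def \<psi>_def by (simp add: cos_of_real sin_of_real)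
  thus "((\<lambda>L. mL \<alpha> L z) \<longlongrightarrow> m_fun \<sigma> \<tau> \<alpha> z) at_top" "0 < Im (m_fun \<sigma> \<tau> \<alpha> z)"
    using W by simp_all
qed

end

section \<open>The spectral measure\<close>

text \<open>Half-open intervals form an intersection-stable generator. The inner limits are
  determined only for \<delta> near 0, which suffices to determine the outer limit, hence the mass
  of each interval.\<close>

lemma is_spectral_measure_unique:
  assumes m: "is_spectral_measure \<sigma> \<tau> \<alpha> \<mu>" and n: "is_spectral_measure \<sigma> \<tau> \<alpha> \<nu>"
  shows "\<mu> = \<nu>"
proof (rule measure_eqI_generator_eq[where \<Omega>=UNIV and E="range (\<lambda>(a, b). {a<..b::real})" and A="\<lambda>n. {- real n<..real n}"])
  have S: "sets (borel :: real measure) = sigma_sets UNIV (range (\<lambda>(a, b). {a<..b::real}))"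
    unfolding borel_sigma_sets_Ioc by (rule sets_measure_of) simp
  show "sets \<mu> = sigma_sets UNIV (range (\<lambda>(a, b). {a<..b::real}))" "sets \<nu> = sigma_sets UNIV (range (\<lambda>(a, b). {a<..b::real}))"
    using m n S unfolding is_spectral_measure_def by auto
  show "Int_stable (range (\<lambda>(a, b). {a<..b::real}))"
    by (auto simp: Int_stable_def)
  have fin: "emeasure \<mu> {a<..b} < \<infinity>" "emeasure \<nu> {a<..b} < \<infinity>" if "a < b" for a b
    using m n that unfolding is_spectral_measure_def by blast+
  have eq: "emeasure \<mu> {a<..b} = emeasure \<nu> {a<..b}" for a b
  proof (cases "a < b")
    case True
    define I where "I \<delta> \<epsilon> = 1 / pi * (LINT E:{a+\<delta>..b+\<delta>}|lborel. Im (m_fun \<sigma> \<tau> \<alpha> (Complex E \<epsilon>)))" for \<delta> \<epsilon>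
    obtain L where L: "\<forall>\<^sub>F \<delta> in at_right 0. (I \<delta> \<longlongrightarrow> L \<delta>) (at_right 0)" "(L \<longlongrightarrow> measure \<mu> {a<..b}) (at_right 0)"
      using m True unfolding is_spectral_measure_def I_def by blast
    obtain L' where L': "\<forall>\<^sub>F \<delta> in at_right 0. (I \<delta> \<longlongrightarrow> L' \<delta>) (at_right 0)" "(L' \<longlongrightarrow> measure \<nu> {a<..b}) (at_right 0)"
      using n True unfolding is_spectral_measure_def I_def by blast
    have "\<forall>\<^sub>F \<delta> in at_right 0. L \<delta> = L' \<delta>"
      using L(1) L'(1)
    proof eventually_elim
      case (elim \<delta>)
      show ?case by (rule tendsto_unique[OF _ elim]) simp
    qed
    hence "(L' \<longlongrightarrow> measure \<mu> {a<..b}) (at_right 0)" using L(2) by (rule Lim_transform_eventually[rotated])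
    hence "measure \<mu> {a<..b} = measure \<nu> {a<..b}" by (intro tendsto_unique[OF _ _ L'(2)]) auto
    moreover have "emeasure \<mu> {a<..b} = ennreal (measure \<mu> {a<..b})" "emeasure \<nu> {a<..b} = ennreal (measure \<nu> {a<..b})"
      using fin[OF True] by (auto intro!: emeasure_eq_ennreal_measure)
    ultimately show ?thesis by simp
  qed simp
  thus "\<And>X. X \<in> range (\<lambda>(a, b). {a<..b::real}) \<Longrightarrow> emeasure \<mu> X = emeasure \<nu> X" by auto
  show "emeasure \<mu> {- real n<..real n} \<noteq> \<infinity>" for n
    using fin(1)[of "- real n" "real n"] by (cases "n = 0") auto
  show "(\<Union>n. {- real n<..real n}) = UNIV"
  proof (intro UNIV_eq_I[symmetric])
    fix x :: real
    obtain n where "\<bar>x\<bar> < real n" using reals_Archimedean2 by blast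
    thus "x \<in> (\<Union>n. {- real n<..real n})" by (intro UN_I[of n]) auto
  qed
qed auto

text \<open>A finite level strictly above the lower limit is undercut arbitrarily far out, in
  particular at some X n >= n.\<close>

lemma Liminf_finite_imp_bounded_sequence:
  fixes f :: "real \<Rightarrow> ennreal"
  assumes "Liminf at_top f < \<infinity>"
  obtains X C where "filterlim X at_top sequentially" "\<And>n. 0 \<le> X n" "0 \<le> C" "\<And>n::nat. f (X n) \<le> ennreal C"
proof -
  obtain c where c: "Liminf at_top f < c" "c < \<infinity>" using assms dense by blast
  have "\<exists>x\<ge>real n. f x < c" for n
  proof (rule ccontr)
    assume "\<not> ?thesis"
    hence ge: "c \<le> f x" if "real n \<le> x" for x using that by (meson not_less)
    have "\<forall>\<^sub>F x in at_top. c \<le> f x" using eventually_ge_at_top[of "real n"] by eventually_elim (rule ge)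
    hence "c \<le> Liminf at_top f" by (rule Liminf_bounded)
    thus False using c(1) by simp
  qed
  then obtain X where X: "\<And>n. real n \<le> X n" "\<And>n. f (X n) < c" by metis
  have "filterlim X at_top sequentially"
    by (rule filterlim_at_top_mono[OF filterlim_real_sequentially]) (use X(1) in auto)
  moreover have "0 \<le> X n" for n using X(1)[of n] by (meson of_nat_0_le_iff order_trans)
  moreover have "f (X n) \<le> ennreal (enn2real c)" for n
    using X(2)[of n] c(2) by (simp add: ennreal_enn2real_if less_imp_le)
  ultimately show ?thesis using that enn2real_nonneg by blast
qed

theorem theorem1p5:
  fixes \<sigma> \<tau> :: "real \<Rightarrow> real" and \<alpha> E\<^sub>1 E\<^sub>2 p :: real
  assumes "\<sigma> \<in> borel_measurable (lebesgue_on {0<..})"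
    and "\<tau> \<in> borel_measurable (lebesgue_on {0<..})"
    and "(SUP x\<in>{0<..}. \<integral>\<^sup>+t\<in>{x..x+1}. ennreal ((\<sigma> t)\<^sup>2) \<partial>lebesgue) < \<infinity>"
    and "(SUP x\<in>{0<..}. \<integral>\<^sup>+t\<in>{x..x+1}. ennreal \<bar>\<tau> t\<bar> \<partial>lebesgue) < \<infinity>"
    and "0 \<le> \<alpha>" and "\<alpha> < pi"
    and "E\<^sub>1 < E\<^sub>2"
    and "2 < p"
    and "Liminf at_top (\<lambda>x. \<integral>\<^sup>+E\<in>{E\<^sub>1..E\<^sub>2}.
           ennreal (mat_norm (transfer_matrix \<sigma> \<tau> (complex_of_real E) x) powr p) \<partial>lborel) < \<infinity>"
  shows "purely_ac_spectrum_on \<sigma> \<tau> \<alpha> {E\<^sub>1<..<E\<^sub>2}"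
proof -
  obtain K where K: "sturm_unif (zero_ext \<sigma>) (zero_ext (\<lambda>x. \<tau> x - (\<sigma> x)\<^sup>2)) K"
    using sturm_unif_zero_ext[OF assms(1-4)] by blast
  interpret sturm_pair \<sigma> \<tau> K by (rule sturm_pair.intro[OF K])
  obtain X C where X: "filterlim X at_top sequentially" "\<And>n. 0 \<le> X n" and C: "0 \<le> C"
    "\<And>n::nat. (\<integral>\<^sup>+E\<in>{E\<^sub>1..E\<^sub>2}. ennreal (mat_norm (transfer_matrix \<sigma> \<tau> (complex_of_real E) (X n)) powr p) \<partial>lborel) \<le> ennreal C"
    using Liminf_finite_imp_bounded_sequence[OF assms(9)] by blast
  define h where "h n = mL \<alpha> (X n)" for n
  have hol: "\<exists>S. open S \<and> {z. 0 \<le> Im z} \<subseteq> S \<and> h n holomorphic_on S" for n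
    unfolding h_def by (rule mL_holomorphic[OF X(2)])
  have pos: "0 < Im (h n z)" if "0 \<le> Im z" for n z
    unfolding h_def by (rule Im_mL_pos[OF that X(2)])
  have lim: "(\<lambda>n. h n z) \<longlonglongrightarrow> m_fun \<sigma> \<tau> \<alpha> z" if "0 < Im z" for z
    unfolding h_def by (rule filterlim_compose[OF mL_tendsto_m_fun(1)[OF that] X(1)])
  \<comment> \<open>Since Im of \<open>mL\<close> is at most the squared norm, its power p / 2 is at
    most the p-th power of the norm, whose integral is bounded along \<open>X\<close>.\<close>
  have bd: "integral {E\<^sub>1..E\<^sub>2} (\<lambda>t. Im (h n (of_real t)) powr (p / 2)) \<le> C" for n
  proof -
    let ?f = "\<lambda>t. Im (h n (complex_of_real t)) powr (p / 2)"
    obtain S where S: "open S" "{z. 0 \<le> Im z} \<subseteq> S" "h n holomorphic_on S" using hol by blast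
    have "continuous_on {E\<^sub>1..E\<^sub>2} (h n \<circ> complex_of_real)"
      by (intro continuous_on_compose continuous_intros continuous_on_subset[OF holomorphic_on_imp_continuous_on[OF S(3)]])
        (use S(2) in auto)
    hence "continuous_on {E\<^sub>1..E\<^sub>2} (\<lambda>t. Im (h n (complex_of_real t)))" unfolding comp_def by (intro continuous_intros)
    moreover have "Im (h n (complex_of_real t)) \<noteq> 0" for t using pos[of "complex_of_real t" n] by simp
    ultimately have "continuous_on {E\<^sub>1..E\<^sub>2} ?f" by (intro continuous_on_powr continuous_on_const) auto
    hence "?f integrable_on {E\<^sub>1..E\<^sub>2}" by (rule integrable_continuous_interval)
    from nn_integral_has_integral_lebesgue[OF _ integrable_integral[OF this]]
    have "ennreal (integral {E\<^sub>1..E\<^sub>2} ?f) = (\<integral>\<^sup>+t. ennreal (indicator {E\<^sub>1..E\<^sub>2} t * ?f t) \<partial>lborel)" by simp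
    also have "\<dots> \<le> (\<integral>\<^sup>+E\<in>{E\<^sub>1..E\<^sub>2}. ennreal (mat_norm (transfer_matrix \<sigma> \<tau> (complex_of_real E) (X n)) powr p) \<partial>lborel)"
    proof (rule nn_integral_mono)
      fix t
      let ?N = "mat_norm (transfer_matrix \<sigma> \<tau> (complex_of_real t) (X n))"
      have le: "Im (h n (of_real t)) \<le> ?N\<^sup>2" unfolding h_def by (rule Im_mL_le_transfer_matrix[OF X(2)])
      have i: "0 < Im (h n (of_real t))" using pos[of "complex_of_real t" n] by simp
      have N0: "0 \<le> ?N"
      proof -
        have "(norm (vector [1, 0] :: complex^2))\<^sup>2 = 1" by (simp add: norm_vector_2)
        hence v: "0 < norm (vector [1, 0] :: complex^2)" by (metis norm_ge_zero less_eq_real_def zero_neq_one power_zero_numeral)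
        have "0 \<le> norm (transfer_matrix \<sigma> \<tau> (complex_of_real t) (X n) *v vector [1, 0])" by simp
        also have "\<dots> \<le> ?N * norm (vector [1, 0] :: complex^2)" by (rule norm_matrix_vector_le)
        finally show ?thesis using v by (simp add: zero_le_mult_iff)
      qed
      \<comment> \<open>Strict positivity of the norm allows its square to be rewritten as a real
        power.\<close>
      have "?N\<^sup>2 > 0" using le i by linarith
      hence N: "0 < ?N" using N0 by (metis less_eq_real_def power_zero_numeral less_irrefl)
      have "?f t \<le> (?N\<^sup>2) powr (p / 2)" using le i assms(8) by (intro powr_mono2) auto
      also have "?N\<^sup>2 = ?N powr 2" using N by (simp add: powr_numeral)
      also have "(?N powr 2) powr (p / 2) = ?N powr p" by (simp add: powr_powr)
      finally have "?f t \<le> ?N powr p" .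
      thus "ennreal (indicator {E\<^sub>1..E\<^sub>2} t * ?f t) \<le> ennreal (?N powr p) * indicator {E\<^sub>1..E\<^sub>2} t"
        by (auto simp: indicator_def)
    qed
    also have "\<dots> \<le> ennreal C" by (rule C(2))
    finally show ?thesis using C(1) by simp
  qed
  have q: "1 < p / 2" using assms(8) by simp
  have A: "0 < Im (m_fun \<sigma> \<tau> \<alpha> \<i>)" using mL_tendsto_m_fun(2)[of \<i> \<alpha>] by simp
  obtain \<nu> where nu: "real_distribution \<nu>" "AE \<theta> in \<nu>. \<theta> \<in> {0..2*pi}"
    and rep: "\<And>w. cmod w < 1 \<Longrightarrow> Im (m_fun \<sigma> \<tau> \<alpha> (cayley w)) = Im (m_fun \<sigma> \<tau> \<alpha> \<i>) * integral\<^sup>L \<nu> (poisson w)"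
    and null: "\<And>N. N \<in> null_sets lborel \<Longrightarrow> N \<subseteq> {pi + 2 * arctan E\<^sub>1<..<pi + 2 * arctan E\<^sub>2} \<Longrightarrow> emeasure \<nu> N = 0"
    using herglotz_disc_limit[OF hol pos[OF less_imp_le] lim A less_imp_le[OF assms(7)] q bd] by blast
  from herglotz_spectral_measure[OF nu, of "\<lambda>z. Im (m_fun \<sigma> \<tau> \<alpha> z)", OF rep A null]
  obtain \<mu> where "is_spectral_measure \<sigma> \<tau> \<alpha> \<mu> \<and> (\<forall>N\<in>null_sets lborel. N \<subseteq> {E\<^sub>1<..<E\<^sub>2} \<longrightarrow> emeasure \<mu> N = 0)"
    unfolding is_spectral_measure_def conj_assoc by (rule exE)
  hence mu: "is_spectral_measure \<sigma> \<tau> \<alpha> \<mu>"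
    and null\<mu>: "\<And>N. N \<in> null_sets lborel \<Longrightarrow> N \<subseteq> {E\<^sub>1<..<E\<^sub>2} \<Longrightarrow> emeasure \<mu> N = 0" by simp_all
  \<comment> \<open>The definite description denotes the constructed measure because spectral
    measures are unique.\<close>
  have sp: "spectral_measure \<sigma> \<tau> \<alpha> = \<mu>"
    unfolding spectral_measure_def by (rule the_equality[where P="is_spectral_measure \<sigma> \<tau> \<alpha>", OF mu]) (erule is_spectral_measure_unique[OF _ mu])
  have sets: "sets \<mu> = sets borel" using mu unfolding is_spectral_measure_def by blast
  show ?thesis
    unfolding purely_ac_spectrum_on_def sp absolutely_continuous_def
  proof
    fix N assume "N \<in> null_sets (restrict_space lborel {E\<^sub>1<..<E\<^sub>2})"
    hence N: "N \<in> null_sets lborel" "N \<subseteq> {E\<^sub>1<..<E\<^sub>2}" by (auto simp: null_sets_restrict_space)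
    have "N \<in> null_sets \<mu>" using null\<mu>[OF N] null_setsD2[OF N(1)] sets by (intro null_setsI) auto
    thus "N \<in> null_sets (restrict_space \<mu> {E\<^sub>1<..<E\<^sub>2})"
      using N(2) sets sets_eq_imp_space_eq[OF sets] by (subst null_sets_restrict_space) auto
  qed
qed

end
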